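(* Let $n\ge3$ and let $k$ be a positive integer. Let cubature rules $(X_{2t},W_{2t})$ for $\mu$ of algebraic degree $2t$ be given for every integer $t$, and let $(h_s)_{s\in\mathbb{N}}$ be a sequence of univariate polynomials which are nonnegative on $[-1,1]$, with $d_s:=\deg(h_s)$. Let $A_s^*\subseteq R_{2k}^*$ be the convex cone generated by the operators \[L_y:=\left\langle\sum_{j=0}^k\lambda_{2j}^{(s)}\|x\|^{2(k-j)}\phi_y^{2j}(x),\ \bullet\right\rangle,\qquad y\in X_{2(k+d_s)}.\] Then: (1) The sets $(A_s^* )_{s\in\mathbb{N}}$ are polyhedral cones satisfying $R_{2k}^*\supseteq A_s^*\supseteq P_{2k}^*$. Furthermore $A_s^*$ is the dual cone to $A_s$. (2) If $\lim_{s\to\infty}\tau_{2k}(h_s)=0$ then the hierarchy $(A_s^* )_{s\in\mathbb{N}}$ converges to $P_{2k}^*$ in the sense that the following equality holds: \[\bigcap_{s=0}^\infty A_s^*=P_{2k}^*.\]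
   Context: $S\subseteq\mathbb{R}^n$ is the unit sphere, $\mu$ is the $(n-1)$-dimensional area measure on $S$, $R_d\subseteq\mathbb{R}[x_1,\dots,x_n]$ is the space of homogeneous polynomials of degree $d$, $H_d\subseteq R_d$ is the subspace of harmonic ones, $P_{2k}\subseteq R_{2k}$ is the cone of forms nonnegative on $S$, and $\langle f,g\rangle=\int_Sfg\,d\mu$. $R_{2k}^*$ is the dual vector space of $R_{2k}$, and the dual cone of $C\subseteq R_{2k}$ is $C^*=\{\ell\in R_{2k}^*:\ell(f)\ge0\ \forall f\in C\}$; $P_{2k}^*$ is the dual cone of $P_{2k}$. A cubature rule of algebraic degree $2t$ for $\mu$ is a pair $(X,W)$ with $X\subseteq S$ finite and $W:X\to\mathbb{R}_{>0}$ such that $\int_S f\,d\mu=\sum_{x\in X}W(x)f(x)$ for every $f\in R_{2t}$. With $\alpha=\frac{n-2}{2}$, the Gegenbauer polynomials are given by $C_0^{(\alpha)}(t)=1$, $C_1^{(\alpha)}(t)=2\alpha t$, $C_j^{(\alpha)}(t)=\frac1j[2t(j+\alpha-1)C_{j-1}^{(\alpha)}(t)-(j+2\alpha-2)C_{j-2}^{(\alpha)}(t)]$ for $j\ge2$, and the normalized ones are $g_j(t)=\frac{\dim(H_j)}{\mu(S)C_j^{(\alpha)}(1)}C_j^{(\alpha)}(t)$. For $y\in S$, $\phi_y^{j}(x)=\|x\|^{j}g_j(\langle x/\|x\|,y\rangle)\in H_j$; it is the element of $H_j$ representing evaluation at $y$, i.e. $\langle f,\phi_y^j\rangle=f(y)$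 for $f\in H_j$. The numbers $\lambda_j^{(s)}$ are the coefficients in the expansion $h_s=\sum_j\lambda_j^{(s)}g_j$ (with $\lambda_j^{(s)}=0$ for $j>d_s$). The Frobenius threshold is $\tau_{2k}(h_s)=\sqrt{\sum_{j=0}^k\dim(H_{2j})\left(\frac{1}{\lambda_{2j}^{(s)}}-1\right)^2}$. For a univariate polynomial $h(t)=\sum_ia_it^i$, $\hat{\Gamma}_h:R_{2k}\to R_{2k}$ is $\hat{\Gamma}_h(f)(x)=\sum_ja_{2j}\|x\|^{2(k-j)}\int_S\langle x,y\rangle^{2j}f(y)\,d\mu(y)$ (only even-degree coefficients enter; for $j>k$ this is division by $\|x\|^{2(j-k)}$, and the quotient is a polynomial). $A_s:=\hat{\Gamma}_{h_s}(Q_s)$, where $Q_s=\{F\in R_{2k}:F(x)\ge0\ \forall x\in X_{2(k+d_s)}\}$.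
   Formalization: L_y is taken with 1/λ_{2j}^{(s)} in place of λ_{2j}^{(s)}, and λ_{2j}^{(s)}≠0 is assumed for all s and j≤k; as printed (1) fails: for h_s=1 the cone A_s^* is the single ray of f↦∫_S f dμ and does not contain P_{2k}^*. *)

theory Defs
  imports
    "HOL-Analysis.Analysis"
    "HOL-Library.Function_Algebras"
    "HOL-Computational_Algebra.Polynomial"
begin

text \<open>Pointwise real vector space structure on functions, so that \<open>dim\<close>, \<open>linear\<close>, \<open>hull\<close>
  etc. apply to spaces of forms and to spaces of functionals on them.\<close>

instantiation "fun" :: (type, real_vector) real_vector
begin

definition scaleR_fun :: "real \<Rightarrow> ('a \<Rightarrow> 'b) \<Rightarrow> 'a \<Rightarrow> 'b"
  where "scaleR_fun c f = (\<lambda>x. c *\<^sub>R f x)"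

instance
  by standard (auto simp: scaleR_fun_def fun_eq_iff scaleR_add_right scaleR_add_left)

end


subsection \<open>Forms\<close>

text \<open>Real polynomials in the coordinates are identified with the functions they define on
  \<open>real ^ 'n\<close>; this loses nothing, the reals being infinite. The exponent vectors \<open>e\<close> of
  total degree \<open>d\<close> are finite in number.\<close>

definition forms :: "nat \<Rightarrow> ((real ^ 'n) \<Rightarrow> real) set"
  where "forms d =
    {f. \<exists>c :: ('n \<Rightarrow> nat) \<Rightarrow> real.
          f = (\<lambda>x. \<Sum>e | (\<Sum>i\<in>UNIV. e i) = d. c e * (\<Prod>i\<in>UNIV. (x $ i) ^ e i))}"

definition laplacian :: "((real ^ 'n) \<Rightarrow> real) \<Rightarrow> (real ^ 'n) \<Rightarrow> real"
  where "laplacian f x = (\<Sum>i\<in>UNIV. (deriv ^^ 2) (\<lambda>t. f (x + t *\<^sub>R axis i 1)) 0)"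

definition harmonic_forms :: "nat \<Rightarrow> ((real ^ 'n) \<Rightarrow> real) set"
  where "harmonic_forms d = {f \<in> forms d. \<forall>x. laplacian f x = 0}"

definition nonneg_forms_on :: "nat \<Rightarrow> (real ^ 'n) set \<Rightarrow> ((real ^ 'n) \<Rightarrow> real) set"
  where "nonneg_forms_on d X = {f \<in> forms d. \<forall>x\<in>X. f x \<ge> 0}"


subsection \<open>Integration on the sphere\<close>

text \<open>Area measure in polar coordinates: the area of \<open>A\<close> is \<open>n\<close> times the volume of the
  part of the unit ball lying over \<open>A\<close>. The origin is removed only to make the radial projection
  land in the sphere.\<close>

definition area :: "(real ^ 'n) measure"
  where "area =
    scale_measure (of_nat CARD('n))
      (distr (restrict_space lborel (ball 0 1 - {0})) (restrict_space borel (sphere 0 1))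
        (\<lambda>x. x /\<^sub>R norm x))"

definition sph_inner :: "((real ^ 'n) \<Rightarrow> real) \<Rightarrow> ((real ^ 'n) \<Rightarrow> real) \<Rightarrow> real"
  where "sph_inner f g = (LINT x|area. f x * g x)"

definition cubature :: "nat \<Rightarrow> (real ^ 'n) set \<Rightarrow> ((real ^ 'n) \<Rightarrow> real) \<Rightarrow> bool"
  where "cubature d X W \<longleftrightarrow>
    X \<subseteq> sphere 0 1 \<and> finite X \<and> (\<forall>x\<in>X. W x > 0) \<and>
    (\<forall>f\<in>forms d. (LINT x|area. f x) = (\<Sum>x\<in>X. W x * f x))"


subsection \<open>Gegenbauer polynomials and expansions\<close>

fun gegenbauer :: "real \<Rightarrow> nat \<Rightarrow> real poly" where
  "gegenbauer \<alpha> 0 = 1"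
| "gegenbauer \<alpha> (Suc 0) = [:0, 2 * \<alpha>:]"
| "gegenbauer \<alpha> (Suc (Suc j)) =
    smult (1 / real (j + 2))
      ([:0, 2 * (real (j + 2) + \<alpha> - 1):] * gegenbauer \<alpha> (Suc j)
        - smult (real (j + 2) + 2 * \<alpha> - 2) (gegenbauer \<alpha> j))"

text \<open>The type argument carries the dimension \<open>n = CARD('n)\<close>.\<close>

definition gegenbauer_norm :: "'n::finite itself \<Rightarrow> nat \<Rightarrow> real poly"
  where "gegenbauer_norm N j =
    (let C = gegenbauer ((real CARD('n) - 2) / 2) j
     in smult (real (dim (harmonic_forms j :: ((real ^ 'n) \<Rightarrow> real) set))
                / (measure (area :: (real ^ 'n) measure) (sphere 0 1) * poly C 1)) C)"

definition zonal :: "nat \<Rightarrow> real ^ 'n \<Rightarrow> (real ^ 'n) \<Rightarrow> real"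
  where "zonal j y x = norm x ^ j * poly (gegenbauer_norm TYPE('n) j) (inner (x /\<^sub>R norm x) y)"

definition gegenbauer_coeff :: "'n::finite itself \<Rightarrow> real poly \<Rightarrow> nat \<Rightarrow> real"
  where "gegenbauer_coeff N h =
    (THE l. (\<forall>j>degree h. l j = 0) \<and>
            h = (\<Sum>j\<le>degree h. smult (l j) (gegenbauer_norm N j)))"

definition frobenius_threshold :: "'n::finite itself \<Rightarrow> nat \<Rightarrow> real poly \<Rightarrow> real"
  where "frobenius_threshold N k h =
    sqrt (\<Sum>j\<le>k. real (dim (harmonic_forms (2 * j) :: ((real ^ 'n) \<Rightarrow> real) set))
                  * (1 / gegenbauer_coeff N h (2 * j) - 1)\<^sup>2)"


subsection \<open>The cones in the space of forms\<close>

text \<open>The exponent is an integer and may be negative. At \<open>x = 0\<close> every summand then has the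
  value 0 when \<open>k > 0\<close>, in agreement with the polynomial quotient, a form of degree \<open>2 * k\<close>.\<close>

definition Gamma_hat :: "nat \<Rightarrow> real poly \<Rightarrow> ((real ^ 'n) \<Rightarrow> real) \<Rightarrow> (real ^ 'n) \<Rightarrow> real"
  where "Gamma_hat k h f x =
    (\<Sum>j\<le>degree h div 2. coeff h (2 * j) * (norm x powi (2 * (int k - int j)))
        * (LINT y|area. inner x y ^ (2 * j) * f y))"

definition inner_cone :: "nat \<Rightarrow> real poly \<Rightarrow> (real ^ 'n) set \<Rightarrow> ((real ^ 'n) \<Rightarrow> real) set"
  where "inner_cone k h X = Gamma_hat k h ` nonneg_forms_on (2 * k) X"


subsection \<open>Dual space and dual cones\<close>

text \<open>A linear functional on \<open>forms d\<close> is represented by its extension by 0 to all functions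
  (a junk value, not a linear extension), so that distinct elements of the set below are distinct
  functionals and the pointwise operations are those of the dual space.\<close>

definition dual_space :: "nat \<Rightarrow> (((real ^ 'n) \<Rightarrow> real) \<Rightarrow> real) set"
  where "dual_space d =
    {l. (\<forall>f\<in>forms d. \<forall>g\<in>forms d. l (f + g) = l f + l g) \<and>
        (\<forall>c. \<forall>f\<in>forms d. l (c *\<^sub>R f) = c * l f) \<and>
        (\<forall>f. f \<notin> forms d \<longrightarrow> l f = 0)}"

definition dual_cone ::
    "nat \<Rightarrow> ((real ^ 'n) \<Rightarrow> real) set \<Rightarrow> (((real ^ 'n) \<Rightarrow> real) \<Rightarrow> real) set"
  where "dual_cone d C = {l \<in> dual_space d. \<forall>f\<in>C. l f \<ge> 0}"

text \<open>Polyhedral cone in a subspace \<open>V\<close>: a finite intersection of closed linear half-spaces.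
  Linear functionals on \<open>V\<close> are exactly the restrictions of those on the ambient space.\<close>

definition polyhedral_cone_in :: "'v::real_vector set \<Rightarrow> 'v set \<Rightarrow> bool"
  where "polyhedral_cone_in V K \<longleftrightarrow>
    (\<exists>\<Phi> :: ('v \<Rightarrow> real) set. finite \<Phi> \<and> (\<forall>\<phi>\<in>\<Phi>. linear \<phi>) \<and>
        K = {v \<in> V. \<forall>\<phi>\<in>\<Phi>. \<phi> v \<ge> 0})"

text \<open>The coefficients are the reciprocals of the Gegenbauer coefficients \<open>\<lambda>\<^sub>2\<^sub>j\<close> of \<open>h\<close>.
  On the degree \<open>2 * j\<close> harmonic component \<open>Gamma_hat k h\<close> is multiplication by \<open>\<lambda>\<^sub>2\<^sub>j\<close>, so a
  functional \<open>l\<close> is nonnegative on \<open>inner_cone k h X\<close> iff its composition with \<open>Gamma_hat k h\<close>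
  is a nonnegative combination of evaluations at points of \<open>X\<close>; \<open>dual_generator k h y\<close> is
  evaluation at \<open>y\<close> composed with the inverse of \<open>Gamma_hat k h\<close>. With \<open>\<lambda>\<^sub>2\<^sub>j\<close> in place of its
  reciprocal one gets evaluation at \<open>y\<close> composed with \<open>Gamma_hat k h\<close> itself; for \<open>h\<close>
  nonnegative on \<open>[-1, 1]\<close> these generate a polyhedral subcone of the dual of the nonnegative
  forms, which cannot contain that (non-polyhedral) dual cone. The definition is meaningful only
  if \<open>\<lambda>\<^sub>2\<^sub>j\<close> is nonzero for all \<open>j \<le> k\<close>.\<close>

definition dual_generator ::
    "nat \<Rightarrow> real poly \<Rightarrow> real ^ 'n \<Rightarrow> ((real ^ 'n) \<Rightarrow> real) \<Rightarrow> real"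
  where "dual_generator k h y =
    (\<lambda>f. if f \<in> forms (2 * k)
         then sph_inner
           (\<lambda>x. \<Sum>j\<le>k. 1 / gegenbauer_coeff TYPE('n) h (2 * j)
                        * norm x ^ (2 * (k - j)) * zonal (2 * j) y x) f
         else 0)"

definition outer_dual_cone ::
    "nat \<Rightarrow> real poly \<Rightarrow> (real ^ 'n) set \<Rightarrow> (((real ^ 'n) \<Rightarrow> real) \<Rightarrow> real) set"
  where "outer_dual_cone k h X = convex_cone hull (dual_generator k h ` X)"

end

theory Submission
  imports Defs
begin

text \<open>Write \<open>f = (\<Sum>j\<le>k. norm x ^ (2 * (k - j)) * F j x)\<close> with \<open>F j\<close> harmonic of degree \<open>2 * j\<close>. By the
  reproducing property of zonal harmonics, \<open>Gamma_hat k h\<close> multiplies \<open>F j\<close> by the Gegenbauer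
  coefficient \<open>\<lambda>\<^sub>2\<^sub>j\<close> of \<open>h\<close>, and \<open>dual_generator k h y\<close> is evaluation at \<open>y\<close> after dividing by
  these coefficients. Hence the inner cone is the set of forms on which the finitely many generators
  are nonnegative, and Farkas' lemma identifies its dual. Exactness of the cubature rule makes
  the inner cone consist of forms nonnegative on the sphere. If the thresholds tend to 0 then all
  \<open>\<lambda>\<^sub>2\<^sub>j\<close> tend to 1, so the images under \<open>Gamma_hat\<close> of a form converge to it.

  All facts on spherical harmonics rest on one integration by parts: up to a positive factor depending
  only on \<open>d\<close>, the integrals over the sphere of \<open>x $ i * g x\<close> and of the \<open>i\<close>-th partial
  derivative of \<open>g\<close> agree for all forms \<open>g\<close> of degree \<open>d\<close>.\<close>


subsection \<open>Forms and partial derivatives\<close>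

text \<open>\<open>area\<close> is the push-forward of volume under radial projection, so sphere
  integrals are reached through volume integrals over the ball. Homogeneity is the bridge: for a
  form of degree \<open>d\<close>, the ball integral with weight \<open>norm x ^ p\<close> is the
  sphere integral divided by \<open>CARD('n) + d + p\<close>. Comparing the weights
  \<open>p = 0, 2, 4\<close> turns translation invariance of volume into the integration by parts on
  the sphere.

  A second device recurs: multiplying by an even power of \<open>norm x\<close> changes the degree
  but no value on the sphere. It lets forms of different degrees be compared, makes residues of
  projections harmonic, and pads an integrand to the exact degree of the cubature rule.

  The constant in the reproducing property is not computed from Gegenbauer integrals. The recurrence
  gives the property up to an unknown positive factor, the same for all poles \<open>y\<close>; a
  trace identity then matches this factor with the normalisation of
  \<open>gegenbauer_norm\<close>.\<close>

definition monomial :: "('n::finite \<Rightarrow> nat) \<Rightarrow> real ^ 'n \<Rightarrow> real"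
  where "monomial e x = (\<Prod>i\<in>UNIV. (x $ i) ^ e i)"

lemma finite_exponents: "finite {e :: 'n::finite \<Rightarrow> nat. (\<Sum>i\<in>UNIV. e i) = d}"
proof -
  have "{e :: 'n \<Rightarrow> nat. (\<Sum>i\<in>UNIV. e i) = d} \<subseteq> UNIV \<rightarrow>\<^sub>E {..d}"
  proof
    fix e :: "'n \<Rightarrow> nat" assume "e \<in> {e. (\<Sum>i\<in>UNIV. e i) = d}"
    then have "e i \<le> d" for i
      using member_le_sum[of i UNIV e] by auto
    then show "e \<in> UNIV \<rightarrow>\<^sub>E {..d}" by (auto simp: PiE_def extensional_def)
  qed
  then show ?thesis by (rule finite_subset) (auto intro: finite_PiE)
qed

lemma forms_altdef:
  "f \<in> forms d \<longleftrightarrow> (\<exists>c. f = (\<lambda>x. \<Sum>e | (\<Sum>i\<in>UNIV. e i)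
      = d. c e * monomial e x))"
  by (simp add: forms_def monomial_def)

lemma forms_zero [simp]: "(\<lambda>_. 0) \<in> forms d"
  unfolding forms_altdef by (rule exI[of _ "\<lambda>_. 0"]) simp

lemma forms_add: "f \<in> forms d \<Longrightarrow> g \<in> forms d \<Longrightarrow> (\<lambda>x. f x
    + g x) \<in> forms d"
  unfolding forms_altdef
  apply (elim exE)
  subgoal for c c' by (rule exI[of _ "\<lambda>e. c e + c' e"]) (simp add: sum.distrib distrib_right)
  done

lemma forms_cmult: "f \<in> forms d \<Longrightarrow> (\<lambda>x. a * f x) \<in> forms d"
  unfolding forms_altdef
  apply (elim exE)
  subgoal for c by (rule exI[of _ "\<lambda>e. a * c e"]) (simp add: sum_distrib_left mult.assoc)
  done

lemma forms_diff: "f \<in> forms d \<Longrightarrow> g \<in> forms d \<Longrightarrow> (\<lambda>x. f x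
    - g x) \<in> forms d"
  using forms_add[of f d "\<lambda>x. (- 1) * g x"] forms_cmult[of g d "- 1"] by simp

lemma forms_sum: "(\<And>a. a \<in> A \<Longrightarrow> f a \<in> forms d)
    \<Longrightarrow> (\<lambda>x. \<Sum>a\<in>A. f a x) \<in> forms d"
  by (induction A rule: infinite_finite_induct) (auto intro: forms_add)

lemma forms_monomial: "(\<Sum>i\<in>UNIV. e i) = d \<Longrightarrow> monomial e \<in> forms d"
  unfolding forms_altdef
proof (intro exI[of _ "\<lambda>e'. if e' = e then 1 else 0"] ext)
  fix x :: "real ^ 'a" assume e: "(\<Sum>i\<in>UNIV. e i) = d"
  have "(\<Sum>e' | (\<Sum>i\<in>UNIV. e' i) = d. (if e' = e then 1 else 0) * monomial e' x)
      = (\<Sum>e' | (\<Sum>i\<in>UNIV. e' i) = d. if e' = e then monomial e' x else 0)"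
    by (intro sum.cong) auto
  also have "\<dots> = monomial e x"
    by (subst sum.delta[OF finite_exponents]) (simp add: e)
  finally show "monomial e x
      = (\<Sum>e' | (\<Sum>i\<in>UNIV. e' i) = d. (if e' = e then 1 else 0) * monomial e' x)" ..
qed

lemma forms_const: "(\<lambda>_. c) \<in> forms 0"
proof -
  have "monomial (\<lambda>_. 0) \<in> forms 0" by (rule forms_monomial) simp
  from forms_cmult[OF this, of c] show ?thesis by (simp add: monomial_def)
qed

lemma monomial_Suc: "monomial (e(i := Suc (e i))) x = x $ i * monomial e x"
proof -
  have "monomial (e(i := Suc (e i))) x = (x $ i) ^ Suc (e i) * (\<Prod>j\<in>UNIV - {i}. (x $ j) ^ e j)"
    unfolding monomial_def by (subst prod.remove[of _ i]) (auto intro!: prod.cong)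
  moreover have "monomial e x = (x $ i) ^ e i * (\<Prod>j\<in>UNIV - {i}. (x $ j) ^ e j)"
    unfolding monomial_def by (subst prod.remove[of _ i]) auto
  ultimately show ?thesis by simp
qed

lemma sum_exponents_Suc:
  fixes e :: "'n::finite \<Rightarrow> nat"
  shows "(\<Sum>j\<in>UNIV. (e(i := Suc (e i))) j) = Suc (\<Sum>j\<in>UNIV. e j)"
proof -
  have "(\<Sum>j\<in>UNIV. (e(i := Suc (e i))) j) = Suc (e i) + (\<Sum>j\<in>UNIV - {i}. e j)"
    by (subst sum.remove[of _ i]) (auto intro!: sum.cong)
  also have "\<dots> = Suc (\<Sum>j\<in>UNIV. e j)"
    by (subst sum.remove[of _ i]) auto
  finally show ?thesis .
qed

lemma forms_coord_mult:
  assumes "q \<in> forms d"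
  shows "(\<lambda>x. x $ i * q x) \<in> forms (Suc d)"
proof -
  obtain c where q: "q = (\<lambda>x. \<Sum>e | (\<Sum>i\<in>UNIV. e i) = d. c e * monomial e x)"
    using assms forms_altdef by blast
  have "(\<lambda>x. x $ i * q x)
      = (\<lambda>x. \<Sum>e | (\<Sum>i\<in>UNIV. e i) = d. c e * monomial (e(i := Suc (e i))) x)"
    by (simp add: q monomial_Suc sum_distrib_left mult_ac fun_eq_iff)
  also have "\<dots> \<in> forms (Suc d)"
    by (intro forms_sum forms_cmult forms_monomial) (simp only: sum_exponents_Suc mem_Collect_eq)
  finally show ?thesis .
qed

text \<open>Constants, sums and multiplication by a coordinate generate all forms. Continuity,
  homogeneity, differentiability, Euler's identity and the symmetry of second derivatives then
  follow by checking three cases, with no exponent vectors in sight.\<close>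

lemma forms_induct [consumes 1, case_names const add coord]:
  assumes "f \<in> forms d"
    and const: "\<And>c. P 0 (\<lambda>_. c)"
    and add: "\<And>d f g. f \<in> forms d \<Longrightarrow> g \<in> forms d \<Longrightarrow> P d f
        \<Longrightarrow> P d g \<Longrightarrow> P d (\<lambda>x. f x + g x)"
    and coord: "\<And>d i q. q \<in> forms d \<Longrightarrow> P d q
        \<Longrightarrow> P (Suc d) (\<lambda>x. x $ i * q x)"
  shows "P d f"
proof -
  have mono: "P d (\<lambda>x. c * monomial e x)" if "(\<Sum>i\<in>UNIV. e i) = d" for c e d
    using that
  proof (induction d arbitrary: e)
    case 0
    then show ?case using const[of c] by (simp add: monomial_def)
  next
    case (Suc d)
    then obtain i where i: "e i > 0"
      by (metis gr0I sum.neutral nat.distinct(1))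
    define e' where "e' = e(i := e i - 1)"
    have e: "e = e'(i := Suc (e' i))" using i by (auto simp: e'_def)
    have "Suc (\<Sum>i\<in>UNIV. e' i) = Suc d"
      using sum_exponents_Suc[of e' i] Suc.prems e by simp
    then have s: "(\<Sum>i\<in>UNIV. e' i) = d" by simp
    have "P (Suc d) (\<lambda>x. x $ i * (c * monomial e' x))"
      by (intro coord forms_cmult forms_monomial s Suc.IH)
    moreover have "(\<lambda>x. x $ i * (c * monomial e' x)) = (\<lambda>x. c * monomial e x)"
      by (subst e, subst monomial_Suc) (simp add: mult_ac)
    ultimately show ?case by simp
  qed
  obtain c where f: "f = (\<lambda>x. \<Sum>e | (\<Sum>i\<in>UNIV. e i) = d. c e * monomial e x)"
    using assms(1) forms_altdef by blast
  \<comment> \<open>The empty sum is a form of every degree, but \<open>const\<close> speaks of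
    degree 0 only; degree \<open>d\<close> is reached by multiplying zero by coordinates.\<close>
  have zero: "P d (\<lambda>_. 0)" for d
  proof (induction d)
    case 0 show ?case by (rule const)
  next
    case (Suc d) show ?case using coord[OF forms_zero Suc] by simp
  qed
  have "P d (\<lambda>x. \<Sum>e\<in>E. c e * monomial e x)"
    if "E \<subseteq> {e. (\<Sum>i\<in>UNIV. e i) = d}" and "finite E" for E
    using that(2,1)
  proof (induction E)
    case empty
    show ?case using zero by simp
  next
    case (insert e E)
    then have "P d (\<lambda>x. c e * monomial e x + (\<Sum>e\<in>E. c e * monomial e x))"
      by (intro add forms_cmult forms_monomial forms_sum mono) auto
    then show ?case using insert by simp
  qed
  then show ?thesis unfolding f using finite_exponents by blast
qed

lemma forms_mult: "f \<in> forms a \<Longrightarrow> g \<in> forms b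
    \<Longrightarrow> (\<lambda>x. f x * g x) \<in> forms (a + b)"
proof (induction rule: forms_induct)
  case (const c) then show ?case by (simp add: forms_cmult)
next
  case (add d f g') then show ?case by (simp add: forms_add distrib_right)
next
  case (coord d i q) then show ?case by (simp add: forms_coord_mult mult.assoc)
qed

lemma forms_coord: "(\<lambda>x. x $ i) \<in> forms 1"
  using forms_coord_mult[OF forms_const[of 1], of i] by simp

lemma forms_inner: "(\<lambda>x. inner x y) \<in> forms 1"
proof -
  have "(\<lambda>x. \<Sum>i\<in>UNIV. y $ i * x $ i) \<in> forms 1"
    by (intro forms_sum forms_cmult forms_coord)
  then show ?thesis by (simp add: inner_vec_def mult.commute)
qed

lemma forms_norm_sq: "(\<lambda>x. (norm x)\<^sup>2) \<in> forms 2"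
proof -
  have "(\<lambda>x::real^'a. \<Sum>i\<in>UNIV. x $ i * x $ i) \<in> forms (Suc 1)"
    by (intro forms_sum forms_coord_mult forms_coord)
  then show ?thesis by (simp add: norm_vec_def L2_set_def sum_nonneg power2_eq_square numeral_2_eq_2)
qed

lemma forms_power: "f \<in> forms a \<Longrightarrow> (\<lambda>x. f x ^ m) \<in> forms (m * a)"
proof (induction m)
  case 0 then show ?case by (simp add: forms_const)
next
  case (Suc m) then show ?case using forms_mult[of f a "\<lambda>x. f x ^ m" "m * a"] by simp
qed

lemma forms_norm_power: "(\<lambda>x. norm x ^ (2 * m)) \<in> forms (2 * m)"
  using forms_power[OF forms_norm_sq, of m] by (simp only: power_mult[symmetric] mult.commute)

lemma forms_homogeneous: "f \<in> forms d \<Longrightarrow> f (c *\<^sub>R x) = c ^ d * f x"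
  by (induction rule: forms_induct) (auto simp: algebra_simps)

lemma forms_continuous: "f \<in> forms d \<Longrightarrow> continuous_on A f"
  by (induction rule: forms_induct) (auto intro!: continuous_intros)

lemma forms_borel [measurable]: "f \<in> forms d \<Longrightarrow> f \<in> borel_measurable borel"
  by (intro borel_measurable_continuous_onI forms_continuous)

lemma forms_degree_0: "f \<in> forms 0 \<Longrightarrow> f x = f 0"
  using forms_homogeneous[of f 0 0 x] by simp

lemma forms_normalize: "f \<in> forms d \<Longrightarrow> x \<noteq> 0 \<Longrightarrow> f x
    = norm x ^ d * f (x /\<^sub>R norm x)"
  using forms_homogeneous[of f d "norm x" "x /\<^sub>R norm x"] by simp

lemma forms_at_0: "f \<in> forms d \<Longrightarrow> d > 0 \<Longrightarrow> f 0 = 0"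
  using forms_homogeneous[of f d 0 0] by (simp add: zero_power)

lemma subspace_forms: "subspace (forms d)"
  by (rule subspaceI) (auto simp: zero_fun_def plus_fun_def scaleR_fun_def intro: forms_add forms_cmult)

lemma sum_fun_apply: "(\<Sum>a\<in>A. f a) x = (\<Sum>a\<in>A. f a x)"
    for f :: "'a \<Rightarrow> 'b \<Rightarrow> 'c::comm_monoid_add"
  by (induction A rule: infinite_finite_induct) auto

text \<open>Finite dimension in the form used below: it bounds the size of orthonormal families and
  turns the vanishing of a functional into finitely many conditions.\<close>

lemma forms_finite_span:
  "\<exists>B. finite B \<and> B \<subseteq> forms d \<and> forms d \<subseteq> span B"
proof (intro exI[of _ "monomial ` {e. (\<Sum>i\<in>UNIV. e i) = d}"] conjI subsetI)
  fix f :: "real ^ 'a \<Rightarrow> real" assume "f \<in> forms d"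
  then obtain c where "f = (\<lambda>x. \<Sum>e | (\<Sum>i\<in>UNIV. e i) = d. c e * monomial e x)"
    using forms_altdef by blast
  then have "f = (\<Sum>e | (\<Sum>i\<in>UNIV. e i) = d. c e *\<^sub>R monomial e)"
    by (simp add: fun_eq_iff sum_fun_apply scaleR_fun_def)
  also have "\<dots> \<in> span (monomial ` {e. (\<Sum>i\<in>UNIV. e i) = d})"
    by (intro span_sum span_scale span_base) auto
  finally show "f \<in> span (monomial ` {e. (\<Sum>i\<in>UNIV. e i) = d})" .
qed (auto intro: forms_monomial finite_exponents)

section \<open>Partial derivatives, Euler's identity and the Laplacian of forms\<close>

definition pd :: "'n \<Rightarrow> (real ^ 'n \<Rightarrow> real) \<Rightarrow> real ^ 'n \<Rightarrow> real"
  where "pd i f x = deriv (\<lambda>t. f (x + t *\<^sub>R axis i 1)) 0"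

lemma forms_has_pd:
  "f \<in> forms d \<Longrightarrow> ((\<lambda>t. f (x + t *\<^sub>R axis i 1)) has_real_derivative pd i f
      x) (at 0)"
proof -
  assume "f \<in> forms d"
  then have "\<exists>D. ((\<lambda>t. f (x + t *\<^sub>R axis i 1)) has_real_derivative D) (at 0)"
  proof (induction rule: forms_induct)
    case (const c) then show ?case using DERIV_const by blast
  next
    case (add d f g) then show ?case using DERIV_add by blast
  next
    case (coord d j q)
    have "((\<lambda>t. (x + t *\<^sub>R axis i 1) $ j) has_real_derivative axis i 1 $ j) (at 0)"
      by (auto intro!: derivative_eq_intros)
    then show ?case using coord DERIV_mult by blast
  qed
  then show ?thesis unfolding pd_def using DERIV_imp_deriv by blast
qed

text \<open>Moving the base point along the axis identifies the derivative on the whole line, not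
  only at 0, so that the iterated \<open>deriv\<close> in \<open>laplacian\<close> becomes an
  iterated \<open>pd\<close>.\<close>

lemma forms_has_pd_at:
  assumes "f \<in> forms d"
  shows "((\<lambda>t. f (x + t *\<^sub>R axis i 1)) has_real_derivative pd i f (x
      + s *\<^sub>R axis i 1)) (at s)"
proof -
  have "((\<lambda>t. f ((x + s *\<^sub>R axis i 1) + t *\<^sub>R axis i 1)) has_real_derivative pd i f (x
      + s *\<^sub>R axis i 1)) (at 0)"
    by (rule forms_has_pd[OF assms])
  then have "((\<lambda>t. f (x + (s + t) *\<^sub>R axis i 1)) has_real_derivative pd i f (x
      + s *\<^sub>R axis i 1)) (at 0)"
    by (simp add: algebra_simps)
  then show ?thesis
    using DERIV_shift[of "\<lambda>t. f (x + t *\<^sub>R axis i 1)" _ 0 s] by (simp add: add.commute)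
qed

lemma pd_const [simp]: "pd i (\<lambda>_. c) = (\<lambda>_. 0)"
  by (simp add: pd_def fun_eq_iff)

lemma pd_add: "f \<in> forms d \<Longrightarrow> g \<in> forms d' \<Longrightarrow> pd i (\<lambda>x. f x
    + g x) = (\<lambda>x. pd i f x + pd i g x)"
  unfolding pd_def fun_eq_iff
  by (intro allI DERIV_imp_deriv DERIV_add; fold pd_def; rule forms_has_pd)

lemma pd_mult:
  assumes "f \<in> forms d" "g \<in> forms d'"
  shows "pd i (\<lambda>x. f x * g x) = (\<lambda>x. pd i f x * g x + f x * pd i g x)"
proof
  fix x
  have "((\<lambda>t. f (x + t *\<^sub>R axis i 1) * g (x + t *\<^sub>R axis i 1)) has_real_derivative
      pd i f x * g (x + 0 *\<^sub>R axis i 1) + pd i g x * f (x + 0 *\<^sub>R axis i 1)) (at 0)"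
    by (intro DERIV_mult forms_has_pd[OF assms(1)] forms_has_pd[OF assms(2)])
  then show "pd i (\<lambda>x. f x * g x) x = pd i f x * g x + f x * pd i g x"
    unfolding pd_def[of i "\<lambda>x. f x * g x"] by (intro DERIV_imp_deriv) (simp add: mult.commute)
qed

lemma pd_coord: "pd i (\<lambda>x. x $ j) = (\<lambda>_. if i = j then 1 else 0)"
proof
  fix x :: "real ^ 'a"
  have "((\<lambda>t. (x + t *\<^sub>R axis i 1) $ j) has_real_derivative axis i 1 $ j) (at 0)"
    by (auto intro!: derivative_eq_intros)
  then show "pd i (\<lambda>x. x $ j) x = (if i = j then 1 else 0)"
    unfolding pd_def by (simp add: DERIV_imp_deriv axis_def)
qed

lemma pd_cmult: "f \<in> forms d \<Longrightarrow> pd i (\<lambda>x. c * f x) = (\<lambda>x. c * pd i f x)"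
  using pd_mult[OF forms_const[of c], of f d i] by simp

lemma pd_diff: "f \<in> forms d \<Longrightarrow> g \<in> forms d' \<Longrightarrow> pd i (\<lambda>x. f x
    - g x) = (\<lambda>x. pd i f x - pd i g x)"
  using pd_add[of f d "\<lambda>x. (- 1) * g x" d' i] pd_cmult[of g d' i "- 1"] forms_cmult[of g d' "- 1"]
      by simp

lemma pd_sum:
  assumes "\<And>a. a \<in> A \<Longrightarrow> f a \<in> forms d"
  shows "pd i (\<lambda>x. \<Sum>a\<in>A. f a x) = (\<lambda>x. \<Sum>a\<in>A. pd i (f a) x)"
  using assms
proof (induction A rule: infinite_finite_induct)
  case (insert a A)
  then show ?case
    using pd_add[of "f a" d "\<lambda>x. \<Sum>a\<in>A. f a x" d i] forms_sum[of A f d] by simp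
qed auto

lemma forms_pd: "f \<in> forms d \<Longrightarrow> pd i f \<in> forms (d - 1)"
proof (induction rule: forms_induct)
  case (const c) then show ?case by simp
next
  case (add d f g) then show ?case by (simp add: pd_add[of f d g d] forms_add)
next
  case (coord d j q)
  have eq: "pd i (\<lambda>x. x $ j * q x) = (\<lambda>x. (if i = j then 1 else 0) * q x + x $ j * pd i q x)"
    using pd_mult[OF forms_coord coord(1), of i j] by (simp add: pd_coord)
  show ?case
  \<comment> \<open>The degree \<open>d - 1\<close> is truncated. For \<open>d = 0\<close> the
    factor \<open>x $ j\<close> would raise the degree of \<open>pd i q\<close> to 1, but
    \<open>pd i q\<close> is zero there.\<close>
  proof (cases d)
    case 0
    then have "pd i q = (\<lambda>_. 0)"
      using forms_degree_0 coord(1) pd_const[of i "q 0"] by (metis (no_types, lifting) ext)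
    then show ?thesis unfolding eq using 0 coord(1) forms_cmult[of q d "if i = j then 1 else 0"] by simp
  next
    case (Suc d')
    then have "(\<lambda>x. x $ j * pd i q x) \<in> forms d"
      using forms_coord_mult[OF coord(2), of j] by simp
    then show ?thesis unfolding eq using coord(1) by (simp add: forms_add)
  qed
qed

lemma pd_degree_0: "f \<in> forms 0 \<Longrightarrow> pd i f = (\<lambda>_. 0)"
  using forms_degree_0 pd_const[of i "f 0"] by (metis (no_types, lifting) ext)

lemma euler_identity: "f \<in> forms d \<Longrightarrow> (\<Sum>i\<in>UNIV. x $ i * pd i f x) = real d * f x"
proof (induction rule: forms_induct)
  case (const c) then show ?case by simp
next
  case (add d f g)
  then show ?case by (simp add: pd_add[of f d g d] distrib_left sum.distrib)
next
  case (coord d j q)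
  have eq: "pd i (\<lambda>x. x $ j * q x) x = (if i = j then q x else 0) + x $ j * pd i q x" for i
    using pd_mult[OF forms_coord coord(1), of i j] by (simp add: pd_coord)
  have "(\<Sum>i\<in>UNIV. x $ i * pd i (\<lambda>x. x $ j * q x) x)
      = (\<Sum>i\<in>UNIV. (if i = j then x $ i * q x else 0)) + x $ j * (\<Sum>i\<in>UNIV. x $ i * pd i q x)"
    unfolding eq sum_distrib_left sum.distrib[symmetric] by (intro sum.cong) (auto simp: algebra_simps)
  also have "\<dots> = real (Suc d) * (x $ j * q x)"
    using coord(2) by (simp add: algebra_simps)
  finally show ?case .
qed

text \<open>For forms the symmetry is algebraic: two applications of the product rule to
  \<open>x $ l * q\<close> give an expression symmetric in \<open>i\<close> and \<open>j\<close> as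
  soon as this holds for \<open>q\<close>.\<close>

lemma pd_commute: "f \<in> forms d \<Longrightarrow> pd i (pd j f) = pd j (pd i f)"
proof (induction rule: forms_induct)
  case (const c) then show ?case by simp
next
  case (add d f g)
  then show ?case
    using forms_pd[of f d] forms_pd[of g d] by (simp add: pd_add[of _ d _ d] pd_add[of _ "d-1" _ "d-1"])
next
  case (coord d l q)
  have eq: "pd i (\<lambda>x. x $ l * q x) = (\<lambda>x. (if i = l then 1 else 0) * q x + x $ l * pd i q x)"
    if "q \<in> forms d" for i d and q :: "real ^ 'a \<Rightarrow> real"
    using pd_mult[OF forms_coord that, of i l] by (simp add: pd_coord)
  have "pd i (pd j (\<lambda>x. x $ l * q x))
      = (\<lambda>x. (if j = l then 1 else 0) * pd i q x + ((if i = l then 1 else 0) * pd j q x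
          + x $ l * pd i (pd j q) x))"
    for i j
    using coord(1) forms_pd[OF coord(1), of j]
    by (subst eq[OF coord(1)], subst pd_add[of _ d _ "Suc (d-1)"])
       (auto intro: forms_cmult forms_coord_mult simp: pd_cmult[of _ d] eq[of _ "d-1"])
  then show ?case using coord(2) by (simp add: fun_eq_iff)
qed

lemma laplacian_forms: "f \<in> forms d \<Longrightarrow> laplacian f x = (\<Sum>i\<in>UNIV. pd i (pd i f) x)"
proof -
  assume f: "f \<in> forms d"
  have "deriv (\<lambda>t. f (x + t *\<^sub>R axis i 1)) = (\<lambda>t. pd i f (x + t *\<^sub>R axis i 1))"
      for i
    using DERIV_imp_deriv[OF forms_has_pd_at[OF f]] by blast
  then show ?thesis unfolding laplacian_def by (simp add: numeral_2_eq_2 pd_def)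
qed

lemma forms_laplacian: "f \<in> forms d \<Longrightarrow> laplacian f \<in> forms (d - 2)"
proof -
  assume f: "f \<in> forms d"
  have "laplacian f = (\<lambda>x. \<Sum>i\<in>UNIV. pd i (pd i f) x)" using laplacian_forms[OF f] by blast
  also have "\<dots> \<in> forms (d - 1 - 1)" by (intro forms_sum forms_pd f)
  finally show ?thesis by (simp add: numeral_2_eq_2)
qed

lemma harmonic_formsD: "f \<in> harmonic_forms d \<Longrightarrow> f \<in> forms d"
  by (simp add: harmonic_forms_def)

lemma laplacian_add:
  "f \<in> forms d \<Longrightarrow> g \<in> forms d \<Longrightarrow> laplacian (\<lambda>x. f x + g x) x
      = laplacian f x + laplacian g x"
  by (simp add: laplacian_forms[OF forms_add] laplacian_forms[of f d] laplacian_forms[of g d]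
      pd_add[of f d g d] pd_add[OF forms_pd forms_pd, of f d g d] sum.distrib)

lemma laplacian_cmult: "f \<in> forms d \<Longrightarrow> laplacian (\<lambda>x. c * f x) x = c * laplacian f x"
  by (simp add: laplacian_forms[OF forms_cmult] laplacian_forms[of f d] sum_distrib_left
      pd_cmult[of f d] pd_cmult[OF forms_pd, of f d])

lemma laplacian_diff:
  "f \<in> forms d \<Longrightarrow> g \<in> forms d \<Longrightarrow> laplacian (\<lambda>x. f x - g x) x
      = laplacian f x - laplacian g x"
  by (simp add: laplacian_forms[OF forms_diff] laplacian_forms[of f d] laplacian_forms[of g d]
      pd_diff[of f d g d] pd_diff[OF forms_pd forms_pd, of f d g d] sum_subtractf)

lemma subspace_harmonic_forms: "subspace (harmonic_forms d)"
proof (rule subspaceI)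
  show "0 \<in> harmonic_forms d"
    by (simp add: harmonic_forms_def zero_fun_def laplacian_forms[of _ 0])
qed (auto simp: harmonic_forms_def plus_fun_def scaleR_fun_def laplacian_add laplacian_cmult
  intro: forms_add forms_cmult)

text \<open>The Laplacian commutes with partial derivatives. This keeps inductions on the degree
  inside the harmonic forms.\<close>

lemma harmonic_pd:
  assumes "f \<in> harmonic_forms d"
  shows "pd i f \<in> harmonic_forms (d - 1)"
proof -
  have f: "f \<in> forms d" and h: "\<And>x. (\<Sum>j\<in>UNIV. pd j (pd j f) x) = 0"
    using assms laplacian_forms[of f d] by (auto simp: harmonic_forms_def)
  have "pd j (pd j (pd i f)) = pd i (pd j (pd j f))" for j
    using pd_commute[OF f, of j i] pd_commute[OF forms_pd[OF f, of j], of j i] by simp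
  then have "laplacian (pd i f) x = pd i (\<lambda>x. \<Sum>j\<in>UNIV. pd j (pd j f) x) x" for x
    by (simp only: laplacian_forms[OF forms_pd[OF f]] pd_sum[OF forms_pd[OF forms_pd[OF f]]])
  then have "laplacian (pd i f) x = 0" for x by (simp add: h)
  then show ?thesis using forms_pd[OF f] by (simp add: harmonic_forms_def)
qed

subsection \<open>Integration over the sphere\<close>

text \<open>A constant density has the same effect as \<open>scale_measure\<close> and gives access
  to the integration rules for densities.\<close>

lemma area_eq_density:
  "area = density (distr (restrict_space lborel (ball 0 1 - {0}))
      (restrict_space borel (sphere 0 1)) (\<lambda>x :: real ^ 'n. x /\<^sub>R norm x)) (\<lambda>_.
          ennreal (real CARD('n)))"
  unfolding area_def
  by (rule measure_eqI) (simp_all add: emeasure_density_const ennreal_of_nat_eq_real_of_nat)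

lemma space_area: "space area = sphere 0 1"
  by (simp add: area_eq_density space_restrict_space)

lemma sets_area: "sets area = sets (restrict_space borel (sphere 0 1))"
  by (simp add: area_eq_density)

lemma measurable_radial_projection:
  "(\<lambda>x :: real ^ 'n. x /\<^sub>R norm x)
    \<in> restrict_space lborel (ball 0 1 - {0}) \<rightarrow>\<^sub>M restrict_space borel (sphere 0 1)"
proof (rule measurable_restrict_space2)
  show "(\<lambda>x :: real ^ 'n. x /\<^sub>R norm x) \<in> space (restrict_space lborel (ball 0 1
      - {0})) \<rightarrow> sphere 0 1"
    by (auto simp: space_restrict_space)
  show "(\<lambda>x :: real ^ 'n. x /\<^sub>R norm x) \<in> restrict_space lborel (ball 0 1
      - {0}) \<rightarrow>\<^sub>M borel"
    by (intro measurable_restrict_space1) simp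
qed

lemma borel_measurable_area: "f \<in> borel_measurable borel \<Longrightarrow> f \<in> borel_measurable area"
  using measurable_restrict_space1[of f borel borel "sphere 0 1"]
    measurable_cong_sets[OF sets_area refl] by blast

lemma area_integral:
  fixes f :: "real ^ 'n \<Rightarrow> real"
  assumes [measurable]: "f \<in> borel_measurable borel"
  shows "(LINT x|area. f x)
    = real CARD('n) * (LINT x|lborel. indicator (ball 0 1 - {0}) x * f (x /\<^sub>R norm x))"
proof -
  let ?M = "restrict_space lborel (ball 0 1 - {0})" and ?S = "restrict_space borel (sphere 0 1)"
  have f: "f \<in> borel_measurable ?S" by (intro measurable_restrict_space1) simp
  have "(LINT x|area. f x)
      = real CARD('n) * (LINT x|distr ?M ?S (\<lambda>x. x /\<^sub>R norm x). f x)"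
    unfolding area_eq_density by (subst integral_density) (use f in auto)
  also have "(LINT x|distr ?M ?S (\<lambda>x. x /\<^sub>R norm x). f x) = (LINT x|?M. f (x /\<^sub>R norm x))"
    by (rule integral_distr[OF measurable_radial_projection f])
  also have "\<dots> = (LINT x|lborel. indicator (ball 0 1 - {0}) x * f (x /\<^sub>R norm x))"
    by (subst integral_restrict_space) auto
  finally show ?thesis .
qed

lemma emeasure_area:
  "emeasure (area :: (real ^ 'n) measure) (sphere 0 1) = ennreal (real CARD('n)) * emeasure lborel (ball (0
      :: real ^ 'n) 1 - {0})"
proof -
  have "(sphere (0 :: real ^ 'n) 1) \<in> sets (restrict_space borel (sphere 0 1))"
    by (metis sets.top space_restrict_space space_borel Int_UNIV_right)
  moreover have "(\<lambda>x :: real ^ 'n. x /\<^sub>R norm x) -` sphere 0 1 \<inter> (ball 0 1 - {0})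
      = ball 0 1 - {0}"
    by auto
  ultimately show ?thesis
    by (simp add: area_eq_density emeasure_density_const emeasure_distr[OF measurable_radial_projection]
        space_restrict_space emeasure_restrict_space)
qed

lemma emeasure_punctured_ball: "emeasure lborel (ball (0 :: real ^ 'n) 1 - {0})
    = emeasure lborel (ball (0 :: real ^ 'n) 1)"
  by (rule emeasure_Diff_null_set) auto

lemma finite_measure_area: "finite_measure (area :: (real ^ 'n) measure)"
proof (rule finite_measureI)
  show "emeasure (area :: (real ^ 'n) measure) (space area) \<noteq> \<infinity>"
    using emeasure_lborel_ball_finite[of "0 :: real ^ 'n" 1]
    by (auto simp: space_area emeasure_area emeasure_punctured_ball ennreal_mult_eq_top_iff)
qed

lemma area_sphere_pos: "measure (area :: (real ^ 'n) measure) (sphere 0 1) > 0"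
proof -
  have "emeasure lborel (ball (0 :: real ^ 'n) 1) \<noteq> 0"
    using content_ball_pos[of 1 "0 :: real ^ 'n"] by (auto simp: measure_def)
  then have "emeasure (area :: (real ^ 'n) measure) (sphere 0 1) \<noteq> 0"
    by (simp add: emeasure_area emeasure_punctured_ball)
  then show ?thesis
    using finite_measure.emeasure_eq_measure[OF finite_measure_area, of "sphere (0 :: real ^ 'n) 1"]
      measure_nonneg[of "area :: (real ^ 'n) measure" "sphere 0 1"]
    by (metis ennreal_0 less_eq_real_def)
qed

lemma area_integrable:
  fixes f :: "real ^ 'n \<Rightarrow> real"
  assumes "continuous_on UNIV f"
  shows "integrable area f"
proof -
  have "compact (f ` sphere 0 1)"
    by (rule compact_continuous_image[OF continuous_on_subset[OF assms]]) auto
  from compact_imp_bounded[OF this]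
  obtain M where "\<And>x. x \<in> sphere 0 1 \<Longrightarrow> norm (f x) \<le> M"
    unfolding bounded_iff by (metis imageI)
  then have "AE x in area. norm (f x) \<le> M" by (intro AE_I2) (simp add: space_area)
  moreover have "f \<in> borel_measurable area"
    by (intro borel_measurable_area borel_measurable_continuous_onI assms)
  ultimately show ?thesis
    using finite_measure.integrable_const_bound[OF finite_measure_area] by blast
qed

section \<open>Scaling and translation of volume integrals; homogeneous functions on the
  ball\<close>

lemma lborel_integral_scale:
  fixes g :: "real ^ 'n \<Rightarrow> real"
  assumes [measurable]: "g \<in> borel_measurable borel" and r: "r > 0"
  shows "(LINT x|lborel. g x) = r ^ CARD('n) * (LINT x|lborel. g (r *\<^sub>R x))"
proof -
  have eq: "lborel = density (distr lborel borel (\<lambda>x :: real ^ 'n. r *\<^sub>R x)) (\<lambda>_.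
      ennreal (r ^ CARD('n)))"
    using lborel_affine[of r "0 :: real ^ 'n"] r by simp
  show ?thesis
    by (subst (1) eq, subst integral_density)
       (use r in \<open>auto simp: integral_distr\<close>)
qed

lemma lborel_integral_translate:
  fixes g :: "real ^ 'n \<Rightarrow> real"
  assumes [measurable]: "g \<in> borel_measurable borel"
  shows "(LINT x|lborel. g (x + a)) = (LINT x|lborel. g x)"
proof -
  have eq: "lborel = distr lborel borel (\<lambda>x :: real ^ 'n. x + a)"
    using lborel_affine[of 1 a] by (simp add: density_1 add.commute one_ennreal_def[symmetric])
  show ?thesis by (subst (2) eq) (auto simp: integral_distr)
qed

lemma integrable_bounded_on_ball:
  fixes u :: "real ^ 'n \<Rightarrow> real"
  assumes [measurable]: "u \<in> borel_measurable borel" and M: "\<And>x. x \<in> ball 0 1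
      \<Longrightarrow> \<bar>u x\<bar> \<le> M"
  shows "integrable lborel (\<lambda>x. indicator (ball 0 1) x * u x)"
proof (rule Bochner_Integration.integrable_bound)
  show "integrable lborel (\<lambda>x :: real ^ 'n. indicator (ball 0 1) x * M)"
    using emeasure_lborel_ball_finite by (intro integrable_mult_left integrable_real_indicator) auto
  show "AE x in lborel. norm (indicator (ball 0 1) x * u x) \<le> norm (indicator (ball 0 1) x * M)"
    using M by (intro AE_I2) (fastforce simp: indicator_def)
  show "(\<lambda>x. indicator (ball 0 1) x * u x) \<in> borel_measurable lborel"
    unfolding measurable_lborel2 by (intro borel_measurable_times borel_measurable_indicator) auto
qed

lemma integrable_continuous_on_ball:
  fixes u :: "real ^ 'n \<Rightarrow> real"
  assumes "continuous_on UNIV u"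
  shows "integrable lborel (\<lambda>x. indicator (ball 0 1) x * u x)"
proof -
  have "compact (u ` cball 0 1)"
    by (rule compact_continuous_image[OF continuous_on_subset[OF assms]]) auto
  from compact_imp_bounded[OF this]
  obtain M where "\<And>x. x \<in> cball 0 1 \<Longrightarrow> norm (u x) \<le> M"
    unfolding bounded_iff by (metis imageI)
  then show ?thesis
    using assms by (intro integrable_bounded_on_ball[of u M]) (auto simp: borel_measurable_continuous_onI)
qed

text \<open>Squeezing the integral over the annulus \<open>r \<le> norm x < 1\<close> between \<open>r ^ p\<close> and \<open>1\<close> times its
  value for \<open>p = 0\<close> and letting \<open>r\<close> tend to 1 replaces integration in polar coordinates.\<close>

lemma radial_power_integral_nonneg:
  fixes u :: "real ^ 'n \<Rightarrow> real"
  assumes u [measurable]: "u \<in> borel_measurable borel"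
    and M: "\<And>x. \<bar>u x\<bar> \<le> M" and pos: "\<And>x. u x \<ge> 0"
    and hom: "\<And>r x. r > 0 \<Longrightarrow> u (r *\<^sub>R x) = u x"
  shows "(real CARD('n) + real p) * (LINT x|lborel. indicator (ball 0 1) x * (norm x ^ p * u x))
    = real CARD('n) * (LINT x|lborel. indicator (ball 0 1) x * u x)"
proof -
  define \<Psi> where "\<Psi> p = (LINT x|lborel. indicator (ball 0 1) x * (norm x ^ p * u x))" for p
  have int: "integrable lborel (\<lambda>x. indicator (ball 0 1) x * (norm x ^ p * u x))" for p
  proof (rule integrable_bounded_on_ball)
    fix x :: "real ^ 'n" assume "x \<in> ball 0 1"
    then have "norm x ^ p \<le> 1" by (intro power_le_one) auto
    then show "\<bar>norm x ^ p * u x\<bar> \<le> 1 * M"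
      unfolding abs_mult using M[of x] by (intro mult_mono) auto
  qed measurable
  define D where "D r p = (LINT x|lborel. indicator (ball 0 1 - ball 0 r) x * (norm x ^ p * u x))" for r p
  have intD: "integrable lborel (\<lambda>x. indicator (ball 0 1 - ball 0 r) x * (norm x ^ p * u x))" for p r
  proof (rule Bochner_Integration.integrable_bound[OF int[of p]])
    show "AE x in lborel. norm (indicator (ball 0 1 - ball 0 r) x * (norm x ^ p * u x))
        \<le> norm (indicator (ball 0 1) x * (norm x ^ p * u x))"
      by (intro AE_I2) (auto simp: indicator_def)
    show "(\<lambda>x. indicator (ball 0 1 - ball 0 r) x * (norm x ^ p * u x)) \<in> borel_measurable lborel"
      unfolding measurable_lborel2
      by (intro borel_measurable_times borel_measurable_indicator) auto
  qed
  have D: "D r p = (1 - r ^ (CARD('n) + p)) * \<Psi> p" if r: "0 < r" "r < 1" for r p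
  proof -
    have intr: "integrable lborel (\<lambda>x. indicator (ball 0 r) x * (norm x ^ p * u x))"
    proof (rule Bochner_Integration.integrable_bound[OF int[of p]])
      show "AE x in lborel. norm (indicator (ball 0 r) x * (norm x ^ p * u x))
          \<le> norm (indicator (ball 0 1) x * (norm x ^ p * u x))"
        using r by (intro AE_I2) (auto simp: indicator_def)
      show "(\<lambda>x. indicator (ball 0 r) x * (norm x ^ p * u x)) \<in> borel_measurable lborel"
        unfolding measurable_lborel2
        by (intro borel_measurable_times borel_measurable_indicator) auto
    qed
    have "(LINT x|lborel. indicator (ball 0 r) x * (norm x ^ p * u x))
      = r ^ CARD('n) * (LINT x|lborel. indicator (ball 0 r) (r *\<^sub>R x) * (norm (r *\<^sub>R x) ^ p * u
          (r *\<^sub>R x)))"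
      using r by (intro lborel_integral_scale borel_measurable_times borel_measurable_indicator) auto
    also have "(\<lambda>x :: real ^ 'n. indicator (ball 0 r) (r *\<^sub>R x) * (norm (r *\<^sub>R x) ^ p *
        u (r *\<^sub>R x)))
      = (\<lambda>x. r ^ p * (indicator (ball 0 1) x * (norm x ^ p * u x)))"
      using r by (auto simp: fun_eq_iff indicator_def hom power_mult_distrib)
    finally have eq: "(LINT x|lborel. indicator (ball 0 r) x * (norm x ^ p * u x))
      = r ^ (CARD('n) + p) * \<Psi> p"
      by (simp add: \<Psi>_def power_add)
    have "D r p = (LINT x|lborel. indicator (ball 0 1) x * (norm x ^ p * u x)
        - indicator (ball 0 r) x * (norm x ^ p * u x))"
      unfolding D_def using r by (intro Bochner_Integration.integral_cong) (auto simp: indicator_def)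
    also have "\<dots> = \<Psi> p - (LINT x|lborel. indicator (ball 0 r) x * (norm x ^ p * u x))"
      unfolding \<Psi>_def by (rule Bochner_Integration.integral_diff[OF int intr])
    finally show ?thesis unfolding eq by (simp add: algebra_simps)
  qed
  have lower: "r ^ p * D r 0 \<le> D r p" if r: "0 < r" "r < 1" for r
  proof -
    have "r ^ p * D r 0 = (LINT x|lborel. r ^ p * (indicator (ball 0 1 - ball 0 r) x * (norm x ^ 0 * u x)))"
      by (simp add: D_def)
    also have "\<dots> \<le> D r p"
      unfolding D_def
    proof (rule integral_mono)
      show "integrable lborel (\<lambda>x. r ^ p * (indicator (ball 0 1 - ball 0 r) x * (norm x ^ 0 * u x)))"
        using intD[of r 0] by auto
      fix x :: "real ^ 'n"
      have "r ^ p * u x \<le> norm x ^ p * u x" if "x \<notin> ball 0 r"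
        using that r pos[of x] by (intro mult_right_mono power_mono) auto
      then show "r ^ p * (indicator (ball 0 1 - ball 0 r) x * (norm x ^ 0 * u x))
          \<le> indicator (ball 0 1 - ball 0 r) x * (norm x ^ p * u x)"
        by (auto simp: indicator_def)
    qed (rule intD)
    finally show ?thesis .
  qed
  have upper: "D r p \<le> D r 0" for r
    unfolding D_def
  proof (rule integral_mono[OF intD intD])
    fix x :: "real ^ 'n"
    have "norm x ^ p * u x \<le> 1 * u x" if "x \<in> ball 0 1"
      using that pos[of x] by (intro mult_right_mono power_le_one) auto
    then show "indicator (ball 0 1 - ball 0 r) x * (norm x ^ p * u x)
        \<le> indicator (ball 0 1 - ball 0 r) x * (norm x ^ 0 * u x)"
      by (auto simp: indicator_def)
  qed
  have pow: "1 - r ^ m = (1 - r) * (\<Sum>i<m. r ^ i)" for r :: real and m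
    by (rule one_diff_power_eq)
  \<comment> \<open>Everything vanishes to first order at \<open>r = 1\<close>. Splitting off
    \<open>1 - r\<close> allows it to be cancelled before the limit, where the geometric sums become
    \<open>CARD('n) + p\<close> and \<open>CARD('n)\<close>.\<close>
  have *: "(1 - r) * (r ^ p * (\<Sum>i<CARD('n). r ^ i) * \<Psi> 0) \<le> (1 - r) * ((\<Sum>i<CARD('n)
      + p. r ^ i) * \<Psi> p)
      \<and> (1 - r) * ((\<Sum>i<CARD('n) + p. r ^ i) * \<Psi> p) \<le> (1
          - r) * ((\<Sum>i<CARD('n). r ^ i) * \<Psi> 0)"
    if "0 < r" "r < 1" for r
  proof -
    have "D r 0 = (1 - r) * ((\<Sum>i<CARD('n). r ^ i) * \<Psi> 0)"
      "D r p = (1 - r) * ((\<Sum>i<CARD('n) + p. r ^ i) * \<Psi> p)"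
      using D[OF that, of 0] D[OF that, of p] by (simp_all only: pow add_0_right mult.assoc)
    moreover have "r ^ p * D r 0 \<le> D r p" "D r p \<le> D r 0" using lower[OF that] upper by auto
    ultimately show ?thesis by (simp only: mult_ac)
  qed
  have **: "r ^ p * (\<Sum>i<CARD('n). r ^ i) * \<Psi> 0 \<le> (\<Sum>i<CARD('n) + p. r ^ i) * \<Psi> p
      \<and> (\<Sum>i<CARD('n) + p. r ^ i) * \<Psi> p \<le> (\<Sum>i<CARD('n). r ^ i) * \<Psi> 0"
          if "0 < r" "r < 1" for r
    using *[OF that] that by (auto simp: mult_le_cancel_left)
  have ev: "eventually (\<lambda>r::real. 0 < r \<and> r < 1) (at_left 1)"
    using eventually_at_left[of 0 "1::real"] by (auto intro!: exI[of _ 0])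
  have lim: "((\<lambda>r::real. r) \<longlongrightarrow> 1) (at_left 1)" by (rule tendsto_ident_at)
  have S: "((\<lambda>r::real. (\<Sum>i<m. r ^ i) * c) \<longlongrightarrow> (\<Sum>i<m. 1 ^ i) * c)
      (at_left 1)" for m c
    by (intro tendsto_intros lim)
  have S': "((\<lambda>r::real. r ^ p * (\<Sum>i<m. r ^ i) * c) \<longlongrightarrow> 1 ^ p * (\<Sum>i<m. 1
      ^ i) * c) (at_left 1)" for m c
    by (intro tendsto_intros lim)
  have "(\<Sum>i<CARD('n) + p. 1 ^ i) * \<Psi> p \<le> (\<Sum>i<CARD('n). 1 ^ i) * \<Psi> 0"
    by (rule tendsto_le[OF _ S S]) (use ev ** in \<open>auto elim: eventually_mono\<close>)
  moreover have "1 ^ p * (\<Sum>i<CARD('n). 1 ^ i) * \<Psi> 0 \<le> (\<Sum>i<CARD('n) + p. 1 ^ i) * \<Psi> p"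
    by (rule tendsto_le[OF _ S S']) (use ev ** in \<open>auto elim: eventually_mono\<close>)
  ultimately show ?thesis by (simp add: \<Psi>_def)
qed

text \<open>Both sides are linear in \<open>u\<close>, and \<open>u + M\<close> as well as the
  constant \<open>M\<close> are nonnegative and invariant under scaling, so the claim is a
  difference of two nonnegative cases.\<close>

lemma radial_power_integral:
  fixes u :: "real ^ 'n \<Rightarrow> real"
  assumes u [measurable]: "u \<in> borel_measurable borel"
    and M: "\<And>x. \<bar>u x\<bar> \<le> M"
    and hom: "\<And>r x. r > 0 \<Longrightarrow> u (r *\<^sub>R x) = u x"
  shows "(real CARD('n) + real p) * (LINT x|lborel. indicator (ball 0 1) x * (norm x ^ p * u x))
    = real CARD('n) * (LINT x|lborel. indicator (ball 0 1) x * u x)"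
proof -
  have M0: "M \<ge> 0" using M[of 0] by simp
  define v where "v x = u x + M" for x
  have 1: "(real CARD('n) + real p) * (LINT x|lborel. indicator (ball 0 1) x * (norm x ^ p * v x))
    = real CARD('n) * (LINT x|lborel. indicator (ball 0 1) x * v x)"
  proof (rule radial_power_integral_nonneg[of v "2 * M"])
    fix x r
    show "\<bar>v x\<bar> \<le> 2 * M" "v x \<ge> 0" using M[of x] by (auto simp: v_def)
    show "r > 0 \<Longrightarrow> v (r *\<^sub>R x) = v x" by (simp add: v_def hom)
  qed (simp add: v_def[abs_def])
  have 2: "(real CARD('n) + real p) * (LINT x :: real ^ 'n|lborel. indicator (ball 0 1) x * (norm x ^ p * M))
    = real CARD('n) * (LINT x :: real ^ 'n|lborel. indicator (ball 0 1) x * M)"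
    using M0 by (intro radial_power_integral_nonneg[of "\<lambda>_. M" M]) auto
  have b: "norm x ^ p * \<bar>u x\<bar> \<le> M" if "norm x < 1" for x :: "real ^ 'n" and p
    using that mult_mono[OF power_le_one[of "norm x" p] M[of x]] by auto
  have int: "integrable lborel (\<lambda>x. indicator (ball 0 1) x * (norm x ^ p * u x))" for p
    using b by (intro integrable_bounded_on_ball[of _ M]) (auto simp: abs_mult)
  have intM: "integrable lborel (\<lambda>x :: real ^ 'n. indicator (ball 0 1) x * (norm x ^ p * M))" for p
    by (intro integrable_continuous_on_ball continuous_intros)
  have split: "(LINT x|lborel. indicator (ball 0 1) x * (norm x ^ p * v x))
     = (LINT x|lborel. indicator (ball 0 1) x * (norm x ^ p * u x))
     + (LINT x :: real ^ 'n|lborel. indicator (ball 0 1) x * (norm x ^ p * M))" for p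
    by (subst Bochner_Integration.integral_add[OF int intM, symmetric]) (simp add: v_def algebra_simps)
  show ?thesis
    using 1 2 split[of p] split[of 0] by (simp add: algebra_simps)
qed

lemma forms_bounded_unit_ball:
  assumes "f \<in> forms d"
  obtains M where "\<And>x. norm x \<le> 1 \<Longrightarrow> \<bar>f x\<bar> \<le> M"
proof -
  have "compact (f ` cball 0 1)"
    by (intro compact_continuous_image forms_continuous[OF assms]) auto
  from compact_imp_bounded[OF this]
  obtain M where "\<And>x. x \<in> cball 0 1 \<Longrightarrow> norm (f x) \<le> M"
    unfolding bounded_iff by (metis imageI)
  then show ?thesis using that[of M] by auto
qed

text \<open>With \<open>u x = f (x /\<^sub>R norm x)\<close> the integrand is
  \<open>norm x ^ (d + p) * u x\<close>, and \<open>u\<close> is invariant under scaling; the radial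
  integral contributes \<open>CARD('n) / (CARD('n) + d + p)\<close>, and the numerator is absorbed
  by the normalisation of \<open>area\<close>. The free exponent \<open>p\<close> is what makes
  integration by parts possible.\<close>

lemma area_integral_forms:
  fixes f :: "real ^ 'n \<Rightarrow> real"
  assumes f: "f \<in> forms d"
  shows "(LINT x|lborel. indicator (ball 0 1) x * (norm x ^ p * f x))
    = (LINT x|area. f x) / (real CARD('n) + real d + real p)"
proof -
  note [measurable] = forms_borel[OF f]
  define u where "u x = f (x /\<^sub>R norm x)" for x
  obtain M where M: "\<And>x. norm x \<le> 1 \<Longrightarrow> \<bar>f x\<bar> \<le> M"
      using forms_bounded_unit_ball[OF f] by blast
  have u [measurable]: "u \<in> borel_measurable borel" unfolding u_def by measurable
  have uM: "\<bar>u x\<bar> \<le> M" for x unfolding u_def by (rule M) (cases "x = 0"; simp)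
  have hom: "u (r *\<^sub>R x) = u x" if "r > 0" for r x
  proof -
    have "(r *\<^sub>R x) /\<^sub>R norm (r *\<^sub>R x) = x /\<^sub>R norm x" using that by
        (simp add: field_simps)
    then show ?thesis by (simp only: u_def)
  qed
  have "f x = norm x ^ d * u x" for x
  proof (cases "x = 0")
    case True then show ?thesis using forms_homogeneous[OF f, of 0 0] by (simp add: u_def)
  next
    case False then show ?thesis unfolding u_def by (rule forms_normalize[OF f])
  qed
  then have "(LINT x|lborel. indicator (ball 0 1) x * (norm x ^ p * f x))
      = (LINT x|lborel. indicator (ball 0 1) x * (norm x ^ (d + p) * u x))"
    by (intro Bochner_Integration.integral_cong) (auto simp: power_add mult_ac)
  moreover have "(LINT x|area. f x) = real CARD('n) * (LINT x|lborel. indicator (ball 0 1) x * u x)"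
  proof -
    have "(LINT x|lborel. indicator (ball 0 1 - {0}) x * u x) = (LINT x|lborel. indicator (ball 0 1) x * u x)"
    proof (rule integral_cong_AE)
      show "AE x in lborel. indicator (ball 0 1 - {0}) x * u x = indicator (ball 0 1) x * u x"
        using AE_lborel_singleton[of 0] by eventually_elim (auto simp: indicator_def)
    qed (unfold measurable_lborel2, auto intro!: borel_measurable_times borel_measurable_indicator)
    then show ?thesis by (simp add: area_integral u_def)
  qed
  moreover have "real CARD('n) + real d + real p > 0" by (simp add: add_pos_nonneg)
  ultimately show ?thesis
    using radial_power_integral[OF u uM hom, of "d + p"] by (simp add: eq_divide_eq mult_ac add.assoc)
qed

text \<open>By translation invariance every difference quotient of \<open>G\<close> has integral 0,
  and dominated convergence carries this over to the derivative.\<close>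

lemma integral_dir_derivative_eq_0:
  fixes G :: "real ^ 'n \<Rightarrow> real"
  assumes G: "continuous_on UNIV G" and D: "continuous_on UNIV D"
    and der: "\<And>x. ((\<lambda>t. G (x + t *\<^sub>R e)) has_real_derivative D x) (at 0)"
    and supp: "\<And>x. norm x \<ge> 1 \<Longrightarrow> G x = 0" and e: "norm e = 1"
  shows "(LINT x|lborel. D x) = 0"
proof -
  have [measurable]: "G \<in> borel_measurable borel" "D \<in> borel_measurable borel"
    using G D by (auto intro: borel_measurable_continuous_onI)
  have der': "((\<lambda>t. G (x + t *\<^sub>R e)) has_real_derivative D (x + s *\<^sub>R e)) (at s)" for x s
    using der[of "x + s *\<^sub>R e"] DERIV_shift[of "\<lambda>t. G (x + t *\<^sub>R e)" _ 0 s]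
    by (simp add: algebra_simps)
  define s :: "nat \<Rightarrow> real" where "s m = 1 / real (Suc m)" for m
  have s: "0 < s m" "s m \<le> 1" for m by (auto simp: s_def)
  have s_lim: "s \<longlonglongrightarrow> 0" unfolding s_def by (rule LIMSEQ_Suc[OF lim_1_over_n])
  define Q where "Q m x = (G (x + s m *\<^sub>R e) - G x) / s m" for m x
  have "compact (D ` cball 0 3)"
    by (rule compact_continuous_image[OF continuous_on_subset[OF D]]) auto
  from compact_imp_bounded[OF this]
  obtain L where L: "\<And>x. x \<in> cball 0 3 \<Longrightarrow> norm (D x) \<le> L"
    unfolding bounded_iff by (metis imageI)
  have intG: "integrable lborel G"
  proof -
    have "G = (\<lambda>x. indicator (ball 0 1) x * G x)"
      using supp by (force simp: indicator_def)
    then show ?thesis using integrable_continuous_on_ball[OF G] by simp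
  qed
  \<comment> \<open>Since \<open>s m \<le> 1\<close> and \<open>G\<close> vanishes outside the unit
    ball, the quotients vanish outside radius 2. Inside it the mean value theorem evaluates
    \<open>D\<close> at a point of norm at most 3, whence the bound \<open>L\<close>.\<close>
  have lim: "(\<lambda>m. LINT x|lborel. Q m x) \<longlonglongrightarrow> (LINT x|lborel. D x)"
  proof (rule integral_dominated_convergence[where w = "\<lambda>x. indicator (cball 0 2) x * L"])
    show "integrable lborel (\<lambda>x :: real ^ 'n. indicator (cball 0 2) x * L)"
      using emeasure_lborel_cball_finite by (intro integrable_mult_left integrable_real_indicator) auto
    show "AE x in lborel. (\<lambda>m. Q m x) \<longlonglongrightarrow> D x"
    proof (rule AE_I2)
      fix x
      have "((\<lambda>h. (G (x + h *\<^sub>R e) - G x) / h) \<longlongrightarrow> D x) (at 0)"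
        using der[of x] by (simp add: DERIV_def)
      moreover have "filterlim s (at 0) sequentially"
        using s_lim s(1) by (auto simp: filterlim_at intro!: always_eventually) (metis less_irrefl)
      ultimately show "(\<lambda>m. Q m x) \<longlonglongrightarrow> D x"
        unfolding Q_def by (rule filterlim_compose)
    qed
    show "AE x in lborel. norm (Q m x) \<le> indicator (cball 0 2) x * L" for m
    proof (rule AE_I2)
      fix x :: "real ^ 'n"
      show "norm (Q m x) \<le> indicator (cball 0 2) x * L"
      proof (cases "x \<in> cball 0 2")
        case True
        obtain z where z: "0 < z" "z < s m" "G (x + s m *\<^sub>R e) - G (x + 0 *\<^sub>R e) = (s m
            - 0) * D (x + z *\<^sub>R e)"
          using MVT2[of 0 "s m" "\<lambda>t. G (x + t *\<^sub>R e)" "\<lambda>t. D (x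
              + t *\<^sub>R e)"] s[of m] der' by auto
        have "norm (x + z *\<^sub>R e) \<le> norm x + norm (z *\<^sub>R e)" by (rule norm_triangle_ineq)
        also have "\<dots> \<le> 3" using True z s[of m] e by auto
        finally have "norm (D (x + z *\<^sub>R e)) \<le> L" by (intro L) simp
        moreover have "Q m x = D (x + z *\<^sub>R e)" using z s[of m] by (simp add: Q_def)
        ultimately show ?thesis using True by simp
      next
        case False
        have "norm x - norm (s m *\<^sub>R e) \<le> norm (x + s m *\<^sub>R e)" by (rule norm_diff_ineq)
        then have "norm (x + s m *\<^sub>R e) \<ge> 1" using False e s[of m] by auto
        then show ?thesis using False supp by (simp add: Q_def)
      qed
    qed
  qed (unfold Q_def, measurable)
  have "(LINT x|lborel. Q m x) = 0" for m
  proof -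
    have eq: "(LINT x|lborel. G (x + s m *\<^sub>R e)) = (LINT x|lborel. G x)"
      by (rule lborel_integral_translate) measurable
    have int': "integrable lborel (\<lambda>x. G (x + s m *\<^sub>R e))"
    proof -
      have "integrable (distr lborel borel (\<lambda>x :: real ^ 'n. s m *\<^sub>R e + x)) G"
        using intG lborel_affine[of 1 "s m *\<^sub>R e"] by (simp add: density_1 one_ennreal_def[symmetric])
      then show ?thesis by (subst (asm) integrable_distr_eq) (auto simp: add.commute)
    qed
    show ?thesis using eq intG int' by (simp add: Q_def)
  qed
  then show ?thesis using lim LIMSEQ_unique tendsto_const by (metis (no_types, lifting) ext)
qed

text \<open>Squaring makes the positive part differentiable at 0 as well; this yields a continuously
  differentiable cutoff supported in the unit ball.\<close>

lemma has_real_derivative_pos_part_square: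
  "((\<lambda>u::real. (max 0 u)\<^sup>2) has_real_derivative 2 * max 0 u) (at u)"
proof -
  consider "u > 0" | "u < 0" | "u = 0" by linarith
  then show ?thesis
  proof cases
    case 1
    have "((\<lambda>u::real. u\<^sup>2) has_real_derivative 2 * u) (at u)"
        by (auto intro!: derivative_eq_intros)
    then have "((\<lambda>u::real. (max 0 u)\<^sup>2) has_real_derivative 2 * u) (at u)"
      by (rule has_field_derivative_transform_within_open[of _ _ _ "{0<..}"]) (use 1 in auto)
    then show ?thesis using 1 by simp
  next
    case 2
    have "((\<lambda>u::real. 0) has_real_derivative 0) (at u)" by simp
    then have "((\<lambda>u::real. (max 0 u)\<^sup>2) has_real_derivative 0) (at u)"
      by (rule has_field_derivative_transform_within_open[of _ _ _ "{..<0}"]) (use 2 in auto)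
    then show ?thesis using 2 by simp
  next
    case 3
    have "((\<lambda>h::real. (max 0 h)\<^sup>2 / h) \<longlongrightarrow> 0) (at 0)"
    proof (rule Lim_null_comparison)
      show "eventually (\<lambda>h::real. norm ((max 0 h)\<^sup>2 / h) \<le> \<bar>h\<bar>) (at 0)"
        by (intro always_eventually) (auto simp: max_def power2_eq_square)
      show "((\<lambda>h::real. \<bar>h\<bar>) \<longlongrightarrow> 0) (at 0)"
          by (rule tendsto_rabs_zero) (rule tendsto_ident_at)
    qed
    then show ?thesis using 3 by (simp add: DERIV_def)
  qed
qed

text \<open>The derivative of \<open>(w x)\<^sup>2 * g x\<close> has integral 0, where
  \<open>w\<close> is a cutoff that is polynomial in the ball. Passing from ball to sphere weight by
  weight leaves one linear relation between the two sphere integrals.\<close>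

lemma area_integration_by_parts:
  fixes g :: "real ^ 'n \<Rightarrow> real"
  assumes g: "g \<in> forms d"
  shows "(real CARD('n) + real d - 1) * (LINT x|area. x $ i * g x) = (LINT x|area. pd i g x)"
proof -
  let ?e = "axis i 1 :: real ^ 'n"
  define w where "w x = max 0 (1 - (norm x)\<^sup>2)" for x :: "real ^ 'n"
  define D where "D x = - 4 * (x $ i) * w x * g x + (w x)\<^sup>2 * pd i g x" for x
  have cw: "continuous_on UNIV w" unfolding w_def by (intro continuous_intros)
  have zero: "(LINT x|lborel. D x) = 0"
  proof (rule integral_dir_derivative_eq_0)
    show "continuous_on UNIV (\<lambda>x. (w x)\<^sup>2 * g x)"
      by (intro continuous_intros cw forms_continuous[OF g])
    show "continuous_on UNIV D" unfolding D_def
      by (intro continuous_intros cw forms_continuous[OF g] forms_continuous[OF forms_pd[OF g]])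
    show "(w x)\<^sup>2 * g x = 0" if "norm x \<ge> 1" for x
    proof -
      have "(norm x)\<^sup>2 \<ge> 1" using that by simp
      then show ?thesis by (simp add: w_def)
    qed
    show "norm ?e = 1" by (simp add: norm_axis_1)
    fix x :: "real ^ 'n"
    have "((\<lambda>t. 1 - (norm (x + t *\<^sub>R ?e))\<^sup>2) has_real_derivative - 2 * x $ i) (at 0)"
    proof -
      have "(\<lambda>t. 1 - (norm (x + t *\<^sub>R ?e))\<^sup>2) = (\<lambda>t. 1 - ((norm x)\<^sup>2
          + 2 * t * (x $ i) + t\<^sup>2))"
        unfolding fun_eq_iff power2_norm_eq_inner inner_add_left inner_add_right
          inner_scaleR_left inner_scaleR_right
        by (simp add: inner_axis inner_commute[of ?e] power2_eq_square algebra_simps)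
      then show ?thesis by (auto intro!: derivative_eq_intros)
    qed
    then have "((\<lambda>t. (max 0 (1 - (norm (x + t *\<^sub>R ?e))\<^sup>2))\<^sup>2) has_real_derivative
        2 * max 0 (1 - (norm (x + 0 *\<^sub>R ?e))\<^sup>2) * (- 2 * x $ i)) (at 0)"
      by (rule DERIV_chain2[OF has_real_derivative_pos_part_square])
    then have "((\<lambda>t. (w (x + t *\<^sub>R ?e))\<^sup>2) has_real_derivative - 4 * (x $ i) * w x) (at 0)"
      by (simp add: w_def mult_ac)
    from DERIV_mult[OF this forms_has_pd[OF g, of x i]]
    show "((\<lambda>t. (w (x + t *\<^sub>R ?e))\<^sup>2 * g (x
        + t *\<^sub>R ?e)) has_real_derivative D x) (at 0)"
      by (simp add: D_def mult_ac)
  qed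
  define E where "E p f = (LINT x :: real ^ 'n|lborel. indicator (ball 0 1) x * (norm x ^ p * f x))" for p f
  have xg: "(\<lambda>x. x $ i * g x) \<in> forms (Suc d)" by (rule forms_coord_mult[OF g])
  have pg: "pd i g \<in> forms (d - 1)" by (rule forms_pd[OF g])
  have int: "integrable lborel (\<lambda>x. indicator (ball 0 1) x * (norm x ^ p * f x))"
    if "f \<in> forms m" for p m and f :: "real ^ 'n \<Rightarrow> real"
    by (intro integrable_continuous_on_ball continuous_intros forms_continuous[OF that])
  \<comment> \<open>The cutoff is expanded in powers of the norm: the derivative of
    \<open>(w x)\<^sup>2\<close> gives the weights 0 and 2, and \<open>(w x)\<^sup>2\<close> itself
    the weights 0, 2 and 4. Outside the open ball both sides vanish.\<close>
  have "D x = (- 4) * (indicator (ball 0 1) x * (norm x ^ 0 * (x $ i * g x)))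
     + 4 * (indicator (ball 0 1) x * (norm x ^ 2 * (x $ i * g x)))
     + (indicator (ball 0 1) x * (norm x ^ 0 * pd i g x))
     - 2 * (indicator (ball 0 1) x * (norm x ^ 2 * pd i g x))
     + (indicator (ball 0 1) x * (norm x ^ 4 * pd i g x))" for x
  proof (cases "norm x < 1")
    case True
    then have "(norm x)\<^sup>2 < 1" by (simp add: power_less_one_iff)
    then have w: "w x = 1 - (norm x)\<^sup>2" by (simp add: w_def)
    show ?thesis using True unfolding D_def w
      by (simp add: algebra_simps power2_eq_square power4_eq_xxxx)
  next
    case False
    then have "(norm x)\<^sup>2 \<ge> 1" by simp
    then have "w x = 0" by (simp add: w_def)
    then show ?thesis using False by (simp add: D_def)
  qed
  then have "(LINT x|lborel. D x) = (- 4) * E 0 (\<lambda>x. x $ i * g x) + 4 * E 2 (\<lambda>x. x $ i * g x)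
     + E 0 (pd i g) - 2 * E 2 (pd i g) + E 4 (pd i g)"
    unfolding E_def
    by (simp only:, intro has_bochner_integral_integral_eq has_bochner_integral_add
        has_bochner_integral_diff has_bochner_integral_mult_right has_bochner_integral_integrable
        int[OF xg] int[OF pg])
  then have eq: "4 * E 0 (\<lambda>x. x $ i * g x) - 4 * E 2 (\<lambda>x. x $ i * g x)
     = E 0 (pd i g) - 2 * E 2 (pd i g) + E 4 (pd i g)"
    using zero by simp
  define I where "I = (LINT x|area. x $ i * g x)"
  define J where "J = (LINT x|area. pd i g x)"
  define N where "N = real CARD('n) + real d"
  have "1 \<le> CARD('n)" by (simp add: Suc_leI)
  then have N: "N \<ge> 1" unfolding N_def by linarith
  have E1: "E p (\<lambda>x. x $ i * g x) = I / (N + 1 + real p)" for p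
    unfolding E_def I_def N_def using area_integral_forms[OF xg, of p] by (simp add: algebra_simps)
  show ?thesis
  \<comment> \<open>For \<open>d = 0\<close> the degree \<open>d - 1\<close> is truncated, so the
    denominators \<open>N - 1 + p\<close> for \<open>pd i g\<close> would be wrong; there the
    relation reduces to \<open>I = 0\<close>.\<close>
  proof (cases "d = 0")
    case True
    then have pd0: "pd i g = (\<lambda>_. 0)" using pd_degree_0 g by blast
    then have "E 0 (\<lambda>x. x $ i * g x) = E 2 (\<lambda>x. x $ i * g x)" using eq by (simp add: E_def)
    then have "I = 0" unfolding E1 using N by (simp add: field_simps)
    then show ?thesis by (simp add: I_def pd0)
  next
    case False
    have E2: "E p (pd i g) = J / (N - 1 + real p)" for p
      unfolding E_def J_def N_def using area_integral_forms[OF pg, of p] False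
      by (simp add: algebra_simps of_nat_diff)
    have N2: "N > 1" using False \<open>1 \<le> CARD('n)\<close> unfolding N_def by linarith
    have l: "4 * (I / (N + 1)) - 4 * (I / (N + 3)) = 8 * I / ((N + 1) * (N + 3))"
      using N by (simp add: field_simps)
    have r: "J / (N - 1) - 2 * (J / (N + 1)) + J / (N + 3) = 8 * J / ((N - 1) * (N + 1) * (N + 3))"
    proof -
      have "N - 1 \<noteq> 0" "N + 1 \<noteq> 0" "N + 3 \<noteq> 0" using N2 by auto
      then show ?thesis by (simp add: divide_simps) algebra
    qed
    have "8 * I / ((N + 1) * (N + 3)) = 8 * J / ((N - 1) * (N + 1) * (N + 3))"
      using eq[unfolded E1 E2] l r by (simp add: add.commute)
    moreover have "N - 1 \<noteq> 0" "(N + 1) * (N + 3) \<noteq> 0" using N2 by auto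
    ultimately have "(N - 1) * I = J" by (simp add: divide_simps) (simp add: mult.commute)
    then show ?thesis by (simp add: I_def J_def N_def)
  qed
qed

text \<open>The sphere integral of \<open>f * f\<close> is a positive multiple of its ball integral.
  A form that is nonzero somewhere is, by homogeneity and continuity, nonzero on a small ball inside
  the unit ball, which has positive volume.\<close>

lemma forms_eq_0_if_sphere_norm_0:
  fixes f :: "real ^ 'n \<Rightarrow> real"
  assumes f: "f \<in> forms d" and z: "(LINT x|area. f x * f x) = 0"
  shows "f = (\<lambda>_. 0)"
proof (rule ccontr)
  assume "f \<noteq> (\<lambda>_. 0)"
  then obtain x0 where x0: "f x0 \<noteq> 0" by (auto simp: fun_eq_iff)
  define c where "c = 1 / (2 * (norm x0 + 1))"
  have c: "c > 0" unfolding c_def by (simp add: add_nonneg_pos)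
  have "norm (c *\<^sub>R x0) < 1"
    by (simp add: c_def divide_simps add_nonneg_pos)
  moreover have "f (c *\<^sub>R x0) \<noteq> 0" using x0 c forms_homogeneous[OF f] by simp
  ultimately have ne: "c *\<^sub>R x0 \<in> {x \<in> ball 0 1. f x \<noteq> 0}" by simp
  have "open {x \<in> ball 0 1. f x \<noteq> 0}"
  proof -
    have "{x \<in> ball 0 1. f x \<noteq> 0} = ball 0 1 \<inter> f -` (- {0})" by auto
    then show ?thesis
      using continuous_open_preimage[OF forms_continuous[OF f, of "ball 0 1"] open_ball, of "- {0}"] by auto
  qed
  then obtain r where r: "r > 0" "ball (c *\<^sub>R x0) r \<subseteq> {x \<in> ball 0 1. f x \<noteq> 0}"
    using ne open_contains_ball by blast
  have ff: "(\<lambda>x. f x * f x) \<in> forms (d + d)" by (rule forms_mult[OF f f])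
  have "(LINT x|lborel. indicator (ball 0 1) x * (f x * f x)) = 0"
    using area_integral_forms[OF ff, of 0] z by simp
  moreover have "integrable lborel (\<lambda>x. indicator (ball 0 1) x * (f x * f x))"
    by (rule integrable_continuous_on_ball) (rule forms_continuous[OF ff])
  ultimately have "AE x in lborel. indicator (ball 0 1) x * (f x * f x) = 0"
    by (subst (asm) integral_nonneg_eq_0_iff_AE) auto
  then have "AE x in lborel. x \<notin> ball (c *\<^sub>R x0) r"
    by eventually_elim (use r in \<open>auto simp: indicator_def split: if_splits\<close>)
  then have "ball (c *\<^sub>R x0) r \<in> null_sets lborel"
    by (subst AE_iff_null_sets) auto
  then have "measure lborel (ball (c *\<^sub>R x0) r) = 0" by (auto simp: measure_def)
  then show False using content_ball_pos[OF r(1), of "c *\<^sub>R x0"] by simp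
qed

subsection \<open>Harmonic forms\<close>

lemma sph_inner_commute: "sph_inner f g = sph_inner g f"
  by (simp add: sph_inner_def mult.commute)

lemma sph_inner_cong:
  assumes "\<And>x. norm x = 1 \<Longrightarrow> f x * g x = f' x * g' x"
  shows "sph_inner f g = sph_inner f' g'"
  unfolding sph_inner_def using assms
  by (intro Bochner_Integration.integral_cong) (auto simp: space_area)

lemma sph_inner_add_left:
  assumes "continuous_on UNIV f" "continuous_on UNIV g" "continuous_on UNIV h"
  shows "sph_inner (\<lambda>x. f x + g x) h = sph_inner f h + sph_inner g h"
  unfolding sph_inner_def
  by (subst Bochner_Integration.integral_add[symmetric])
    (auto intro!: area_integrable continuous_intros assms simp: distrib_right)

lemma sph_inner_cmult_left: "sph_inner (\<lambda>x. c * f x) g = c * sph_inner f g"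
  by (simp add: sph_inner_def mult.assoc)

lemma sph_inner_zero_left [simp]: "sph_inner (\<lambda>_. 0) g = 0"
  by (simp add: sph_inner_def)

lemma sph_inner_zero_right [simp]: "sph_inner g (\<lambda>_. 0) = 0"
  by (simp add: sph_inner_def)

lemma sph_inner_add_right:
  assumes "continuous_on UNIV f" "continuous_on UNIV g" "continuous_on UNIV h"
  shows "sph_inner h (\<lambda>x. f x + g x) = sph_inner h f + sph_inner h g"
  using sph_inner_add_left[OF assms] by (simp add: sph_inner_commute)

lemma sph_inner_cmult_right: "sph_inner f (\<lambda>x. c * g x) = c * sph_inner f g"
  by (simp only: sph_inner_commute[of f] sph_inner_cmult_left)

lemma sph_inner_sum_left:
  assumes "\<And>a. a \<in> A \<Longrightarrow> continuous_on UNIV (f a)" "continuous_on UNIV h"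
  shows "sph_inner (\<lambda>x. \<Sum>a\<in>A. f a x) h = (\<Sum>a\<in>A. sph_inner (f a) h)"
  using assms
  by (induction A rule: infinite_finite_induct)
     (simp_all add: sph_inner_add_left continuous_on_sum)

lemma sph_inner_sum_right:
  assumes "\<And>a. a \<in> A \<Longrightarrow> continuous_on UNIV (f a)" "continuous_on UNIV h"
  shows "sph_inner h (\<lambda>x. \<Sum>a\<in>A. f a x) = (\<Sum>a\<in>A. sph_inner h (f a))"
  using sph_inner_sum_left[OF assms] by (simp add: sph_inner_commute)

text \<open>Trades a coordinate factor for derivatives, which lower degrees. Together with Euler's
  identity it drives the degree arguments below.\<close>

lemma sph_inner_by_parts:
  fixes f g :: "real ^ 'n \<Rightarrow> real"
  assumes f: "f \<in> forms a" and g: "g \<in> forms b"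
  shows "(real CARD('n) + real a + real b - 1) * sph_inner (\<lambda>x. x $ i * f x) g
    = sph_inner (pd i f) g + sph_inner f (pd i g)"
proof -
  have "(LINT x|area. pd i (\<lambda>x. f x * g x) x) = sph_inner (pd i f) g + sph_inner f (pd i g)"
    unfolding sph_inner_def pd_mult[OF f g]
    by (intro Bochner_Integration.integral_add area_integrable continuous_intros
        forms_continuous[OF f] forms_continuous[OF g]
        forms_continuous[OF forms_pd[OF f]] forms_continuous[OF forms_pd[OF g]])
  then show ?thesis
    using area_integration_by_parts[OF forms_mult[OF f g], of i]
    by (simp add: sph_inner_def mult.assoc add.assoc)
qed

text \<open>Euler's identity and integration by parts replace \<open>f\<close> by its second
  derivatives, whose degree is again odd; in degree 1 they vanish. This takes the place of antipodal
  symmetry and will remove the odd coefficients of \<open>h\<close>.\<close>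

lemma area_integral_odd_form:
  fixes f :: "real ^ 'n \<Rightarrow> real"
  assumes "CARD('n) \<ge> 2" and "f \<in> forms d" "odd d"
  shows "(LINT x|area. f x) = 0"
  using assms(2,3)
proof (induction d arbitrary: f rule: less_induct)
  case (less d)
  then obtain m where d: "d = Suc m" by (cases d) auto
  note f = less.prems(1)[unfolded d]
  have 0: "(LINT x|area. x $ i * pd i f x) = 0" for i
  proof -
    have p: "pd i f \<in> forms m" using forms_pd[OF f, of i] by simp
    have "(LINT x|area. pd i (pd i f) x) = 0"
    \<comment> \<open>For \<open>m = 0\<close> the truncated degree \<open>m - 1\<close> is the even
      number 0, so the induction hypothesis does not apply.\<close>
    proof (cases "m = 0")
      case True
      have "pd i (pd i f) = (\<lambda>_. 0)" using p unfolding True by (rule pd_degree_0)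
      then show ?thesis by simp
    next
      case False
      then have "m - 1 < d" "odd (m - 1)" using less.prems(2) d by auto
      then show ?thesis using less.IH[of "m - 1" "pd i (pd i f)"] forms_pd[OF p] by blast
    qed
    then show ?thesis using area_integration_by_parts[OF p, of i] assms(1) by auto
  qed
  have "real (Suc m) * (LINT x|area. f x) = (LINT x|area. real (Suc m) * f x)" by simp
  also have "\<dots> = (LINT x|area. (\<Sum>i\<in>UNIV. x $ i * pd i f x))"
    by (simp only: euler_identity[OF f])
  also have "\<dots> = (\<Sum>i\<in>UNIV. (LINT x|area. x $ i * pd i f x))"
    by (intro Bochner_Integration.integral_sum area_integrable continuous_intros
        forms_continuous[OF forms_pd[OF f]])
  finally show ?case using 0 by simp
qed

text \<open>Writing \<open>m * p\<close> as the sum of \<open>x $ i * pd i p\<close> and integrating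
  by parts leaves the pairings of \<open>pd i (pd i p)\<close> with \<open>f\<close> and of
  \<open>pd i p\<close> with \<open>pd i f\<close>. In both the left factor has smaller degree than
  \<open>p\<close> and the right factor is harmonic of still larger degree.\<close>

lemma harmonic_orthogonal:
  fixes f p :: "real ^ 'n \<Rightarrow> real"
  assumes n: "CARD('n) \<ge> 2" and "p \<in> forms m" "f \<in> harmonic_forms j" "m < j"
  shows "sph_inner p f = 0"
  using assms(2-)
proof (induction m arbitrary: p f j rule: less_induct)
  case (less m)
  have f: "f \<in> forms j" and lap: "\<And>x. (\<Sum>i\<in>UNIV. pd i (pd i f) x) = 0"
    using less.prems(2) laplacian_forms[of f j] by (auto simp: harmonic_forms_def)
  show ?case
  proof (cases m)
    case 0
    \<comment> \<open>For a constant \<open>p\<close> Euler's identity for \<open>p\<close> only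
      says \<open>0 = 0\<close>. It is applied to \<open>f\<close> instead, and integration by parts
      produces the Laplacian of \<open>f\<close>.\<close>
    define c where "c = p 0"
    have p: "p = (\<lambda>_. c)" using less.prems(1) 0 forms_degree_0 unfolding c_def by blast
    have "(real CARD('n) + real (j - 1) - 1) * (real j * sph_inner p f)
      = (real CARD('n) + real (j - 1) - 1) * sph_inner p (\<lambda>x. \<Sum>i\<in>UNIV. x $ i * pd i f x)"
      by (simp only: euler_identity[OF f] sph_inner_cmult_right)
    also have "\<dots> = (real CARD('n) + real (j - 1) - 1) * (\<Sum>i\<in>UNIV. sph_inner p (\<lambda>x. x
        $ i * pd i f x))"
      by (subst sph_inner_sum_right)
        (auto intro!: continuous_intros forms_continuous[OF forms_pd[OF f]] simp: p)
    also have "\<dots> = (\<Sum>i\<in>UNIV. (real CARD('n) + real (j - 1) + real m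
        - 1) * sph_inner (\<lambda>x. x $ i * pd i f x) p)"
      by (simp add: sum_distrib_left 0 sph_inner_commute[of p])
    also have "\<dots> = (\<Sum>i\<in>UNIV. sph_inner (pd i (pd i f)) p)"
      unfolding sph_inner_by_parts[OF forms_pd[OF f] less.prems(1)] by (simp add: p)
    also have "\<dots> = sph_inner (\<lambda>x. \<Sum>i\<in>UNIV. pd i (pd i f) x) p"
      by (rule sph_inner_sum_left[symmetric])
        (auto intro: forms_continuous[OF forms_pd[OF forms_pd[OF f]]] simp: p)
    also have "\<dots> = 0" by (simp add: lap)
    finally show ?thesis using n less.prems(3) by auto
  next
    case (Suc m')
    note p = less.prems(1)
    have q: "pd i p \<in> forms m'" for i using forms_pd[OF p] Suc by simp
    have "sph_inner (\<lambda>x. x $ i * pd i p x) f = 0" for i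
    proof -
      have "sph_inner (pd i (pd i p)) f = 0"
        by (rule less.IH[of "m' - 1", OF _ forms_pd[OF q] less.prems(2)]) (use less.prems(3) Suc in auto)
      moreover have "sph_inner (pd i p) (pd i f) = 0"
        using less.IH[of m' "pd i p" "pd i f" "j - 1"] q harmonic_pd[OF less.prems(2)] less.prems(3) Suc by simp
      ultimately have "(real CARD('n) + real m' + real j - 1) * sph_inner (\<lambda>x. x $ i * pd i p x) f = 0"
        using sph_inner_by_parts[OF q f, of i] by simp
      moreover have "real CARD('n) + real m' + real j - 1 \<noteq> 0" using n by linarith
      ultimately show ?thesis unfolding mult_eq_0_iff by blast
    qed
    moreover have "real m * sph_inner p f = sph_inner (\<lambda>x. \<Sum>i\<in>UNIV. x $ i * pd i p x) f"
      by (simp only: euler_identity[OF p] sph_inner_cmult_left)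
    moreover have "\<dots> = (\<Sum>i\<in>UNIV. sph_inner (\<lambda>x. x $ i * pd i p x) f)"
      by (rule sph_inner_sum_left) (auto intro!: continuous_intros forms_continuous[OF q]
          forms_continuous[OF f])
    ultimately show ?thesis using Suc by simp
  qed
qed

lemma harmonic_orthogonal_neq:
  fixes f g :: "real ^ 'n \<Rightarrow> real"
  assumes "CARD('n) \<ge> 2" "f \<in> harmonic_forms i" "g \<in> harmonic_forms j" "i \<noteq> j"
  shows "sph_inner f g = 0"
proof (cases "i < j")
  case True then show ?thesis using harmonic_orthogonal[OF assms(1) harmonic_formsD[OF assms(2)] assms(3)]
      by simp
next
  case False
  then show ?thesis using harmonic_orthogonal[OF assms(1) harmonic_formsD[OF assms(3)] assms(2)] assms(4)
    by (simp add: sph_inner_commute)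
qed

text \<open>Orthonormal families in \<open>V\<close> are independent, hence bounded in size by a
  finite spanning set of the forms, so a largest one exists. If its expansion missed some
  \<open>f\<close>, the normalised residue would enlarge it.\<close>

lemma orthonormal_basis_exists:
  fixes V :: "(real ^ 'n \<Rightarrow> real) set"
  assumes V: "subspace V" "V \<subseteq> forms d"
  obtains E where "finite E" "E \<subseteq> V" "card E = dim V"
    "\<And>e e'. e \<in> E \<Longrightarrow> e' \<in> E \<Longrightarrow> sph_inner e e' = (if e
        = e' then 1 else 0)"
    "\<And>f. f \<in> V \<Longrightarrow> f = (\<lambda>x. \<Sum>e\<in>E. sph_inner f e * e x)"
proof -
  define on where "on E \<longleftrightarrow> finite E \<and> E \<subseteq> V \<and>
    (\<forall>e\<in>E. \<forall>e'\<in>E. sph_inner e e' = (if e = e' then 1 else 0))" for E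
  have cont: "continuous_on UNIV f" if "f \<in> V" for f using that V(2) forms_continuous by blast
  obtain B where B: "finite B" "forms d \<subseteq> span (B :: (real ^ 'n \<Rightarrow> real) set)"
    using forms_finite_span by blast
  have comb: "sph_inner (\<lambda>x. \<Sum>e\<in>E. u e * e x) e0 = u e0" if E: "on E" "e0 \<in> E" for E u e0
  proof -
    have "sph_inner (\<lambda>x. \<Sum>e\<in>E. u e * e x) e0
        = (\<Sum>e\<in>E. sph_inner (\<lambda>x. u e * e x) e0)"
      by (rule sph_inner_sum_left) (use E cont in \<open>auto simp: on_def intro!: continuous_intros\<close>)
    also have "\<dots> = (\<Sum>e\<in>E. if e = e0 then u e else 0)"
      using E by (intro sum.cong) (auto simp: sph_inner_cmult_left on_def)
    also have "\<dots> = u e0" using E by (simp add: on_def)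
    finally show ?thesis .
  qed
  have ind: "independent E" if E: "on E" for E
  proof
    assume "dependent E"
    then obtain u e0 where u: "e0 \<in> E" "u e0 \<noteq> 0" "(\<Sum>e\<in>E. u e *\<^sub>R e) = 0"
      using dependent_finite[of E] E unfolding on_def by blast
    from u(3) have "(\<lambda>x. \<Sum>e\<in>E. u e * e x) = (\<lambda>_. 0)"
      by (simp add: fun_eq_iff sum_fun_apply scaleR_fun_def)
    then show False using comb[OF E u(1), of u] u(2) by simp
  qed
  have bound: "card E \<le> card B" if E: "on E" for E
  proof -
    have "E \<subseteq> span B" using E V(2) B(2) by (auto simp: on_def)
    then show ?thesis using independent_span_bound[OF B(1) ind[OF E]] by blast
  qed
  have "on {}" by (simp add: on_def)
  then obtain E where E: "on E" and max: "\<And>E'. on E' \<Longrightarrow> card E' \<le> card E"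
    using ex_has_greatest_nat[of on "{}" card "Suc (card B)"] bound le_imp_less_Suc by blast
  have exp: "f = (\<lambda>x. \<Sum>e\<in>E. sph_inner f e * e x)" if f: "f \<in> V" for f
  proof (rule ccontr)
    assume ne: "f \<noteq> (\<lambda>x. \<Sum>e\<in>E. sph_inner f e * e x)"
    define p where "p = (\<Sum>e\<in>E. sph_inner f e *\<^sub>R e)"
    have p: "p = (\<lambda>x. \<Sum>e\<in>E. sph_inner f e * e x)"
      by (simp add: p_def fun_eq_iff sum_fun_apply scaleR_fun_def)
    have pV: "p \<in> V" unfolding p_def
      using E V(1) by (intro subspace_sum subspace_scale) (auto simp: on_def)
    define r where "r = f + (- 1) *\<^sub>R p"
    have r: "r = (\<lambda>x. f x + (- 1) * p x)"
      by (simp add: r_def fun_eq_iff scaleR_fun_def)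
    have rV: "r \<in> V" unfolding r_def using V(1) f pV by (intro subspace_add subspace_scale)
    have rE: "sph_inner r e = 0" if "e \<in> E" for e
    proof -
      have "e \<in> V" using that E by (auto simp: on_def)
      then have "sph_inner r e = sph_inner f e + sph_inner (\<lambda>x. (- 1) * p x) e"
        unfolding r by (intro sph_inner_add_left continuous_intros cont f pV)
      then show ?thesis unfolding sph_inner_cmult_left p comb[OF E that] by simp
    qed
    have "r \<noteq> (\<lambda>_. 0)" using ne unfolding r p[symmetric] by (auto simp: fun_eq_iff)
    then have ne0: "sph_inner r r \<noteq> 0"
      using forms_eq_0_if_sphere_norm_0[of r d] rV V(2) unfolding sph_inner_def by blast
    moreover have "sph_inner r r \<ge> 0"
      unfolding sph_inner_def by (intro Bochner_Integration.integral_nonneg) simp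
    ultimately have pos: "sph_inner r r > 0" by simp
    define c where "c = 1 / sqrt (sph_inner r r)"
    define e where "e = c *\<^sub>R r"
    have e: "e = (\<lambda>x. c * r x)" by (simp add: e_def fun_eq_iff scaleR_fun_def)
    have eV: "e \<in> V" unfolding e_def using V(1) rV by (intro subspace_scale)
    have ee: "sph_inner e e = 1"
      unfolding e sph_inner_cmult_left sph_inner_cmult_right using pos by (simp add: c_def)
    have eE: "sph_inner e e' = 0" if "e' \<in> E" for e'
      unfolding e sph_inner_cmult_left using rE[OF that] by simp
    have "e \<notin> E" using ee eE by fastforce
    moreover have "on (insert e E)"
      using E eV ee eE eE[unfolded sph_inner_commute[of e]] unfolding on_def by auto
    ultimately show False using max[of "insert e E"] E by (simp add: on_def)
  qed
  have "V \<subseteq> span E"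
  proof
    fix f assume "f \<in> V"
    then have "f = (\<Sum>e\<in>E. sph_inner f e *\<^sub>R e)"
      using exp by (simp add: fun_eq_iff sum_fun_apply scaleR_fun_def)
    moreover have "(\<Sum>e\<in>E. sph_inner f e *\<^sub>R e) \<in> span E"
      by (intro span_sum span_scale span_base)
    ultimately show "f \<in> span E" by (simp only:)
  qed
  then have "card E = dim V" using E ind[OF E] dim_unique[of E V "card E"] by (simp add: on_def)
  then show ?thesis using that[of E] E exp unfolding on_def by blast
qed

text \<open>With \<open>p\<close> the Laplacian of \<open>h\<close>, two integrations by parts move
  both derivatives from \<open>h\<close> to \<open>p\<close>. Summed over \<open>i\<close>, all
  terms become multiples of the pairings of \<open>h\<close> with \<open>p\<close> and with the
  Laplacian of \<open>p\<close>; these are zero, so \<open>p\<close> pairs to zero with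
  itself.\<close>

lemma harmonic_if_orthogonal:
  fixes h :: "real ^ 'n \<Rightarrow> real"
  assumes h: "h \<in> forms (d + 2)" and orth: "\<And>q. q \<in> forms d \<Longrightarrow> sph_inner h q = 0"
  shows "h \<in> harmonic_forms (d + 2)"
proof -
  define p where "p = laplacian h"
  have p: "p \<in> forms d" unfolding p_def using forms_laplacian[OF h] by simp
  have ph: "pd i h \<in> forms (d + 1)" for i using forms_pd[OF h, of i] by simp
  have pp: "pd i p \<in> forms (d - 1)" for i using forms_pd[OF p, of i] .
  note cont = forms_continuous[OF p] forms_continuous[OF h] forms_continuous[OF ph] forms_continuous[OF pp]
  have 1: "(\<Sum>i\<in>UNIV. sph_inner (\<lambda>x. x $ i * pd i h x) p) = 0"
  proof -
    have "(\<Sum>i\<in>UNIV. sph_inner (\<lambda>x. x $ i * pd i h x) p)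
        = sph_inner (\<lambda>x. \<Sum>i\<in>UNIV. x $ i * pd i h x) p"
      by (rule sph_inner_sum_left[symmetric]) (intro continuous_intros cont)+
    also have "\<dots> = real (d + 2) * sph_inner h p"
      by (simp only: euler_identity[OF h] sph_inner_cmult_left)
    finally show ?thesis using orth[OF p] by simp
  qed
  have 2: "(\<Sum>i\<in>UNIV. sph_inner (\<lambda>x. x $ i * h x) (pd i p)) = 0"
  proof -
    have "(\<Sum>i\<in>UNIV. sph_inner (\<lambda>x. x $ i * h x) (pd i p))
        = (\<Sum>i\<in>UNIV. sph_inner h (\<lambda>x. x $ i * pd i p x))"
      by (intro sum.cong sph_inner_cong) auto
    also have "\<dots> = sph_inner h (\<lambda>x. \<Sum>i\<in>UNIV. x $ i * pd i p x)"
      by (rule sph_inner_sum_right[symmetric]) (intro continuous_intros cont)+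
    also have "\<dots> = real d * sph_inner h p"
      by (simp only: euler_identity[OF p] sph_inner_cmult_right)
    finally show ?thesis using orth[OF p] by simp
  qed
  have 3: "(\<Sum>i\<in>UNIV. sph_inner h (pd i (pd i p))) = 0"
  proof -
    have "(\<Sum>i\<in>UNIV. sph_inner h (pd i (pd i p))) = sph_inner h (laplacian p)"
      unfolding laplacian_forms[OF p, abs_def]
      by (rule sph_inner_sum_right[symmetric]) (intro forms_continuous[OF forms_pd[OF pp]] cont)+
    also have "\<dots> = 0"
    proof (cases "d \<ge> 2")
      case True
      \<comment> \<open>The Laplacian of \<open>p\<close> has degree \<open>d - 2\<close>; the
        factor \<open>(norm x)\<^sup>2\<close>, which is 1 on the sphere, brings it back to degree
        \<open>d\<close>, where orthogonality is known.\<close>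
      have "sph_inner h (laplacian p) = sph_inner h (\<lambda>x. (norm x)\<^sup>2 * laplacian p x)"
        by (rule sph_inner_cong) auto
      also have "\<dots> = 0"
        using forms_mult[OF forms_norm_sq forms_laplacian[OF p]] orth
        unfolding le_add_diff_inverse[OF True] by blast
      finally show ?thesis .
    next
      case False
      then have "pd i (pd i p) = (\<lambda>_. 0)" for i using pd_degree_0 pp[of i] by simp
      then show ?thesis by (simp add: laplacian_forms[OF p, abs_def])
    qed
    finally show ?thesis .
  qed
  have "sph_inner (pd i (pd i h)) p
      = (real CARD('n) + real (d + 1) + real d - 1) * sph_inner (\<lambda>x. x $ i * pd i h x) p
       - ((real CARD('n) + real (d + 2) + real (d - 1) - 1) * sph_inner (\<lambda>x. x $ i * h x) (pd i p)
          - sph_inner h (pd i (pd i p)))" for i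
    using sph_inner_by_parts[OF ph p, of i] sph_inner_by_parts[OF h pp, of i] by simp
  then have "(\<Sum>i\<in>UNIV. sph_inner (pd i (pd i h)) p) = 0"
    using 1 2 3 by (simp add: sum_subtractf sum_distrib_left[symmetric])
  moreover have "sph_inner p p = (\<Sum>i\<in>UNIV. sph_inner (pd i (pd i h)) p)"
    unfolding p_def laplacian_forms[OF h, abs_def]
    by (rule sph_inner_sum_left) (use p in \<open>auto intro!: forms_continuous[OF forms_pd[OF ph]]
        forms_continuous
        simp: p_def laplacian_forms[OF h, abs_def]\<close>)
  ultimately have "p = (\<lambda>_. 0)"
    using forms_eq_0_if_sphere_norm_0[OF p] by (simp add: sph_inner_def)
  then show ?thesis using h by (simp add: harmonic_forms_def p_def)
qed

text \<open>The second summand is the orthogonal projection of \<open>f\<close> to the multiples of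
  \<open>(norm x)\<^sup>2\<close>. On the sphere these multiples have the same values as forms of
  degree \<open>d\<close>, so the residue is orthogonal to all of \<open>forms d\<close> and
  therefore harmonic.\<close>

lemma harmonic_decomposition_step:
  fixes f :: "real ^ 'n \<Rightarrow> real"
  assumes f: "f \<in> forms (d + 2)"
  obtains h q where "h \<in> harmonic_forms (d + 2)" "q \<in> forms d" "f = (\<lambda>x. h x
      + (norm x)\<^sup>2 * q x)"
proof -
  define V where "V = (\<lambda>q x. (norm x)\<^sup>2 * q x) ` (forms d :: (real ^ 'n \<Rightarrow> real) set)"
  have VF: "V \<subseteq> forms (d + 2)"
    unfolding V_def using forms_mult[OF forms_norm_sq, of _ d] by (auto simp: add.commute)
  have "subspace V"
  proof (rule subspaceI)
    show "0 \<in> V" unfolding V_def by (rule image_eqI[of _ _ "\<lambda>_. 0"]) (auto simp: fun_eq_iff)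
    fix u v c assume "u \<in> V"
    then obtain q where q: "q \<in> forms d" "u = (\<lambda>x. (norm x)\<^sup>2 * q x)" by (auto simp: V_def)
    show "c *\<^sub>R u \<in> V"
      unfolding V_def q(2) by (rule image_eqI[OF _ forms_cmult[OF q(1), of c]])
          (simp add: fun_eq_iff scaleR_fun_def)
    assume "v \<in> V"
    then obtain q' where q': "q' \<in> forms d" "v = (\<lambda>x. (norm x)\<^sup>2 * q' x)"
        by (auto simp: V_def)
    show "u + v \<in> V"
      unfolding V_def q(2) q'(2)
      by (rule image_eqI[OF _ forms_add[OF q(1) q'(1)]]) (simp add: fun_eq_iff distrib_left)
  qed
  from orthonormal_basis_exists[OF this VF] obtain E where E: "finite E" "E \<subseteq> V" "card E = dim V"
    "\<And>e e'. e \<in> E \<Longrightarrow> e' \<in> E \<Longrightarrow> sph_inner e e' = (if e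
        = e' then 1 else 0)"
    "\<And>f. f \<in> V \<Longrightarrow> f = (\<lambda>x. \<Sum>e\<in>E. sph_inner f e * e x)"
    by blast
  have EF: "e \<in> forms (d + 2)" if "e \<in> E" for e using that E(2) VF by blast
  have Ec: "continuous_on UNIV e" if "e \<in> E" for e using EF[OF that] forms_continuous by blast
  define p where "p = (\<Sum>e\<in>E. sph_inner f e *\<^sub>R e)"
  have p: "p = (\<lambda>x. \<Sum>e\<in>E. sph_inner f e * e x)"
    by (simp add: p_def fun_eq_iff sum_fun_apply scaleR_fun_def)
  have "p \<in> V" unfolding p_def
    using E(2) \<open>subspace V\<close> by (intro subspace_sum subspace_scale) auto
  then obtain q where q: "q \<in> forms d" "p = (\<lambda>x. (norm x)\<^sup>2 * q x)" by (auto simp: V_def)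
  have pF: "p \<in> forms (d + 2)" using \<open>p \<in> V\<close> VF by blast
  define h where "h x = f x + (- 1) * p x" for x
  have hF: "h \<in> forms (d + 2)"
    unfolding h_def[abs_def] by (intro forms_add forms_cmult f pF)
  note cont = forms_continuous[OF f] forms_continuous[OF pF] forms_continuous[OF hF]
  have hE: "sph_inner h e = 0" if e: "e \<in> E" for e
  proof -
    have "sph_inner p e = (\<Sum>e'\<in>E. sph_inner (\<lambda>x. sph_inner f e' * e' x) e)"
      unfolding p by (rule sph_inner_sum_left) (use e Ec in \<open>auto intro!: continuous_intros\<close>)
    also have "\<dots> = (\<Sum>e'\<in>E. if e' = e then sph_inner f e' else 0)"
      using e E(4) by (intro sum.cong) (auto simp: sph_inner_cmult_left)
    also have "\<dots> = sph_inner f e" using e E(1) by simp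
    finally have "sph_inner p e = sph_inner f e" .
    moreover have "sph_inner h e = sph_inner f e + sph_inner (\<lambda>x. (- 1) * p x) e"
      unfolding h_def[abs_def] by (intro sph_inner_add_left continuous_intros cont Ec e)
    ultimately show ?thesis unfolding sph_inner_cmult_left by simp
  qed
  have "sph_inner h r = 0" if r: "r \<in> forms d" for r
  proof -
    define v where "v x = (norm x)\<^sup>2 * r x" for x
    have vV: "v \<in> V" unfolding V_def v_def[abs_def] using r by blast
    have "sph_inner h r = sph_inner h v" by (rule sph_inner_cong) (simp add: v_def)
    also have "\<dots> = sph_inner h (\<lambda>x. \<Sum>e\<in>E. sph_inner v e * e x)"
      using E(5)[OF vV] by simp
    also have "\<dots> = (\<Sum>e\<in>E. sph_inner h (\<lambda>x. sph_inner v e * e x))"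
      by (intro sph_inner_sum_right continuous_on_mult continuous_on_const Ec cont)
    also have "\<dots> = 0" by (intro sum.neutral) (simp add: sph_inner_cmult_right hE)
    finally show ?thesis .
  qed
  then have "h \<in> harmonic_forms (d + 2)" by (rule harmonic_if_orthogonal[OF hF])
  then show ?thesis using that[of h q] q by (simp add: h_def fun_eq_iff)
qed

lemma harmonic_decomposition:
  fixes f :: "real ^ 'n \<Rightarrow> real"
  assumes "f \<in> forms (2 * k)"
  shows "\<exists>F. (\<forall>j\<le>k. F j \<in> harmonic_forms (2 * j)) \<and> f
      = (\<lambda>x. \<Sum>j\<le>k. norm x ^ (2 * (k - j)) * F j x)"
  using assms
proof (induction k arbitrary: f)
  case 0
  then have "f \<in> forms 0" by simp
  then have "f \<in> harmonic_forms 0"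
    by (simp add: harmonic_forms_def laplacian_forms[of _ 0] pd_degree_0)
  then show ?case by (intro exI[of _ "\<lambda>_. f"]) simp
next
  case (Suc k)
  then have "f \<in> forms (2 * k + 2)" by simp
  then obtain h q where hq: "h \<in> harmonic_forms (2 * k + 2)" "q \<in> forms (2 * k)"
    "f = (\<lambda>x. h x + (norm x)\<^sup>2 * q x)" by (rule harmonic_decomposition_step)
  from Suc.IH[OF hq(2)] obtain F where F: "\<And>j. j \<le> k
      \<Longrightarrow> F j \<in> harmonic_forms (2 * j)"
    "q = (\<lambda>x. \<Sum>j\<le>k. norm x ^ (2 * (k - j)) * F j x)" by blast
  show ?case
  proof (intro exI[of _ "F(Suc k := h)"] conjI allI impI)
    fix j assume "j \<le> Suc k"
    then show "(F(Suc k := h)) j \<in> harmonic_forms (2 * j)"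
      using F(1) hq(1) by (cases "j = Suc k") auto
  next
    have "norm x ^ (2 * (Suc k - j)) = (norm x)\<^sup>2 * norm x ^ (2 * (k - j))" if "j \<le> k" for j
        and x :: "real ^ 'n"
    proof -
      have "2 * (Suc k - j) = 2 + 2 * (k - j)" using that by simp
      then show ?thesis by (simp only: power_add)
    qed
    then show "f = (\<lambda>x. \<Sum>j\<le>Suc k. norm x ^ (2 * (Suc k - j)) * (F(Suc k := h)) j x)"
      unfolding hq(3) F(2) by (simp add: fun_eq_iff sum_distrib_left mult.assoc)
  qed
qed

subsection \<open>Zonal harmonics\<close>

lemma pd_inner: "pd i (\<lambda>x. inner x y) = (\<lambda>_. y $ i)"
proof -
  have "pd i (\<lambda>x. \<Sum>j\<in>UNIV. y $ j * x $ j) = (\<lambda>x. \<Sum>j\<in>UNIV. pd i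
      (\<lambda>x. y $ j * x $ j) x)"
    by (rule pd_sum[OF forms_cmult[OF forms_coord]])
  also have "\<dots> = (\<lambda>x. \<Sum>j\<in>UNIV. (if i = j then y $ j else 0))"
    unfolding pd_cmult[OF forms_coord] pd_coord by (rule ext, rule sum.cong) auto
  also have "\<dots> = (\<lambda>_. y $ i)" by simp
  finally show ?thesis by (simp add: inner_vec_def mult.commute)
qed

lemma norm_sq_eq_sum: "(norm x)\<^sup>2 = (\<Sum>j\<in>UNIV. x $ j * x $ j)" for x :: "real ^ 'n"
  by (simp add: norm_vec_def L2_set_def sum_nonneg power2_eq_square)

lemma pd_norm_sq: "pd i (\<lambda>x. (norm x)\<^sup>2) = (\<lambda>x. 2 * x $ i)"
proof -
  have f: "(\<lambda>x. x $ j * x $ j) \<in> forms 2" for j :: 'a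
    using forms_coord_mult[OF forms_coord, of j j] by (simp add: numeral_2_eq_2)
  have "pd i (\<lambda>x. \<Sum>j\<in>UNIV. x $ j * x $ j) = (\<lambda>x. \<Sum>j\<in>UNIV. pd i
      (\<lambda>x. x $ j * x $ j) x)"
    by (rule pd_sum[OF f])
  also have "\<dots> = (\<lambda>x. \<Sum>j\<in>UNIV. (if i = j then 2 * x $ j else 0))"
    unfolding pd_mult[OF forms_coord forms_coord] pd_coord
    by (rule ext, rule sum.cong) auto
  also have "\<dots> = (\<lambda>x. 2 * x $ i)" by simp
  finally show ?thesis by (simp add: norm_sq_eq_sum)
qed

lemma laplacian_mult:
  assumes f: "f \<in> forms a" and g: "g \<in> forms b"
  shows "laplacian (\<lambda>x. f x * g x) x
    = laplacian f x * g x + 2 * (\<Sum>i\<in>UNIV. pd i f x * pd i g x) + f x * laplacian g x"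
proof -
  have "pd i (pd i (\<lambda>x. f x * g x)) x
      = pd i (pd i f) x * g x + 2 * (pd i f x * pd i g x) + f x * pd i (pd i g) x" for i
    unfolding pd_mult[OF f g]
    by (simp add: pd_add[OF forms_mult[OF forms_pd[OF f] g] forms_mult[OF f forms_pd[OF g]]]
        pd_mult[OF forms_pd[OF f] g] pd_mult[OF f forms_pd[OF g]])
  then show ?thesis
    unfolding laplacian_forms[OF forms_mult[OF f g]] laplacian_forms[OF f] laplacian_forms[OF g]
    by (simp add: sum.distrib sum_distrib_left sum_distrib_right)
qed

lemma laplacian_inner_mult:
  assumes "f \<in> forms d"
  shows "laplacian (\<lambda>x. inner x y * f x) x = 2 * (\<Sum>i\<in>UNIV. y $ i * pd i f x)
      + inner x y * laplacian f x"
  unfolding laplacian_mult[OF forms_inner assms]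
  by (simp add: laplacian_forms[OF forms_inner] pd_inner)

lemma laplacian_norm_sq_mult:
  fixes f :: "real ^ 'n \<Rightarrow> real"
  assumes "f \<in> forms d"
  shows "laplacian (\<lambda>x. (norm x)\<^sup>2 * f x) x
    = (2 * real CARD('n) + 4 * real d) * f x + (norm x)\<^sup>2 * laplacian f x"
proof -
  have "laplacian (\<lambda>x :: real ^ 'n. (norm x)\<^sup>2) x = 2 * real CARD('n)"
    by (simp add: laplacian_forms[OF forms_norm_sq] pd_norm_sq pd_cmult[OF forms_coord] pd_coord)
  moreover have "(\<Sum>i\<in>UNIV. pd i (\<lambda>x :: real ^ 'n. (norm x)\<^sup>2) x * pd i f x)
      = 2 * (real d * f x)"
    unfolding pd_norm_sq euler_identity[OF assms, symmetric] by (simp add: sum_distrib_left mult.assoc)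
  ultimately show ?thesis
    unfolding laplacian_mult[OF forms_norm_sq assms] by (simp add: algebra_simps)
qed

text \<open>The Gegenbauer recurrence, homogenised by powers of \<open>norm x\<close>. Without
  division by \<open>norm x\<close> both membership in \<open>forms j\<close> and the Laplacian can
  be read off term by term.\<close>

fun zonal_form :: "real \<Rightarrow> real ^ 'n \<Rightarrow> nat \<Rightarrow> real ^ 'n \<Rightarrow>
    real" where
  "zonal_form \<alpha> y 0 = (\<lambda>x. 1)"
| "zonal_form \<alpha> y (Suc 0) = (\<lambda>x. 2 * \<alpha> * inner x y)"
| "zonal_form \<alpha> y (Suc (Suc j)) = (\<lambda>x. 1 / real (j + 2) *
     (2 * (real j + 1 + \<alpha>) * (inner x y * zonal_form \<alpha> y (Suc j) x)
      - (real j + 2 * \<alpha>) * ((norm x)\<^sup>2 * zonal_form \<alpha> y j x)))"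

lemma forms_inner_mult: "f \<in> forms d \<Longrightarrow> (\<lambda>x. inner x y * f x) \<in> forms (Suc d)"
  using forms_mult[OF forms_inner, of f d y] by simp

lemma forms_norm_sq_mult: "f \<in> forms d \<Longrightarrow> (\<lambda>x. (norm x)\<^sup>2 * f x) \<in>
    forms (Suc (Suc d))"
  using forms_mult[OF forms_norm_sq, of f d] by simp

lemma zonal_form_forms: "zonal_form \<alpha> y j \<in> forms j"
proof (induction j rule: induct_nat_012)
  case 0 show ?case by (simp add: forms_const)
next
  case 1 show ?case using forms_cmult[OF forms_inner] by simp
next
  case (ge2 j)
  then show ?case unfolding zonal_form.simps
    by (intro forms_cmult forms_diff forms_inner_mult forms_norm_sq_mult)
qed

lemma zonal_form_eq_gegenbauer:
  "zonal_form \<alpha> y j x = norm x ^ j * poly (gegenbauer \<alpha> j) (inner (x /\<^sub>R norm x) y)"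
proof (cases "x = 0")
  case True
  then show ?thesis using forms_at_0[OF zonal_form_forms, of j \<alpha> y] by (cases "j
      = 0") (auto simp: power_0_left)
next
  case False
  define t where "t = inner (x /\<^sub>R norm x) y"
  have t: "inner x y = norm x * t" using False by (simp add: t_def)
  show ?thesis unfolding t_def[symmetric]
  proof (induction j rule: induct_nat_012)
    case 0 show ?case by simp
  next
    case 1 show ?case by (simp add: t)
  next
    case (ge2 j)
    then show ?case by (simp add: t algebra_simps power2_eq_square)
  qed
qed

text \<open>The derivative in the direction of the pole \<open>y\<close> is the cross term in the
  Laplacian of \<open>inner x y\<close> times a zonal form. The recurrence involves two earlier
  terms, so the induction is over all smaller indices.\<close>

lemma zonal_form_pd_dir:
  fixes y :: "real ^ 'n"
  assumes y: "norm y = 1"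
  shows "(\<Sum>i\<in>UNIV. y $ i * pd i (zonal_form \<alpha> y (Suc j)) x) = (real j
      + 2 * \<alpha>) * zonal_form \<alpha> y j x"
proof -
  define L where "L f x = (\<Sum>i\<in>UNIV. y $ i * pd i f x)" for f x
  have yy: "(\<Sum>i\<in>UNIV. y $ i * y $ i) = 1" using y norm_sq_eq_sum[of y] by simp
  have L_inner: "L (\<lambda>x. inner x y * f x) x = f x + inner x y * L f x" if "f \<in> forms d" for f d x
  proof -
    have "L (\<lambda>x. inner x y * f x) x = (\<Sum>i\<in>UNIV. y $ i * y $ i) * f x + inner x y * L f x"
      unfolding L_def pd_mult[OF forms_inner that] pd_inner
      by (simp add: distrib_left sum.distrib sum_distrib_left sum_distrib_right mult_ac)
    then show ?thesis by (simp add: yy)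
  qed
  have L_norm: "L (\<lambda>x. (norm x)\<^sup>2 * f x) x = 2 * inner x y * f x + (norm x)\<^sup>2 * L f x"
      if "f \<in> forms d" for f d x
    unfolding L_def pd_mult[OF forms_norm_sq that] pd_norm_sq inner_vec_def
    by (simp add: distrib_left sum.distrib sum_distrib_left sum_distrib_right mult_ac)
  have L_cmult: "L (\<lambda>x. c * f x) x = c * L f x" if "f \<in> forms d" for c f d x
    by (simp add: L_def pd_cmult[OF that] sum_distrib_left mult_ac)
  have L_diff: "L (\<lambda>x. f x - g x) x = L f x - L g x" if "f \<in> forms d" "g \<in> forms d" for f g d x
    by (simp add: L_def pd_diff[OF that] right_diff_distrib sum_subtractf)
  have "L (zonal_form \<alpha> y (Suc j)) x = (real j + 2 * \<alpha>) * zonal_form \<alpha> y j x" for x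
  proof (induction j arbitrary: x rule: less_induct)
    case (less j)
    note z = zonal_form_forms[of \<alpha> y]
    show ?case
    proof (cases j)
      case 0
      have "L (\<lambda>x. 2 * \<alpha> * (inner x y * 1)) x = 2 * \<alpha> * (1
          + inner x y * L (\<lambda>_. 1) x)"
        by (simp only: L_cmult[OF forms_inner_mult[OF forms_const]] L_inner[OF forms_const])
      then show ?thesis using 0 by (simp add: L_def)
    next
      case (Suc m)
      have IH1: "L (zonal_form \<alpha> y (Suc m)) x = (real m + 2 * \<alpha>) * zonal_form \<alpha> y m x"
        using less[of m] Suc by simp
      note A = forms_inner_mult[OF z[of "Suc m"], of y] and B = forms_norm_sq_mult[OF z[of m]]
      have eq: "L (zonal_form \<alpha> y (Suc (Suc m))) x = 1 / real (m + 2) *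
          (2 * (real m + 1 + \<alpha>) * (zonal_form \<alpha> y (Suc m) x
              + inner x y * L (zonal_form \<alpha> y (Suc m)) x)
          - (real m + 2 * \<alpha>) * (2 * inner x y * zonal_form \<alpha> y m x
              + (norm x)\<^sup>2 * L (zonal_form \<alpha> y m) x))"
        unfolding zonal_form.simps(3)
        by (simp only: L_cmult[OF forms_diff[OF forms_cmult[OF A] forms_cmult[OF B]]]
            L_diff[OF forms_cmult[OF A] forms_cmult[OF B]] L_cmult[OF A] L_cmult[OF B]
            L_inner[OF z] L_norm[OF z])
      \<comment> \<open>For \<open>m > 0\<close> this is the recurrence one index lower, solved for
        its norm term, which eliminates the form of index \<open>m - 1\<close>; for
        \<open>m = 0\<close> both sides vanish.\<close>
      have rec: "(real m + 2 * \<alpha>) * ((norm x)\<^sup>2 * L (zonal_form \<alpha> y m) x)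
        = (real m + 2 * \<alpha>) * (2 * (real m + \<alpha>) * (inner x y * zonal_form \<alpha> y m x)
            - real (m + 1) * zonal_form \<alpha> y (Suc m) x)"
      proof (cases m)
        case 0
        then show ?thesis by (simp add: L_def)
      next
        case (Suc l)
        have "L (zonal_form \<alpha> y (Suc l)) x = (real l + 2 * \<alpha>) * zonal_form \<alpha> y l x"
          using less[of l] Suc \<open>j = Suc m\<close> by simp
        then show ?thesis unfolding Suc zonal_form.simps(3)[of \<alpha> y l] by (simp add: field_simps)
      qed
      have "L (zonal_form \<alpha> y (Suc (Suc m))) x = 1 / real (m + 2) *
         (real (m + 2) * ((real (Suc m) + 2 * \<alpha>) * zonal_form \<alpha> y (Suc m) x))"
        unfolding eq IH1 distrib_left rec
        by (rule arg_cong[of _ _ "\<lambda>u. 1 / real (m + 2) * u"]) (simp add: algebra_simps)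
      also have "\<dots> = (real (Suc m) + 2 * \<alpha>) * zonal_form \<alpha> y (Suc m) x" by simp
      finally show ?thesis using Suc by simp
    qed
  qed
  then show ?thesis by (simp add: L_def)
qed

text \<open>By the induction hypotheses only multiples of \<open>zonal_form \<alpha> y j\<close>
  survive in the Laplacian: one from the cross term of \<open>inner x y\<close>, one from the factor
  \<open>(norm x)\<^sup>2\<close>. They cancel because
  \<open>2 * CARD('n) + 4 * j = 4 * (j + 1 + \<alpha>)\<close>, which pins down the value of
  \<open>\<alpha>\<close>.\<close>

lemma zonal_form_harmonic:
  fixes y :: "real ^ 'n"
  assumes y: "norm y = 1" and \<alpha>: "\<alpha> = (real CARD('n) - 2) / 2"
  shows "zonal_form \<alpha> y j \<in> harmonic_forms j"
proof (induction j rule: induct_nat_012)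
  case 0
  show ?case by (simp add: harmonic_forms_def laplacian_forms[OF forms_const] forms_const)
next
  case 1
  show ?case
    using forms_cmult[OF forms_inner, of "2 * \<alpha>" y]
    by (simp add: harmonic_forms_def laplacian_cmult[OF forms_inner] laplacian_forms[OF forms_inner] pd_inner)
next
  case (ge2 j)
  note z = zonal_form_forms[of \<alpha> y]
  note A = forms_inner_mult[OF z[of "Suc j"], of y] and B = forms_norm_sq_mult[OF z[of j]]
  have h: "laplacian (zonal_form \<alpha> y (Suc j)) x = 0" "laplacian (zonal_form \<alpha> y j) x = 0" for x
    using ge2 by (auto simp: harmonic_forms_def)
  have "laplacian (zonal_form \<alpha> y (Suc (Suc j))) x = 1 / real (j + 2) *
      (2 * (real j + 1 + \<alpha>) * (2 * ((real j + 2 * \<alpha>) * zonal_form \<alpha> y j x))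
       - (real j + 2 * \<alpha>) * ((2 * real CARD('n) + 4 * real j) * zonal_form \<alpha> y j x))" for x
    unfolding zonal_form.simps(3)
    by (simp only: laplacian_cmult[OF forms_diff[OF forms_cmult[OF A] forms_cmult[OF B]]]
        laplacian_diff[OF forms_cmult[OF A] forms_cmult[OF B]] laplacian_cmult[OF A] laplacian_cmult[OF B]
        laplacian_inner_mult[OF z] laplacian_norm_sq_mult[OF z] zonal_form_pd_dir[OF y] h
        mult_zero_right add_0_right)
  moreover have "2 * real CARD('n) + 4 * real j = 4 * (real j + 1 + \<alpha>)" by
      (simp add: \<alpha> field_simps)
  ultimately have "laplacian (zonal_form \<alpha> y (Suc (Suc j))) x = 0" for x by (simp only:) simp
  then show ?case using z[of "Suc (Suc j)"] by (simp add: harmonic_forms_def)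
qed

text \<open>Lifts the reproducing property from degree \<open>j\<close> to \<open>j + 1\<close>.
  Integration by parts leaves the pairing of \<open>z\<close> with \<open>pd i f\<close>, since
  \<open>pd i z\<close> has too small a degree to meet \<open>f\<close>; then \<open>rep\<close>
  gives \<open>\<gamma> * pd i f y\<close>, and Euler's identity at \<open>y\<close> sums these
  values.\<close>

lemma sph_inner_inner_mult_zonal:
  fixes y :: "real ^ 'n"
  assumes n: "CARD('n) \<ge> 2" and f: "f \<in> harmonic_forms (Suc j)" and y: "norm y = 1"
    and z: "z \<in> forms j" and rep: "\<And>g. g \<in> harmonic_forms j \<Longrightarrow> sph_inner z g
        = \<gamma> * g y"
  shows "sph_inner (\<lambda>x. inner x y * z x) f = \<gamma> * real (Suc j) / (real CARD('n)
      + 2 * real j) * f y"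
proof -
  note f' = harmonic_formsD[OF f]
  have "sph_inner (\<lambda>x. inner x y * z x) f = sph_inner (\<lambda>x. \<Sum>i\<in>UNIV. y $ i * (x $ i
      * z x)) f"
    by (rule sph_inner_cong) (simp add: inner_vec_def sum_distrib_left sum_distrib_right mult_ac)
  also have "\<dots> = (\<Sum>i\<in>UNIV. sph_inner (\<lambda>x. y $ i * (x $ i * z x)) f)"
    by (rule sph_inner_sum_left) (intro continuous_intros forms_continuous[OF z] forms_continuous[OF f'])+
  finally have 1: "sph_inner (\<lambda>x. inner x y * z x) f
      = (\<Sum>i\<in>UNIV. y $ i * sph_inner (\<lambda>x. x $ i * z x) f)"
    by (simp only: sph_inner_cmult_left)
  have "(real CARD('n) + 2 * real j) * sph_inner (\<lambda>x. x $ i * z x) f = \<gamma> * pd i f y" for i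
  proof -
    have "sph_inner (pd i z) f = 0"
      by (rule harmonic_orthogonal[OF n forms_pd[OF z] f]) simp
    moreover have "sph_inner z (pd i f) = \<gamma> * pd i f y"
      using rep harmonic_pd[OF f] by simp
    ultimately show ?thesis using sph_inner_by_parts[OF z f', of i] by (simp add: algebra_simps)
  qed
  then have "(real CARD('n) + 2 * real j) * sph_inner (\<lambda>x. inner x y * z x) f
      = (\<Sum>i\<in>UNIV. y $ i * (\<gamma> * pd i f y))"
    unfolding 1 by (simp add: sum_distrib_left mult.left_commute)
  also have "\<dots> = \<gamma> * (real (Suc j) * f y)"
    unfolding euler_identity[OF f', symmetric] by (simp add: sum_distrib_left mult_ac)
  finally have "(real CARD('n) + 2 * real j) * sph_inner (\<lambda>x. inner x y * z x) f
      = \<gamma> * (real (Suc j) * f y)" .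
  moreover have "real CARD('n) + 2 * real j > 0" using n by linarith
  ultimately show ?thesis by (simp add: field_simps)
qed

text \<open>On the sphere the norm term of the recurrence is a form of lower degree, hence
  orthogonal to \<open>f\<close>, so each step only multiplies the constant by a positive factor;
  here \<open>\<alpha> > 0\<close> enters. A single \<open>\<gamma>\<close> serves all poles, which
  later permits integrating over \<open>y\<close>.\<close>

lemma zonal_form_reproducing_upto_const:
  assumes n: "CARD('n) \<ge> 3" and \<alpha>: "\<alpha> = (real CARD('n) - 2) / 2"
  shows "\<exists>\<gamma>>0. \<forall>y :: real ^ 'n. norm y = 1 \<longrightarrow>
    (\<forall>f\<in>harmonic_forms j. sph_inner (zonal_form \<alpha> y j) f = \<gamma> * f y)"
proof -
  have n2: "CARD('n) \<ge> 2" using n by simp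
  have \<alpha>0: "\<alpha> > 0" using n by (simp add: \<alpha>)
  define P where "P j \<gamma> \<longleftrightarrow> \<gamma> > 0 \<and> (\<forall>y :: real ^ 'n. norm y
      = 1 \<longrightarrow>
    (\<forall>f\<in>harmonic_forms j. sph_inner (zonal_form \<alpha> y j) f = \<gamma> * f y))" for j \<gamma>
  have P_rep: "P j \<gamma> \<Longrightarrow> norm y = 1 \<Longrightarrow> f \<in> harmonic_forms j
      \<Longrightarrow> sph_inner (zonal_form \<alpha> y j) f = \<gamma> * f y"
    for j \<gamma> f and y :: "real ^ 'n" by (simp add: P_def)
  have P0: "P 0 (measure (area :: (real ^ 'n) measure) (sphere 0 1))"
    unfolding P_def
  proof (intro conjI allI ballI impI)
    fix y :: "real ^ 'n" and f :: "real ^ 'n \<Rightarrow> real" assume "f \<in> harmonic_forms 0"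
    then have "f x = f y" for x
      using forms_degree_0[OF harmonic_formsD, of f x] forms_degree_0[OF harmonic_formsD, of f y] by simp
    then have "sph_inner (zonal_form \<alpha> y 0) f = (LINT x :: real ^ 'n|area. f y)"
      unfolding sph_inner_def zonal_form.simps(1) mult_1
      by (intro Bochner_Integration.integral_cong refl)
    then show "sph_inner (zonal_form \<alpha> y 0) f = measure (area :: (real ^ 'n) measure) (sphere 0 1) * f y"
      using finite_measure_area by (simp add: space_area)
  qed (rule area_sphere_pos)
  have "\<exists>\<gamma>. P j \<gamma>"
  proof (induction j rule: induct_nat_012)
    case 0
    then show ?case using P0 by blast
  next
    case 1
    let ?m = "measure (area :: (real ^ 'n) measure) (sphere 0 1)"
    have "P (Suc 0) (2 * \<alpha> * (?m / real CARD('n)))"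
      unfolding P_def
    proof (intro conjI allI ballI impI)
      show "2 * \<alpha> * (?m / real CARD('n)) > 0" using \<alpha>0 area_sphere_pos[where 'n = 'n]
        by (intro mult_pos_pos divide_pos_pos) auto
      fix y :: "real ^ 'n" and f :: "real ^ 'n \<Rightarrow> real" assume y: "norm y = 1"
          and f: "f \<in> harmonic_forms (Suc 0)"
      have "sph_inner (\<lambda>x. inner x y * zonal_form \<alpha> y 0 x) f
          = ?m * real (Suc 0) / (real CARD('n) + 2 * real 0) * f y"
        by (rule sph_inner_inner_mult_zonal[OF n2 f y zonal_form_forms]) (rule P_rep[OF P0 y])
      then show "sph_inner (zonal_form \<alpha> y (Suc 0)) f = 2 * \<alpha> * (?m / real CARD('n)) * f y"
        using sph_inner_cmult_left[of "2 * \<alpha>" "\<lambda>x. inner x y" f] by simp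
    qed
    then show ?case by blast
  next
    case (ge2 j)
    then obtain \<gamma> where \<gamma>: "P (Suc j) \<gamma>" by blast
    let ?c = "1 / real (j + 2) * (2 * (real j + 1 + \<alpha>) * (\<gamma> * real (Suc (Suc j)) / (real
        CARD('n) + 2 * real (Suc j))))"
    have "P (Suc (Suc j)) ?c"
      unfolding P_def
    proof (intro conjI allI ballI impI)
      have "real CARD('n) + 2 * real (Suc j) > 0" using n by linarith
      then show "?c > 0" using \<gamma> \<alpha>0 by (intro mult_pos_pos divide_pos_pos) (auto simp: P_def)
      fix y :: "real ^ 'n" and f :: "real ^ 'n \<Rightarrow> real" assume y: "norm y = 1"
          and f: "f \<in> harmonic_forms (Suc (Suc j))"
      note z = zonal_form_forms[of \<alpha> y]
      note f' = harmonic_formsD[OF f]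
      have 1: "sph_inner (\<lambda>x. inner x y * zonal_form \<alpha> y (Suc j) x) f
        = \<gamma> * real (Suc (Suc j)) / (real CARD('n) + 2 * real (Suc j)) * f y"
        by (rule sph_inner_inner_mult_zonal[OF n2 f y zonal_form_forms]) (rule P_rep[OF \<gamma> y])
      have 2: "sph_inner (\<lambda>x. (norm x)\<^sup>2 * zonal_form \<alpha> y j x) f = 0"
      proof -
        have "sph_inner (\<lambda>x. (norm x)\<^sup>2 * zonal_form \<alpha> y j x) f
            = sph_inner (zonal_form \<alpha> y j) f"
          by (rule sph_inner_cong) simp
        then show ?thesis using harmonic_orthogonal[OF n2 z f] by simp
      qed
      have "zonal_form \<alpha> y (Suc (Suc j)) = (\<lambda>x. 1 / real (j + 2) *
         (2 * (real j + 1 + \<alpha>) * (inner x y * zonal_form \<alpha> y (Suc j) x)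
          + (- (real j + 2 * \<alpha>)) * ((norm x)\<^sup>2 * zonal_form \<alpha> y j x)))"
        by (simp only: zonal_form.simps(3) mult_minus_left add_uminus_conv_diff)
      then have "sph_inner (zonal_form \<alpha> y (Suc (Suc j))) f = 1 / real (j + 2) *
         sph_inner (\<lambda>x. (2 * (real j + 1 + \<alpha>) * (inner x y * zonal_form \<alpha> y (Suc j) x)
          + (- (real j + 2 * \<alpha>)) * ((norm x)\<^sup>2 * zonal_form \<alpha> y j x))) f"
        by (simp only: sph_inner_cmult_left)
      also have "\<dots> = 1 / real (j + 2) *
         (sph_inner (\<lambda>x. 2 * (real j + 1 + \<alpha>) * (inner x y * zonal_form \<alpha> y (Suc j) x)) f
          + sph_inner (\<lambda>x. (- (real j + 2 * \<alpha>)) * ((norm x)\<^sup>2 * zonal_form \<alpha> y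
              j x)) f)"
        by (subst sph_inner_add_left)
          (intro continuous_intros forms_continuous[OF z] forms_continuous[OF f'] refl)+
      also have "\<dots> = ?c * f y"
        unfolding sph_inner_cmult_left 1 2 by simp
      finally show "sph_inner (zonal_form \<alpha> y (Suc (Suc j))) f = ?c * f y" .
    qed
    then show ?case by blast
  qed
  then show ?thesis by (simp only: P_def)
qed

text \<open>At 1 the three-term recurrence collapses to the two-term relation \<open>rec\<close>,
  whose factors are positive.\<close>

lemma gegenbauer_at_1_pos:
  assumes "\<alpha> > 0"
  shows "poly (gegenbauer \<alpha> j) 1 > 0"
proof -
  have rec: "real (Suc j) * poly (gegenbauer \<alpha> (Suc j)) 1 = (real j
      + 2 * \<alpha>) * poly (gegenbauer \<alpha> j) 1" for j
  proof (induction j)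
    case 0 show ?case by simp
  next
    case (Suc j)
    have "real (Suc (Suc j)) * poly (gegenbauer \<alpha> (Suc (Suc j))) 1
      = 2 * (real j + 1 + \<alpha>) * poly (gegenbauer \<alpha> (Suc j)) 1 - (real j
          + 2 * \<alpha>) * poly (gegenbauer \<alpha> j) 1"
      by (simp add: field_simps)
    also have "\<dots> = (real (Suc j) + 2 * \<alpha>) * poly (gegenbauer \<alpha> (Suc j)) 1"
      unfolding Suc[symmetric] by (simp add: algebra_simps)
    finally show ?case .
  qed
  show ?thesis
  proof (induction j)
    case (Suc j)
    then have "real (Suc j) * poly (gegenbauer \<alpha> (Suc j)) 1 > 0"
      unfolding rec using assms by (intro mult_pos_pos) auto
    then show ?case by (simp add: zero_less_mult_iff)
  qed simp
qed

text \<open>Expanding the zonal form in an orthonormal basis \<open>E\<close> of the harmonic forms and integrating its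
  value on the diagonal over the sphere counts the elements of \<open>E\<close>.\<close>

lemma zonal_form_reproducing_const:
  assumes n: "CARD('n) \<ge> 3" and \<alpha>: "\<alpha> = (real CARD('n) - 2) / 2"
    and rep: "\<And>(y :: real ^ 'n) f. norm y = 1 \<Longrightarrow> f \<in> harmonic_forms j \<Longrightarrow>
       sph_inner (zonal_form \<alpha> y j) f = \<gamma> * f y"
  shows "measure (area :: (real ^ 'n) measure) (sphere 0 1) * poly (gegenbauer \<alpha> j) 1
    = \<gamma> * real (dim (harmonic_forms j :: (real ^ 'n \<Rightarrow> real) set))"
proof -
  let ?H = "harmonic_forms j :: (real ^ 'n \<Rightarrow> real) set"
  have "?H \<subseteq> forms j" using harmonic_formsD by blast
  from orthonormal_basis_exists[OF subspace_harmonic_forms this]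
  obtain E where E: "finite E" "E \<subseteq> ?H" "card E = dim ?H"
    "\<And>e e'. e \<in> E \<Longrightarrow> e' \<in> E \<Longrightarrow> sph_inner e e' = (if e
        = e' then 1 else 0)"
    "\<And>f. f \<in> ?H \<Longrightarrow> f = (\<lambda>x. \<Sum>e\<in>E. sph_inner f e * e x)" by blast
  have diag: "poly (gegenbauer \<alpha> j) 1 = (\<Sum>e\<in>E. \<gamma> * (e y * e y))" if y: "norm y = 1" for y
  proof -
    have "poly (gegenbauer \<alpha> j) 1 = zonal_form \<alpha> y j y"
      using y by (simp add: zonal_form_eq_gegenbauer dot_square_norm)
    also have "\<dots> = (\<Sum>e\<in>E. sph_inner (zonal_form \<alpha> y j) e * e y)"
      using E(5)[OF zonal_form_harmonic[OF y \<alpha>]] by metis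
    also have "\<dots> = (\<Sum>e\<in>E. \<gamma> * (e y * e y))"
      using E(2) rep[OF y] by (intro sum.cong) auto
    finally show ?thesis .
  qed
  have "measure (area :: (real ^ 'n) measure) (sphere 0 1) * poly (gegenbauer \<alpha> j) 1
      = (LINT y :: real ^ 'n|area. poly (gegenbauer \<alpha> j) 1)"
    using finite_measure_area by (simp add: space_area)
  also have "\<dots> = (LINT y|area. (\<Sum>e\<in>E. \<gamma> * (e y * e y)))"
    by (rule Bochner_Integration.integral_cong) (auto simp: space_area diag[symmetric])
  also have "\<dots> = (\<Sum>e\<in>E. (LINT y|area. \<gamma> * (e y * e y)))"
  proof (rule Bochner_Integration.integral_sum)
    fix e assume "e \<in> E"
    then have "e \<in> forms j" using E(2) harmonic_formsD by blast
    then show "integrable area (\<lambda>y. \<gamma> * (e y * e y))"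
      by (intro area_integrable continuous_intros forms_continuous)
  qed
  also have "\<dots> = (\<Sum>e\<in>E. \<gamma> * sph_inner e e)" by (simp add: sph_inner_def)
  also have "\<dots> = (\<Sum>e\<in>E. \<gamma>)" using E(4) by simp
  finally show ?thesis using E(3) by simp
qed

text \<open>In the identity for the reproducing constant, area times the value at 1 is positive, so
  the dimension cannot be 0. This makes \<open>gegenbauer_norm\<close> nonzero and gives every term
  of the threshold weight at least 1.\<close>

lemma dim_harmonic_forms_pos:
  assumes n: "CARD('n) \<ge> 3"
  shows "dim (harmonic_forms j :: (real ^ 'n \<Rightarrow> real) set) > 0"
proof -
  define \<alpha> where "\<alpha> = (real CARD('n) - 2) / 2"
  have "\<alpha> > 0" using n by (simp add: \<alpha>_def)
  obtain \<gamma> where \<gamma>: "\<gamma> > 0" "\<forall>y :: real ^ 'n. norm y = 1 \<longrightarrow>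
    (\<forall>f\<in>harmonic_forms j. sph_inner (zonal_form \<alpha> y j) f = \<gamma> * f y)"
    using zonal_form_reproducing_upto_const[OF n \<alpha>_def, of j] by blast
  have "measure (area :: (real ^ 'n) measure) (sphere 0 1) * poly (gegenbauer \<alpha> j) 1
      = \<gamma> * real (dim (harmonic_forms j :: (real ^ 'n \<Rightarrow> real) set))"
    using zonal_form_reproducing_const[OF n \<alpha>_def] \<gamma> by blast
  moreover have "measure (area :: (real ^ 'n) measure) (sphere 0 1) * poly (gegenbauer \<alpha> j) 1 > 0"
    using area_sphere_pos gegenbauer_at_1_pos[OF \<open>\<alpha> > 0\<close>] by (rule mult_pos_pos)
  ultimately show ?thesis by (metis gr0I mult_zero_right of_nat_0 less_irrefl)
qed

text \<open>The normalising factor in \<open>gegenbauer_norm\<close> is exactly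
  \<open>1 / \<gamma>\<close>, by the identity obtained from integrating over the diagonal.\<close>

lemma zonal_reproducing:
  fixes y :: "real ^ 'n"
  assumes n: "CARD('n) \<ge> 3" and y: "norm y = 1"
  shows "zonal j y \<in> harmonic_forms j"
    and "f \<in> harmonic_forms j \<Longrightarrow> sph_inner (zonal j y) f = f y"
proof -
  define \<alpha> where "\<alpha> = (real CARD('n) - 2) / 2"
  have "\<alpha> > 0" using n by (simp add: \<alpha>_def)
  obtain \<gamma> where \<gamma>: "\<gamma> > 0" "\<forall>y :: real ^ 'n. norm y = 1 \<longrightarrow>
    (\<forall>f\<in>harmonic_forms j. sph_inner (zonal_form \<alpha> y j) f = \<gamma> * f y)"
    using zonal_form_reproducing_upto_const[OF n \<alpha>_def, of j] by blast
  define c where "c = measure (area :: (real ^ 'n) measure) (sphere 0 1) * poly (gegenbauer \<alpha> j) 1"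
  have c: "c = \<gamma> * real (dim (harmonic_forms j :: (real ^ 'n \<Rightarrow> real) set))"
    unfolding c_def using zonal_form_reproducing_const[OF n \<alpha>_def] \<gamma> by blast
  have "c > 0" unfolding c_def
    using area_sphere_pos gegenbauer_at_1_pos[OF \<open>\<alpha> > 0\<close>] by (rule mult_pos_pos)
  have "zonal j y x = (1 / \<gamma>) * zonal_form \<alpha> y j x" for x
  proof -
    have "zonal j y x = real (dim (harmonic_forms j :: (real ^ 'n \<Rightarrow> real) set)) / c *
        zonal_form \<alpha> y j x"
      by (simp add: zonal_def gegenbauer_norm_def Let_def zonal_form_eq_gegenbauer c_def \<alpha>_def)
    moreover have "real (dim (harmonic_forms j :: (real ^ 'n \<Rightarrow> real) set)) \<noteq> 0"
      using \<open>c > 0\<close> unfolding c by (metis mult_zero_right less_irrefl)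
    ultimately show ?thesis unfolding c by simp
  qed
  then have z: "zonal j y = (\<lambda>x. (1 / \<gamma>) * zonal_form \<alpha> y j x)" by blast
  have "(1 / \<gamma>) *\<^sub>R zonal_form \<alpha> y j \<in> harmonic_forms j"
    by (intro subspace_scale subspace_harmonic_forms zonal_form_harmonic y \<alpha>_def)
  then show "zonal j y \<in> harmonic_forms j" by (simp add: z scaleR_fun_def)
  show "sph_inner (zonal j y) f = f y" if "f \<in> harmonic_forms j"
    unfolding z sph_inner_cmult_left using \<gamma> y that by simp
qed

subsection \<open>Gegenbauer expansions and the operators\<close>

lemma triangular_basis_expansion:
  fixes p :: "nat \<Rightarrow> 'a::field poly"
  assumes deg: "\<And>j. degree (p j) = j" and nz: "\<And>j. p j \<noteq> 0" and "degree q \<le> m"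
  shows "\<exists>l. (\<forall>j>m. l j = 0) \<and> q = (\<Sum>j\<le>m. smult (l j) (p j))"
  using assms(3)
proof (induction m arbitrary: q)
  case 0
  obtain a b where a: "q = [:a:]" and b: "p 0 = [:b:]"
    using 0 deg[of 0] by (metis degree_eq_zeroE le_zero_eq)
  have "b \<noteq> 0" using nz[of 0] b by simp
  then show ?case by (intro exI[of _ "\<lambda>j. if j = 0 then a / b else 0"]) (simp add: a b)
next
  case (Suc m)
  define c where "c = coeff q (Suc m) / coeff (p (Suc m)) (Suc m)"
  have lc: "coeff (p (Suc m)) (Suc m) \<noteq> 0"
    using deg[of "Suc m"] nz[of "Suc m"] leading_coeff_neq_0[of "p (Suc m)"] by simp
  define r where "r = q - smult c (p (Suc m))"
  have "degree r \<le> Suc m"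
    unfolding r_def using Suc.prems deg[of "Suc m"]
    by (intro degree_diff_le) (auto intro: order_trans[OF degree_smult_le])
  moreover have "coeff r (Suc m) = 0" using lc by (simp add: r_def c_def)
  ultimately have "degree r \<le> m"
    by (metis eq_zero_or_degree_less le_less less_Suc_eq_le degree_0 zero_le)
  from Suc.IH[OF this] obtain l where l: "\<forall>j>m. l j = 0" "r = (\<Sum>j\<le>m. smult (l j) (p j))"
      by blast
  have "q = r + smult c (p (Suc m))" by (simp add: r_def)
  then show ?case
    using l by (intro exI[of _ "l(Suc m := c)"]) simp
qed

lemma triangular_basis_independent:
  fixes p :: "nat \<Rightarrow> 'a::field poly"
  assumes deg: "\<And>j. degree (p j) = j" and nz: "\<And>j. p j \<noteq> 0"
    and "(\<Sum>j\<le>m. smult (l j) (p j)) = 0" "j \<le> m"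
  shows "l j = 0"
  using assms(3,4)
proof (induction m)
  case 0
  then show ?case using nz[of 0] by simp
next
  case (Suc m)
  have lc: "coeff (p (Suc m)) (Suc m) \<noteq> 0"
    using deg[of "Suc m"] nz[of "Suc m"] leading_coeff_neq_0[of "p (Suc m)"] by simp
  have "coeff (\<Sum>j\<le>m. smult (l j) (p j)) (Suc m) = 0"
    unfolding coeff_sum by (intro sum.neutral) (auto simp: deg coeff_eq_0)
  then have "l (Suc m) * coeff (p (Suc m)) (Suc m) = 0"
    using arg_cong[OF Suc.prems(1), of "\<lambda>q. coeff q (Suc m)"] by simp
  then have 0: "l (Suc m) = 0" using lc by simp
  then show ?case using Suc by (cases "j = Suc m") auto
qed

lemma gegenbauer_degree_coeff:
  assumes "\<alpha> > 0"
  shows "degree (gegenbauer \<alpha> j) \<le> j \<and> coeff (gegenbauer \<alpha> j) j > 0"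
proof (induction j rule: induct_nat_012)
  case (ge2 j)
  let ?a = "2 * (real (j + 2) + \<alpha> - 1)"
  have "degree ([:0, ?a:] * gegenbauer \<alpha> (Suc j)) \<le> Suc (Suc j)"
    using degree_mult_le[of "[:0, ?a:]" "gegenbauer \<alpha> (Suc j)"] ge2 by auto
  moreover have "degree (smult (real (j + 2) + 2 * \<alpha> - 2) (gegenbauer \<alpha> j)) \<le> Suc (Suc j)"
    using degree_smult_le[of _ "gegenbauer \<alpha> j"] ge2 by (meson le_SucI le_trans)
  ultimately have "degree (gegenbauer \<alpha> (Suc (Suc j))) \<le> Suc (Suc j)"
    unfolding gegenbauer.simps(3) by (meson degree_diff_le degree_smult_le le_trans)
  moreover have "coeff (gegenbauer \<alpha> j) (Suc (Suc j)) = 0"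
    using ge2 by (intro coeff_eq_0) auto
  then have "coeff (gegenbauer \<alpha> (Suc (Suc j))) (Suc (Suc j)) = 1 / real (j
      + 2) * (?a * coeff (gegenbauer \<alpha> (Suc j)) (Suc j))"
    unfolding gegenbauer.simps(3) by simp
  moreover have "\<dots> > 0" using ge2 assms by (intro mult_pos_pos) auto
  ultimately show ?case by (simp only: conj_absorb)
qed (use assms in auto)

lemma gegenbauer_norm_degree:
  assumes n: "CARD('n::finite) \<ge> 3"
  shows "degree (gegenbauer_norm TYPE('n) j) = j" "gegenbauer_norm TYPE('n) j \<noteq> 0"
proof -
  define \<alpha> where "\<alpha> = (real CARD('n) - 2) / 2"
  have "\<alpha> > 0" using n by (simp add: \<alpha>_def)
  from gegenbauer_degree_coeff[OF this, of j] have d: "degree (gegenbauer \<alpha> j)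
      = j" "gegenbauer \<alpha> j \<noteq> 0"
    using le_degree[of "gegenbauer \<alpha> j" j] by auto
  define c where "c = real (dim (harmonic_forms j :: (real ^ 'n \<Rightarrow> real) set)) /
      (measure (area :: (real ^ 'n) measure) (sphere 0 1) * poly (gegenbauer \<alpha> j) 1)"
  have "c > 0" unfolding c_def
    using dim_harmonic_forms_pos[OF n, of j] area_sphere_pos[where 'n
        = 'n] gegenbauer_at_1_pos[OF \<open>\<alpha> > 0\<close>, of j]
    by simp
  moreover have "gegenbauer_norm TYPE('n) j = smult c (gegenbauer \<alpha> j)"
    by (simp add: gegenbauer_norm_def Let_def c_def \<alpha>_def)
  ultimately show "degree (gegenbauer_norm TYPE('n) j) = j" "gegenbauer_norm TYPE('n) j \<noteq> 0"
    using d by auto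
qed

text \<open>Justifies the \<open>THE\<close> in \<open>gegenbauer_coeff\<close>: with one polynomial
  of each degree, removing leading terms gives existence and comparing leading coefficients gives
  uniqueness.\<close>

lemma gegenbauer_coeff_expansion:
  fixes h :: "real poly"
  assumes n: "CARD('n::finite) \<ge> 3"
  shows "(\<forall>j>degree h. gegenbauer_coeff TYPE('n) h j = 0) \<and>
    h = (\<Sum>j\<le>degree h. smult (gegenbauer_coeff TYPE('n) h j) (gegenbauer_norm TYPE('n) j))"
proof -
  let ?g = "gegenbauer_norm TYPE('n)"
  have "\<exists>!l. (\<forall>j>degree h. l j = 0) \<and> h = (\<Sum>j\<le>degree h. smult (l j) (?g j))"
  proof (rule ex_ex1I)
    show "\<exists>l. (\<forall>j>degree h. l j = 0) \<and> h = (\<Sum>j\<le>degree h. smult (l j) (?g j))"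
      by (rule triangular_basis_expansion[OF gegenbauer_norm_degree[OF n] order_refl])
    fix l l' assume l: "(\<forall>j>degree h. l j = 0) \<and> h = (\<Sum>j\<le>degree h. smult (l j) (?g j))"
      and l': "(\<forall>j>degree h. l' j = 0) \<and> h = (\<Sum>j\<le>degree h. smult (l' j) (?g j))"
    have "(\<Sum>j\<le>degree h. smult (l j - l' j) (?g j)) = (\<Sum>j\<le>degree h. smult (l j) (?g j))
        - (\<Sum>j\<le>degree h. smult (l' j) (?g j))"
      by (simp add: smult_diff_left sum_subtractf)
    also have "\<dots> = 0" using conjunct2[OF l] conjunct2[OF l'] by simp
    finally have "j \<le> degree h \<Longrightarrow> l j - l' j = 0" for j
      by (rule triangular_basis_independent[OF gegenbauer_norm_degree[OF n]])
    then show "l = l'" using l l' by (metis eq_iff_diff_eq_0 ext not_le)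
  qed
  from theI'[OF this] show ?thesis unfolding gegenbauer_coeff_def .
qed

lemma poly_gegenbauer_expansion:
  fixes h :: "real poly"
  assumes n: "CARD('n::finite) \<ge> 3"
  shows "poly h t = (\<Sum>j\<le>degree h. gegenbauer_coeff TYPE('n) h j * poly (gegenbauer_norm TYPE('n) j) t)"
  using arg_cong[OF conjunct2[OF gegenbauer_coeff_expansion[OF n, of h]], of "\<lambda>q. poly q t"]
  by (simp add: poly_sum)

lemma sum_even_indices:
  fixes g :: "nat \<Rightarrow> 'a::comm_monoid_add"
  assumes "\<And>i. odd i \<Longrightarrow> g i = 0"
  shows "(\<Sum>i\<le>d. g i) = (\<Sum>j\<le>d div 2. g (2 * j))"
proof -
  have "(\<Sum>j\<le>d div 2. g (2 * j)) = sum g ((*) 2 ` {..d div 2})"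
    by (subst sum.reindex) (auto simp: inj_on_def)
  also have "\<dots> = (\<Sum>i\<le>d. g i)"
  proof (rule sum.mono_neutral_left)
    show "\<forall>i\<in>{..d} - (*) 2 ` {..d div 2}. g i = 0"
    proof
      fix i assume i: "i \<in> {..d} - (*) 2 ` {..d div 2}"
      have "odd i"
      proof
        assume "even i"
        then obtain j where "i = 2 * j" by blast
        then show False using i by auto
      qed
      then show "g i = 0" by (rule assms)
    qed
  qed auto
  finally show ?thesis by simp
qed

section \<open>The operator \<open>Gamma_hat\<close> and the dual generators in harmonic
  components\<close>

lemma zonal_sphere: "norm x = 1 \<Longrightarrow> zonal j y x = poly (gegenbauer_norm TYPE('n) j) (inner x y)"
  for x y :: "real ^ 'n"
  by (simp add: zonal_def)

text \<open>\<open>Gamma_hat\<close> drops the odd coefficients of \<open>h\<close>, but these would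
  only contribute integrals of odd forms. On the sphere it is therefore integration against the full
  kernel \<open>poly h (inner y x)\<close>, to which the Gegenbauer expansion of \<open>h\<close>
  applies.\<close>

lemma Gamma_hat_sphere:
  fixes x :: "real ^ 'n"
  assumes n: "CARD('n) \<ge> 2" and f: "f \<in> forms (2 * k)" and x: "norm x = 1"
  shows "Gamma_hat k h f x = (LINT y|area. poly h (inner y x) * f y)"
proof -
  define g where "g i = coeff h i * (LINT y|area. inner y x ^ i * f y)" for i
  have form: "(\<lambda>y. inner y x ^ i * f y) \<in> forms (i + 2 * k)" for i
    using forms_mult[OF forms_power[OF forms_inner[of x], of i] f] by simp
  have "g i = 0" if "odd i" for i
    using area_integral_odd_form[OF n form[of i]] that by (simp add: g_def)
  then have "(\<Sum>i\<le>degree h. g i) = (\<Sum>j\<le>degree h div 2. g (2 * j))"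
    by (rule sum_even_indices)
  also have "\<dots> = Gamma_hat k h f x"
    by (simp add: Gamma_hat_def g_def x inner_commute[of x])
  finally have "Gamma_hat k h f x = (\<Sum>i\<le>degree h. (LINT y|area. coeff h i * (inner y x ^ i * f y)))"
    by (simp add: g_def)
  also have "\<dots> = (LINT y|area. (\<Sum>i\<le>degree h. coeff h i * (inner y x ^ i * f y)))"
    by (rule Bochner_Integration.integral_sum[symmetric])
      (intro area_integrable continuous_intros forms_continuous[OF form] forms_continuous[OF f])
  also have "\<dots> = (LINT y|area. poly h (inner y x) * f y)"
    by (simp add: poly_altdef sum_distrib_right mult.assoc)
  finally show ?thesis .
qed

definition assemble :: "nat \<Rightarrow> (nat \<Rightarrow> real ^ 'n \<Rightarrow> real) \<Rightarrow>
    real ^ 'n \<Rightarrow> real"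
  where "assemble k F x = (\<Sum>j\<le>k. norm x ^ (2 * (k - j)) * F j x)"

lemma assemble_summand_forms:
  assumes "j \<le> k" "f \<in> harmonic_forms (2 * j)"
  shows "(\<lambda>x. norm x ^ (2 * (k - j)) * f x) \<in> forms (2 * k)"
  using forms_mult[OF forms_norm_power harmonic_formsD[OF assms(2)], of "k - j"] assms(1)
  by (simp add: distrib_left[symmetric])

lemma assemble_forms:
  assumes "\<And>j. j \<le> k \<Longrightarrow> F j \<in> harmonic_forms (2 * j)"
  shows "assemble k F \<in> forms (2 * k)"
  unfolding assemble_def[abs_def]
  by (intro forms_sum assemble_summand_forms assms) auto

lemma assemble_sphere: "norm x = 1 \<Longrightarrow> assemble k F x = (\<Sum>j\<le>k. F j x)"
  by (simp add: assemble_def)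

text \<open>Orthogonality between degrees leaves at most one component. The degree \<open>m\<close>
  is arbitrary because the expansion of \<open>h\<close> also contains odd degrees and degrees above
  \<open>2 * k\<close>, for which the sum is 0.\<close>

lemma sph_inner_zonal_assemble:
  fixes y :: "real ^ 'n"
  assumes n: "CARD('n) \<ge> 3" and F: "\<And>j. j \<le> k \<Longrightarrow> F j \<in> harmonic_forms (2 *
      j)" and y: "norm y = 1"
  shows "sph_inner (zonal m y) (assemble k F) = (\<Sum>j\<le>k. if m = 2 * j then F j y else 0)"
proof -
  have n2: "CARD('n) \<ge> 2" using n by simp
  note z = zonal_reproducing[OF n y]
  have "sph_inner (zonal m y) (assemble k F) = sph_inner (zonal m y) (\<lambda>x. \<Sum>j\<le>k. F j x)"
    by (rule sph_inner_cong) (simp add: assemble_sphere)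
  also have "\<dots> = (\<Sum>j\<le>k. sph_inner (zonal m y) (F j))"
    by (rule sph_inner_sum_right)
      (auto intro: forms_continuous[OF harmonic_formsD[OF F]] forms_continuous[OF harmonic_formsD[OF z(1)]])
  also have "\<dots> = (\<Sum>j\<le>k. if m = 2 * j then F j y else 0)"
    using z(2) F harmonic_orthogonal_neq[OF n2 z(1) F] by (intro sum.cong) auto
  finally show ?thesis .
qed

text \<open>The factor \<open>norm x ^ (2 * j)\<close> hidden in \<open>inner x y ^ (2 * j)\<close>
  compensates the possibly negative power of the norm; identities for \<open>Gamma_hat\<close> need
  checking only on the sphere and at 0.\<close>

lemma Gamma_hat_homogeneous:
  fixes x :: "real ^ 'n"
  assumes "x \<noteq> 0"
  shows "Gamma_hat k h f x = norm x ^ (2 * k) * Gamma_hat k h f (x /\<^sub>R norm x)"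
proof -
  have "norm x powi (2 * (int k - int j)) * (LINT y|area. inner x y ^ (2 * j) * f y)
     = norm x ^ (2 * k) * (LINT y|area. inner (x /\<^sub>R norm x) y ^ (2 * j) * f y)" for j
  proof -
    have "norm x * inner (x /\<^sub>R norm x) y = inner x y" for y using assms by simp
    then have "inner x y ^ (2 * j) = norm x ^ (2 * j) * inner (x /\<^sub>R norm x) y ^ (2 * j)" for y
      by (simp only: power_mult_distrib[symmetric])
    then have "(LINT y|area. inner x y ^ (2 * j) * f y)
      = norm x ^ (2 * j) * (LINT y|area. inner (x /\<^sub>R norm x) y ^ (2 * j) * f y)"
      by (simp only: mult.assoc integral_mult_right_zero)
    moreover have "norm x powi (2 * (int k - int j)) * norm x ^ (2 * j) = norm x ^ (2 * k)"
    proof -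
      have "norm x powi (2 * (int k - int j)) * norm x powi int (2 * j) = norm x powi int (2 * k)"
        using assms by (subst power_int_add[symmetric]) auto
      then show ?thesis by (simp only: power_int_of_nat)
    qed
    ultimately show ?thesis by (simp only: mult.assoc[symmetric])
  qed
  then show ?thesis using assms by (simp add: Gamma_hat_def sum_distrib_left mult_ac)
qed

lemma Gamma_hat_at_0: "k \<ge> 1 \<Longrightarrow> Gamma_hat k h f 0 = 0"
  unfolding Gamma_hat_def
proof (intro sum.neutral ballI)
  fix j assume k: "k \<ge> 1"
  show "coeff h (2 * j) * norm (0 :: real ^ 'a) powi (2 * (int k - int j))
      * (LINT y|area. inner (0 :: real ^ 'a) y ^ (2 * j) * f y) = 0"
    \<comment> \<open>For \<open>j = 0\<close> the inner product is raised to the power 0 and the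
      norm factor vanishes, as \<open>2 * k > 0\<close>; for \<open>j > 0\<close> the inner product
      vanishes, whatever the power of the norm.\<close>
    using k by (cases "j = 0") (auto simp: power_int_0_left_if)
qed

text \<open>A Funk-Hecke formula: the kernel \<open>poly h (inner y x)\<close> is a combination of
  zonal harmonics with pole \<open>x\<close>, and each of even degree at most \<open>2 * k\<close>
  reproduces one component of the form at \<open>x\<close>.\<close>

lemma Gamma_hat_assemble:
  fixes F :: "nat \<Rightarrow> real ^ 'n \<Rightarrow> real"
  assumes n: "CARD('n) \<ge> 3" and k: "k \<ge> 1"
    and F: "\<And>j. j \<le> k \<Longrightarrow> F j \<in> harmonic_forms (2 * j)"
  shows "Gamma_hat k h (assemble k F) = assemble k (\<lambda>j x. gegenbauer_coeff TYPE('n) h (2 * j) * F j x)"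
    (is "_ = assemble k ?G")
proof
  let ?l = "gegenbauer_coeff TYPE('n) h"
  have f: "assemble k F \<in> forms (2 * k)" by (rule assemble_forms[OF F])
  have G: "?G j \<in> harmonic_forms (2 * j)" if "j \<le> k" for j
    using subspace_scale[OF subspace_harmonic_forms F[OF that], of "?l (2 * j)"] by (simp add: scaleR_fun_def)
  have l0: "?l j = 0" if "j > degree h" for j
    using gegenbauer_coeff_expansion[OF n, of h] that by blast
  have sphere: "Gamma_hat k h (assemble k F) x = assemble k ?G x" if x: "norm x = 1" for x
  proof -
    have z: "continuous_on UNIV (zonal j x)" for j
      using forms_continuous[OF harmonic_formsD[OF zonal_reproducing(1)[OF n x]]] .
    have "Gamma_hat k h (assemble k F) x = sph_inner (\<lambda>y. poly h (inner y x)) (assemble k F)"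
      using n f x by (subst Gamma_hat_sphere) (auto simp: sph_inner_def)
    also have "\<dots> = sph_inner (\<lambda>y. \<Sum>j\<le>degree h. ?l j * zonal j x y) (assemble k F)"
      by (rule sph_inner_cong) (simp add: zonal_sphere poly_gegenbauer_expansion[OF n, of h])
    also have "\<dots> = (\<Sum>j\<le>degree h. ?l j * sph_inner (zonal j x) (assemble k F))"
      unfolding sph_inner_cmult_left[symmetric]
      by (rule sph_inner_sum_left) (intro continuous_intros z forms_continuous[OF f])+
    also have "\<dots> = (\<Sum>j\<le>degree h. \<Sum>i\<le>k. ?l j * (if j = 2 * i then F i x else 0))"
      by (simp only: sph_inner_zonal_assemble[OF n F x] sum_distrib_left)
    also have "\<dots> = (\<Sum>i\<le>k. \<Sum>j\<le>degree h. if j = 2 * i then ?l j * F i x else 0)"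
      by (subst sum.swap) (intro sum.cong refl, simp)
    \<comment> \<open>If \<open>2 * i\<close> exceeds the degree of \<open>h\<close> the inner sum
      is empty, in agreement with the convention that the coefficient is then 0.\<close>
    also have "\<dots> = (\<Sum>i\<le>k. ?l (2 * i) * F i x)"
      using l0 by (intro sum.cong) auto
    finally show ?thesis using x by (simp add: assemble_sphere)
  qed
  fix x :: "real ^ 'n"
  show "Gamma_hat k h (assemble k F) x = assemble k ?G x"
  proof (cases "x = 0")
    case True
    then show ?thesis using k forms_at_0[OF assemble_forms[OF G]] by (simp add: Gamma_hat_at_0)
  next
    case False
    have "Gamma_hat k h (assemble k F) x = norm x ^ (2 * k) * assemble k ?G (x /\<^sub>R norm x)"
      using sphere[of "x /\<^sub>R norm x"] False by (subst Gamma_hat_homogeneous[OF False]) simp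
    also have "\<dots> = assemble k ?G x"
      by (rule forms_normalize[OF assemble_forms[OF G] False, symmetric])
    finally show ?thesis .
  qed
qed

lemma dual_generator_assemble:
  fixes y :: "real ^ 'n"
  assumes n: "CARD('n) \<ge> 3" and F: "\<And>j. j \<le> k \<Longrightarrow> F j \<in> harmonic_forms (2 *
      j)" and y: "norm y = 1"
  shows "dual_generator k h y (assemble k F) = (\<Sum>j\<le>k. 1 / gegenbauer_coeff TYPE('n) h (2 * j) * F j y)"
proof -
  let ?l = "gegenbauer_coeff TYPE('n) h"
  have f: "assemble k F \<in> forms (2 * k)" by (rule assemble_forms[OF F])
  have z: "continuous_on UNIV (zonal j y)" for j
    using forms_continuous[OF harmonic_formsD[OF zonal_reproducing(1)[OF n y]]] .
  have "dual_generator k h y (assemble k F)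
      = sph_inner (\<lambda>x. \<Sum>j\<le>k. 1 / ?l (2 * j) * zonal (2 * j) y x) (assemble k F)"
    unfolding dual_generator_def using f by (simp, intro sph_inner_cong) simp
  also have "\<dots> = (\<Sum>j\<le>k. 1 / ?l (2 * j) * sph_inner (zonal (2 * j) y) (assemble k F))"
    unfolding sph_inner_cmult_left[symmetric]
    by (rule sph_inner_sum_left) (intro continuous_intros z forms_continuous[OF f])+
  also have "\<dots> = (\<Sum>j\<le>k. 1 / ?l (2 * j) * F j y)"
    by (intro sum.cong refl) (simp add: sph_inner_zonal_assemble[OF n F y])
  finally show ?thesis .
qed

lemma forms_eq_assemble:
  assumes "f \<in> forms (2 * k)"
  obtains F where "\<And>j. j \<le> k \<Longrightarrow> F j \<in> harmonic_forms (2 * j)" "f = assemble k F"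
  using harmonic_decomposition[OF assms] unfolding assemble_def[abs_def] by blast

lemma harmonic_forms_cmult: "f \<in> harmonic_forms d \<Longrightarrow> (\<lambda>x. c * f x) \<in>
    harmonic_forms d"
  using subspace_scale[OF subspace_harmonic_forms, of f d c] by (simp add: scaleR_fun_def)

text \<open>On the sphere the integrand is the even part of the kernel times \<open>f\<close>.
  Padded to a form of degree \<open>2 * (k + degree h)\<close>, it is integrated exactly by the
  cubature rule, and the resulting sum runs over points of \<open>X\<close>, where both factors are
  nonnegative.\<close>

lemma Gamma_hat_nonneg:
  fixes X :: "(real ^ 'n) set"
  assumes n: "CARD('n) \<ge> 3" and cub: "cubature (2 * (k + degree h)) X W"
    and nonneg: "\<And>u. u \<in> {-1..1} \<Longrightarrow> poly h u \<ge> 0"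
    and f: "f \<in> nonneg_forms_on (2 * k) X" and x: "norm x = 1"
  shows "Gamma_hat k h f x \<ge> 0"
proof -
  let ?d = "degree h"
  have f': "f \<in> forms (2 * k)" and fX: "\<And>y. y \<in> X \<Longrightarrow> f y \<ge> 0" using f
      by (auto simp: nonneg_forms_on_def)
  have X: "y \<in> X \<Longrightarrow> norm y = 1" "y \<in> X \<Longrightarrow> W y > 0" for y using cub
      by (auto simp: cubature_def)
  \<comment> \<open>The even part of \<open>h\<close>, nonnegative on the interval as the mean of
    \<open>poly h t\<close> and \<open>poly h (- t)\<close>. Its monomials have even degree, so even
    powers of the norm can bring them all to one degree.\<close>
  define e where "e t = (\<Sum>j\<le>?d div 2. coeff h (2 * j) * t ^ (2 * j))" for t
  have e_nonneg: "e t \<ge> 0" if t: "t \<in> {-1..1}" for t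
  proof -
    have "poly h t + poly h (- t) = (\<Sum>i\<le>?d. coeff h i * (t ^ i + (- t) ^ i))"
      by (simp add: poly_altdef sum.distrib distrib_left)
    also have "\<dots> = (\<Sum>j\<le>?d div 2. coeff h (2 * j) * (t ^ (2 * j) + (- t) ^ (2 * j)))"
      by (rule sum_even_indices) simp
    also have "\<dots> = 2 * e t" by (simp add: e_def sum_distrib_left mult.left_commute)
    finally show ?thesis using nonneg[of t] nonneg[of "- t"] t by simp
  qed
  \<comment> \<open>Each summand has degree \<open>2 * j + 2 * (degree h - j) + 2 * k\<close>; the
    subtraction is not truncated because \<open>j \<le> degree h div 2\<close>.\<close>
  define G where "G y = (\<Sum>j\<le>?d div 2. coeff h (2 * j) * (inner y x ^ (2 * j) * (norm y ^ (2 * (?d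
      - j)) * f y)))" for y
  have "(\<lambda>y. inner y x ^ (2 * j) * (norm y ^ (2 * (?d - j)) * f y)) \<in> forms (2 * (k + ?d))"
      if "j \<le> ?d div 2" for j
  proof -
    have eq: "2 * j * 1 + (2 * (?d - j) + 2 * k) = 2 * (k + ?d)" using that by simp
    show ?thesis
      using forms_mult[OF forms_power[OF forms_inner[of x], of "2 * j"]
          forms_mult[OF forms_norm_power[of "?d - j"] f']] unfolding eq .
  qed
  then have G: "G \<in> forms (2 * (k + ?d))"
    unfolding G_def[abs_def] by (intro forms_sum forms_cmult) auto
  have form: "(\<lambda>y. inner y x ^ i * f y) \<in> forms (i + 2 * k)" for i
    using forms_mult[OF forms_power[OF forms_inner[of x], of i] f'] by simp
  have Gs: "G y = e (inner y x) * f y" if "norm y = 1" for y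
    using that by (simp add: G_def e_def sum_distrib_right mult.assoc)
  have "Gamma_hat k h f x = (\<Sum>j\<le>?d div 2. coeff h (2 * j) * (LINT y|area. inner y x ^ (2 * j) * f y))"
    by (simp add: Gamma_hat_def x inner_commute[of x])
  also have "\<dots> = (\<Sum>j\<le>?d div 2. (LINT y|area. coeff h (2 * j) * (inner y x ^ (2 * j) * f y)))"
    by simp
  also have "\<dots> = (LINT y|area. (\<Sum>j\<le>?d div 2. coeff h (2 * j) * (inner y x ^ (2 * j) * f y)))"
    by (rule Bochner_Integration.integral_sum[symmetric])
      (intro area_integrable continuous_intros forms_continuous[OF form] forms_continuous[OF f'])
  also have "\<dots> = (LINT y|area. G y)"
    by (rule Bochner_Integration.integral_cong) (auto simp: G_def space_area)
  also have "\<dots> = (\<Sum>y\<in>X. W y * G y)" using cub G by (simp add: cubature_def)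
  also have "\<dots> \<ge> 0"
  proof (rule sum_nonneg)
    fix y assume y: "y \<in> X"
    have "\<bar>inner y x\<bar> \<le> 1" using Cauchy_Schwarz_ineq2[of y x] X(1)[OF y] x by simp
    then have "e (inner y x) \<ge> 0" by (intro e_nonneg) auto
    then show "W y * G y \<ge> 0" using Gs[OF X(1)[OF y]] fX[OF y] X(2)[OF y] by simp
  qed
  finally show ?thesis .
qed

subsection \<open>Finitely generated cones of functionals\<close>

lemma dual_space_lincomb:
  assumes "l \<in> dual_space d" "f \<in> forms d" "g \<in> forms d"
  shows "l (\<lambda>x. a * f x + b * g x) = a * l f + b * l g"
proof -
  have "(\<lambda>x. a * f x + b * g x) = a *\<^sub>R f + b *\<^sub>R g" by
      (simp add: fun_eq_iff scaleR_fun_def)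
  moreover have "a *\<^sub>R f \<in> forms d" "b *\<^sub>R g \<in> forms d"
    using assms subspace_scale[OF subspace_forms] by blast+
  ultimately show ?thesis using assms by (simp add: dual_space_def)
qed

lemma dual_space_cmult: "l \<in> dual_space d \<Longrightarrow> f \<in> forms d
    \<Longrightarrow> l (\<lambda>x. a * f x) = a * l f"
  using dual_space_lincomb[of l d f f a 0] by simp

lemma dual_space_sum:
  assumes l: "l \<in> dual_space d" and f: "\<And>a. a \<in> A \<Longrightarrow> f a \<in> forms d"
  shows "l (\<lambda>x. \<Sum>a\<in>A. c a * f a x) = (\<Sum>a\<in>A. c a * l (f a))"
proof -
  have zero: "l (\<lambda>_. 0) = 0" using dual_space_cmult[OF l forms_zero, of 0] by simp
  show ?thesis using f
  proof (induction A rule: infinite_finite_induct)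
    case (insert a A)
    have "l (\<lambda>x. c a * f a x + 1 * (\<Sum>a\<in>A. c a * f a x)) = c a * l (f a)
        + 1 * l (\<lambda>x. \<Sum>a\<in>A. c a * f a x)"
      by (rule dual_space_lincomb[OF l]) (use insert.prems in \<open>auto intro!: forms_sum forms_cmult\<close>)
    then show ?case using insert by simp
  qed (simp_all add: zero)
qed

lemma subspace_dual_space: "subspace (dual_space d)"
  by (rule subspaceI) (auto simp: dual_space_def scaleR_fun_def algebra_simps)

lemma dual_space_eq_0:
  assumes l: "l \<in> dual_space d" and B: "B \<subseteq> forms d" "forms d \<subseteq> span B"
    and 0: "\<And>b. b \<in> B \<Longrightarrow> l b = 0"
  shows "l = 0"
proof
  fix f
  have sub: "subspace {f \<in> forms d. l f = 0}"
  proof (rule subspaceI)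
    show "0 \<in> {f \<in> forms d. l f = 0}"
      using dual_space_cmult[OF l forms_zero, of 0] by (simp add: zero_fun_def)
  qed (use l in \<open>auto simp: dual_space_def intro: subspace_add subspace_scale subspace_forms\<close>)
  have "span B \<subseteq> {f \<in> forms d. l f = 0}"
    using B(1) 0 by (intro span_minimal sub) auto
  then show "l f = 0 f" using B(2) l by (cases "f \<in> forms d") (auto simp: dual_space_def)
qed

lemma convex_cone_dual_cone: "convex_cone (dual_cone d C)"
  unfolding convex_cone_iff dual_cone_def
  using subspace_0[OF subspace_dual_space] subspace_add[OF subspace_dual_space]
    subspace_scale[OF subspace_dual_space]
  by (auto simp: scaleR_fun_def)

text \<open>Isolates the coefficient \<open>t\<close> of the new generator, the variable to be
  eliminated below.\<close>

lemma convex_cone_hull_insert_eq: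
  "convex_cone hull (insert v S) = {x + t *\<^sub>R v | x t. x \<in> convex_cone hull S \<and> t \<ge> 0}"
    (is "?L = ?R")
proof
  note cc = convex_cone_iff[THEN iffD1, OF convex_cone_convex_cone_hull[of S]]
  show "?L \<subseteq> ?R"
  proof (rule hull_minimal)
    show "insert v S \<subseteq> ?R"
    proof
      fix w assume "w \<in> insert v S"
      then consider "w = v" | "w \<in> S" by blast
      then show "w \<in> ?R"
      proof cases
        case 1
        then show ?thesis using cc by (intro CollectI exI[of _ 0] exI[of _ 1]) auto
      next
        case 2
        then show ?thesis using hull_inc[of w S convex_cone]
          by (intro CollectI exI[of _ w] exI[of _ 0]) auto
      qed
    qed
    have "0 \<in> ?R" using cc by (intro CollectI exI[of _ 0]) auto
    moreover have "c *\<^sub>R a \<in> ?R" if "a \<in> ?R" "c \<ge> 0" for a c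
    proof -
      obtain x t where a: "a = x + t *\<^sub>R v" "x \<in> convex_cone hull S" "t \<ge> 0"
        using \<open>a \<in> ?R\<close> by blast
      then show ?thesis
        using cc \<open>c \<ge> 0\<close>
        by (intro CollectI exI[of _ "c *\<^sub>R x"] exI[of _ "c * t"]) (auto simp: scaleR_right_distrib)
    qed
    moreover have "a + b \<in> ?R" if ab: "a \<in> ?R" "b \<in> ?R" for a b
    proof -
      obtain x t where a: "a = x + t *\<^sub>R v" "x \<in> convex_cone hull S" "t \<ge> 0"
        using ab(1) by blast
      obtain y s where b: "b = y + s *\<^sub>R v" "y \<in> convex_cone hull S" "s \<ge> 0"
        using ab(2) by blast
      show ?thesis
        using a b cc by (intro CollectI exI[of _ "x + y"] exI[of _ "t + s"]) (auto simp: scaleR_left_distrib)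
    qed
    ultimately show "convex_cone ?R" unfolding convex_cone_iff by blast
  qed
  show "?R \<subseteq> ?L"
  proof
    fix w assume "w \<in> ?R"
    then obtain x t where w: "w = x + t *\<^sub>R v" "x \<in> convex_cone hull S" "t \<ge> 0" by blast
    have "x \<in> ?L" using w(2) hull_mono[of S "insert v S" convex_cone] by blast
    moreover have "v \<in> ?L" by (rule hull_inc) simp
    ultimately show "w \<in> ?L" unfolding w(1)
      by (intro convex_cone_hull_add convex_cone_hull_mul w(3))
  qed
qed

text \<open>Fourier--Motzkin elimination of the coefficient of the last generator. The half-spaces are kept
  in the form of evaluations at elements of \<open>forms d\<close>, so that the lemma also serves as Farkas' lemma.\<close>

lemma finitely_generated_cone_eq_halfspaces:
  assumes "finite S" "S \<subseteq> dual_space d"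
  shows "\<exists>F. finite F \<and> F \<subseteq> forms d \<and> convex_cone hull S
      = {l \<in> dual_space d. \<forall>f\<in>F. l f \<ge> 0}"
  using assms
proof (induction S)
  case empty
  obtain B :: "(real ^ 'a \<Rightarrow> real) set" where B: "finite B" "B \<subseteq> forms d" "forms d
      \<subseteq> span B"
    using forms_finite_span by blast
  \<comment> \<open>Using a spanning set with both signs cuts out the zero functional by
    inequalities alone.\<close>
  let ?N = "(\<lambda>f x. - 1 * f x)"
  have "{l \<in> dual_space d. \<forall>f\<in>B \<union> ?N ` B. l f \<ge> 0} = {0}"
  proof (rule antisym)
    show "{l \<in> dual_space d. \<forall>f\<in>B \<union> ?N ` B. l f \<ge> 0} \<subseteq> {0}"
    proof
      fix l assume l: "l \<in> {l \<in> dual_space d. \<forall>f\<in>B \<union> ?N ` B. l f \<ge> 0}"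
      have "l b = 0" if b: "b \<in> B" for b
      proof -
        have "l b \<ge> 0" "l (?N b) \<ge> 0" using l b by blast+
        moreover have "l (?N b) = - 1 * l b"
          using l b B(2) by (intro dual_space_cmult[of l d]) auto
        ultimately show ?thesis by simp
      qed
      then show "l \<in> {0}" using dual_space_eq_0[OF _ B(2,3)] l by blast
    qed
    show "{0} \<subseteq> {l \<in> dual_space d. \<forall>f\<in>B \<union> ?N ` B. l f \<ge> 0}"
      using subspace_0[OF subspace_dual_space] by auto
  qed
  moreover have "convex_cone hull {} = ({0} :: ((real ^ 'a \<Rightarrow> real) \<Rightarrow> real) set)"
    using hull_minimal[of "{}" "{0 :: (real ^ 'a \<Rightarrow> real) \<Rightarrow> real}" convex_cone]
      convex_cone_hull_contains_0 by blast
  moreover have "?N ` B \<subseteq> forms d" using forms_cmult B(2) by blast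
  ultimately show ?case using B(1,2)
    by (intro exI[of _ "B \<union> ?N ` B"]) auto
next
  case (insert v S)
  then obtain F where F: "finite F" "F \<subseteq> forms d"
    "convex_cone hull S = {l \<in> dual_space d. \<forall>f\<in>F. l f \<ge> 0}" by auto
  have v: "v \<in> dual_space d" using insert.prems by simp
  define F0 where "F0 = {f \<in> F. v f \<ge> 0}"
  define Fp where "Fp = {f \<in> F. v f > 0}"
  define Fn where "Fn = {g \<in> F. v g < 0}"
  \<comment> \<open>\<open>comb (f, g)\<close> is the combination of \<open>f\<close> and
    \<open>g\<close> with positive coefficients on which \<open>v\<close> vanishes; adding a
    multiple of \<open>v\<close> to a functional does not change its value there.\<close>
  define comb where "comb = (\<lambda>(f, g) x. v f * g x + (- v g) * f x)"
  have fin: "finite Fp" "finite Fn" "finite F0" using F(1) by (auto simp: Fp_def Fn_def F0_def)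
  have comb_forms: "comb p \<in> forms d" if "p \<in> Fp \<times> Fn" for p
    using that F(2) by (auto simp: comb_def Fp_def Fn_def intro!: forms_add forms_diff forms_cmult)
  have comb_eval: "l (comb (f, g)) = v f * l g - v g * l f"
    if "l \<in> dual_space d" "f \<in> F" "g \<in> F" for l f g
    using dual_space_lincomb[OF that(1), of g f "v f" "- v g"] that F(2) by (auto simp: comb_def)
  have "convex_cone hull (insert v S) = {l \<in> dual_space d. \<forall>f\<in>F0 \<union> comb ` (Fp
      \<times> Fn). l f \<ge> 0}"
    (is "_ = ?K")
  proof (rule antisym; rule subsetI)
    fix w assume "w \<in> convex_cone hull (insert v S)"
    then obtain l t where w: "w = l + t *\<^sub>R v" "l \<in> convex_cone hull S" "t \<ge> 0"
      unfolding convex_cone_hull_insert_eq by blast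
    have l: "l \<in> dual_space d" and lF: "\<And>f. f \<in> F \<Longrightarrow> l f \<ge> 0"
        using w(2) F(3) by auto
    have wd: "w \<in> dual_space d" unfolding w(1)
      by (intro subspace_add subspace_scale subspace_dual_space l v)
    have w_eval: "w f = l f + t * v f" for f by (simp add: w(1) scaleR_fun_def)
    have "w f \<ge> 0" if "f \<in> F0" for f
      using that lF[of f] w(3) by (simp add: w_eval F0_def)
    moreover have "w (comb (f, g)) \<ge> 0" if "f \<in> Fp" "g \<in> Fn" for f g
    proof -
      have fg: "f \<in> F" "g \<in> F" "v f > 0" "v g < 0" using that by (auto simp: Fp_def Fn_def)
      have "w (comb (f, g)) = v f * w g - v g * w f" by (rule comb_eval[OF wd fg(1,2)])
      also have "\<dots> = v f * l g + (- v g) * l f"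
        unfolding w_eval by (simp add: algebra_simps)
      also have "\<dots> \<ge> 0" using fg lF by (intro add_nonneg_nonneg mult_nonneg_nonneg) auto
      finally show ?thesis .
    qed
    ultimately show "w \<in> ?K" using wd by auto
  next
    fix w assume w: "w \<in> ?K"
    then have wd: "w \<in> dual_space d" by simp
    \<comment> \<open>Nonnegativity of \<open>w - t *\<^sub>R v\<close> on \<open>Fn\<close> means
      that \<open>t\<close> is at least each \<open>w g / v g\<close>, and on \<open>Fp\<close> that
      \<open>t\<close> is at most each \<open>w f / v f\<close>. The inequalities for
      \<open>comb\<close> and \<open>F0\<close> place every element of \<open>T\<close> below every
      upper bound, so the largest element of \<open>T\<close> will do.\<close>
    define T where "T = insert 0 ((\<lambda>g. w g / v g) ` Fn)"
    define t where "t = Max T"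
    have T: "finite T" "T \<noteq> {}" using fin by (auto simp: T_def)
    have t0: "t \<ge> 0" unfolding t_def by (rule Max_ge[OF T(1)]) (simp add: T_def)
    define l where "l = w - t *\<^sub>R v"
    have l_eval: "l f = w f - t * v f" for f by (simp add: l_def scaleR_fun_def)
    have ld: "l \<in> dual_space d" unfolding l_def
      by (intro subspace_diff subspace_scale subspace_dual_space wd v)
    have "l f \<ge> 0" if f: "f \<in> F" for f
    proof -
      consider "v f = 0" | "v f < 0" | "v f > 0" by linarith
      then show ?thesis
      proof cases
        case 1
        then show ?thesis using f w by (simp add: l_eval F0_def)
      next
        case 2
        then have "w f / v f \<le> t" unfolding t_def
          using f by (intro Max_ge[OF T(1)]) (auto simp: T_def Fn_def)
        then show ?thesis using 2 by (simp add: l_eval divide_le_eq mult.commute)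
      next
        case 3
        have "s \<le> w f / v f" if "s \<in> T" for s
        proof -
          from that consider "s = 0" | g where "g \<in> Fn" "s = w g / v g" by (auto simp: T_def)
          then show ?thesis
          proof cases
            case 1
            have "w f \<ge> 0" using w f 3 by (auto simp: F0_def)
            then show ?thesis using 1 3 by simp
          next
            case 2
            have g: "g \<in> F" "v g < 0" using 2 by (auto simp: Fn_def)
            have "w (comb (f, g)) \<ge> 0" using w f 3 2 by (auto simp: Fp_def)
            then have "v f * w g - v g * w f \<ge> 0" using comb_eval[OF wd f g(1)] by simp
            then show ?thesis unfolding 2(2) using 3 g(2) by (simp add: divide_simps mult.commute)
          qed
        qed
        then have "t \<le> w f / v f" unfolding t_def using Max_in[OF T] by blast
        then show ?thesis using 3 by (simp add: l_eval le_divide_eq)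
      qed
    qed
    then have "l \<in> convex_cone hull S" using F(3) ld by simp
    moreover have "w = l + t *\<^sub>R v" by (simp add: l_def)
    ultimately show "w \<in> convex_cone hull (insert v S)"
      unfolding convex_cone_hull_insert_eq using t0 by blast
  qed
  moreover have "F0 \<union> comb ` (Fp \<times> Fn) \<subseteq> forms d" using comb_forms F(2)
      by (auto simp: F0_def)
  moreover have "finite (F0 \<union> comb ` (Fp \<times> Fn))" using fin by simp
  ultimately show ?case by blast
qed

lemma polyhedral_cone_in_dual_space:
  assumes "finite F"
  shows "polyhedral_cone_in (dual_space d) {l \<in> dual_space d. \<forall>f\<in>F. l f \<ge> 0}"
  unfolding polyhedral_cone_in_def
proof (intro exI[of _ "(\<lambda>f l. (l f :: real)) ` F"] conjI ballI)
  fix \<phi> assume "\<phi> \<in> (\<lambda>f l. (l f :: real)) ` F"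
  then obtain f where "\<phi> = (\<lambda>l. (l f :: real))" by blast
  then show "linear \<phi>" by (auto intro!: linearI simp: scaleR_fun_def)
qed (use assms in auto)

section \<open>Inner cones, their duals and the limit\<close>

lemma dual_generator_in_dual_space:
  fixes y :: "real ^ 'n"
  assumes n: "CARD('n) \<ge> 3" and y: "norm y = 1"
  shows "dual_generator k h y \<in> dual_space (2 * k)"
proof -
  define z where "z x = (\<Sum>j\<le>k. 1 / gegenbauer_coeff TYPE('n) h (2 * j)
      * norm x ^ (2 * (k - j)) * zonal (2 * j) y x)" for x
  have z: "continuous_on UNIV z"
    unfolding z_def[abs_def]
    by (intro continuous_intros forms_continuous[OF harmonic_formsD[OF zonal_reproducing(1)[OF n y]]])
  have d: "dual_generator k h y f = (if f \<in> forms (2 * k) then sph_inner z f else 0)" for f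
    by (simp add: dual_generator_def z_def[abs_def])
  show ?thesis unfolding dual_space_def
  proof (intro CollectI conjI ballI allI impI)
    fix f g :: "real ^ 'n \<Rightarrow> real" assume f: "f \<in> forms (2 * k)"
    fix c :: real
    have "c *\<^sub>R f \<in> forms (2 * k)" using f by (intro subspace_scale subspace_forms)
    then show "dual_generator k h y (c *\<^sub>R f) = c * dual_generator k h y f"
      using f by (simp add: d scaleR_fun_def sph_inner_cmult_right)
    assume g: "g \<in> forms (2 * k)"
    have "f + g \<in> forms (2 * k)" using f g by (intro subspace_add subspace_forms)
    then show "dual_generator k h y (f + g) = dual_generator k h y f + dual_generator k h y g"
      using f g sph_inner_add_right[OF forms_continuous[OF f] forms_continuous[OF g] z]
      by (simp add: d plus_fun_def)
  qed (simp add: d)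
qed

lemma inner_cone_eq:
  fixes X :: "(real ^ 'n) set"
  assumes n: "CARD('n) \<ge> 3" and k: "k \<ge> 1" and X: "X \<subseteq> sphere 0 1"
    and nz: "\<And>j. j \<le> k \<Longrightarrow> gegenbauer_coeff TYPE('n) h (2 * j) \<noteq> 0"
  shows "inner_cone k h X = {g \<in> forms (2 * k). \<forall>y\<in>X. dual_generator k h y g \<ge> 0}"
proof (rule antisym; rule subsetI)
  let ?l = "gegenbauer_coeff TYPE('n) h"
  have X': "norm y = 1" if "y \<in> X" for y using X that by auto
  {
    fix g assume "g \<in> inner_cone k h X"
    then obtain f where f: "f \<in> forms (2 * k)" "\<And>y. y \<in> X \<Longrightarrow> f y \<ge> 0"
        and g: "g = Gamma_hat k h f"
      by (auto simp: inner_cone_def nonneg_forms_on_def)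
    obtain F where F: "\<And>j. j \<le> k \<Longrightarrow> F j \<in> harmonic_forms (2 * j)" "f = assemble k F"
      using forms_eq_assemble[OF f(1)] by blast
    have g': "g = assemble k (\<lambda>j x. ?l (2 * j) * F j x)"
      unfolding g F(2) by (rule Gamma_hat_assemble[OF n k F(1)])
    have "g \<in> forms (2 * k)" unfolding g' by (intro assemble_forms harmonic_forms_cmult F(1))
    moreover have "dual_generator k h y g \<ge> 0" if y: "y \<in> X" for y
    proof -
      have "dual_generator k h y g = (\<Sum>j\<le>k. 1 / ?l (2 * j) * (?l (2 * j) * F j y))"
        unfolding g' by (intro dual_generator_assemble n X' y harmonic_forms_cmult F(1))
      also have "\<dots> = f y" using X'[OF y] nz by (simp add: F(2) assemble_sphere)
      finally show ?thesis using f(2)[OF y] by simp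
    qed
    ultimately show "g \<in> {g \<in> forms (2 * k). \<forall>y\<in>X. dual_generator k h y g \<ge> 0}" by blast
  next
    fix g assume g: "g \<in> {g \<in> forms (2 * k). \<forall>y\<in>X. dual_generator k h y g \<ge> 0}"
    then obtain F where F: "\<And>j. j \<le> k \<Longrightarrow> F j \<in> harmonic_forms (2 * j)" "g
        = assemble k F"
      using forms_eq_assemble by blast
    \<comment> \<open>The components of a preimage of \<open>g\<close> under
      \<open>Gamma_hat\<close>; division is legitimate by \<open>nz\<close>, and at a point
      \<open>y\<close> of \<open>X\<close> the assembled form takes the value of the generator on
      \<open>g\<close>.\<close>
    define F' where "F' j x = 1 / ?l (2 * j) * F j x" for j x
    have F': "F' j \<in> harmonic_forms (2 * j)" if "j \<le> k" for j
      unfolding F'_def[abs_def] by (intro harmonic_forms_cmult F(1) that)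
    have "Gamma_hat k h (assemble k F') = assemble k (\<lambda>j x. ?l (2 * j) * F' j x)"
      by (rule Gamma_hat_assemble[OF n k F'])
    also have "\<dots> = g" using nz by (simp add: F(2) assemble_def[abs_def] F'_def)
    finally have 1: "g = Gamma_hat k h (assemble k F')" ..
    have "assemble k F' y \<ge> 0" if y: "y \<in> X" for y
    proof -
      have "assemble k F' y = dual_generator k h y g"
        unfolding F(2) using dual_generator_assemble[OF n F(1) X'[OF y], where k = k and h = h] X'[OF y]
        by (simp add: assemble_sphere F'_def)
      then show ?thesis using g y by simp
    qed
    then have "assemble k F' \<in> nonneg_forms_on (2 * k) X"
      using assemble_forms[OF F'] by (simp add: nonneg_forms_on_def)
    then show "g \<in> inner_cone k h X" unfolding inner_cone_def using 1 by blast
  }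
qed

text \<open>The bounding half-spaces of the generated cone are given by forms \<open>F\<close>. The
  generators lie in the cone, so they are nonnegative on \<open>F\<close>, which places
  \<open>F\<close> in the inner cone. A functional nonnegative on the inner cone thus satisfies all
  bounding inequalities.\<close>

lemma outer_dual_cone_properties:
  fixes X :: "(real ^ 'n) set"
  assumes n: "CARD('n) \<ge> 3" and k: "k \<ge> 1" and X: "finite X" "X \<subseteq> sphere 0 1"
    and nz: "\<And>j. j \<le> k \<Longrightarrow> gegenbauer_coeff TYPE('n) h (2 * j) \<noteq> 0"
  shows "polyhedral_cone_in (dual_space (2 * k)) (outer_dual_cone k h X)"
    and "outer_dual_cone k h X = dual_cone (2 * k) (inner_cone k h X)"
proof -
  let ?G = "dual_generator k h ` X"
  have G: "?G \<subseteq> dual_space (2 * k)"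
    using X(2) dual_generator_in_dual_space[OF n] by auto
  obtain F where F: "finite F" "F \<subseteq> forms (2 * k)"
    "convex_cone hull ?G = {l \<in> dual_space (2 * k). \<forall>f\<in>F. l f \<ge> 0}"
    using finitely_generated_cone_eq_halfspaces[OF finite_imageI[OF X(1)] G] by blast
  show "polyhedral_cone_in (dual_space (2 * k)) (outer_dual_cone k h X)"
    unfolding outer_dual_cone_def F(3) by (rule polyhedral_cone_in_dual_space[OF F(1)])
  have A: "inner_cone k h X = {g \<in> forms (2 * k). \<forall>y\<in>X. dual_generator k h y g \<ge> 0}"
    by (rule inner_cone_eq[OF n k X(2) nz])
  show "outer_dual_cone k h X = dual_cone (2 * k) (inner_cone k h X)"
  proof
    show "outer_dual_cone k h X \<subseteq> dual_cone (2 * k) (inner_cone k h X)"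
      unfolding outer_dual_cone_def
      using G A by (intro hull_minimal convex_cone_dual_cone) (auto simp: dual_cone_def)
    have "F \<subseteq> inner_cone k h X"
    proof
      fix f assume f: "f \<in> F"
      have "dual_generator k h y f \<ge> 0" if "y \<in> X" for y
      proof -
        have "dual_generator k h y \<in> convex_cone hull ?G" using that by (intro hull_inc) simp
        then show ?thesis unfolding F(3) using f by blast
      qed
      then show "f \<in> inner_cone k h X" using A F(2) f by blast
    qed
    then show "dual_cone (2 * k) (inner_cone k h X) \<subseteq> outer_dual_cone k h X"
      unfolding outer_dual_cone_def F(3) by (auto simp: dual_cone_def)
  qed
qed

lemma inner_cone_subset_nonneg:
  fixes X :: "(real ^ 'n) set"
  assumes n: "CARD('n) \<ge> 3" and k: "k \<ge> 1" and cub: "cubature (2 * (k + degree h)) X W"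
    and nonneg: "\<And>u. u \<in> {-1..1} \<Longrightarrow> poly h u \<ge> 0"
  shows "inner_cone k h X \<subseteq> nonneg_forms_on (2 * k) (sphere 0 1)"
proof
  fix g assume "g \<in> inner_cone k h X"
  then obtain f where f: "f \<in> nonneg_forms_on (2 * k) X" and g: "g = Gamma_hat k h f"
    by (auto simp: inner_cone_def)
  obtain F where F: "\<And>j. j \<le> k \<Longrightarrow> F j \<in> harmonic_forms (2 * j)" "f = assemble k F"
    using forms_eq_assemble[of f k] f unfolding nonneg_forms_on_def by blast
  have "g \<in> forms (2 * k)"
    by (simp only: g F(2) Gamma_hat_assemble[OF n k F(1)])
      (intro assemble_forms harmonic_forms_cmult F(1))
  moreover have "g x \<ge> 0" if "x \<in> sphere 0 1" for x
    unfolding g using that by (intro Gamma_hat_nonneg[OF n cub nonneg f]) auto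
  ultimately show "g \<in> nonneg_forms_on (2 * k) (sphere 0 1)" by (simp add: nonneg_forms_on_def)
qed

text \<open>The harmonic spaces are nonzero, so each squared deviation enters the threshold with
  weight at least 1.\<close>

lemma inverse_coeff_deviation_le_threshold:
  assumes n: "CARD('n::finite) \<ge> 3" and j: "j \<le> k"
  shows "\<bar>1 / gegenbauer_coeff TYPE('n) h (2 * j) - 1\<bar> \<le> frobenius_threshold TYPE('n) k h"
proof -
  let ?d = "\<lambda>j. real (dim (harmonic_forms (2 * j) :: (real ^ 'n \<Rightarrow> real) set))"
  let ?e = "\<lambda>j. 1 / gegenbauer_coeff TYPE('n) h (2 * j) - 1"
  have "1 \<le> ?d j" using dim_harmonic_forms_pos[OF n, of "2 * j"] by linarith
  then have "(?e j)\<^sup>2 \<le> ?d j * (?e j)\<^sup>2" using mult_right_mono[of 1 "?d j" "(?e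
      j)\<^sup>2"] by simp
  also have "\<dots> \<le> (\<Sum>j\<le>k. ?d j * (?e j)\<^sup>2)"
    using j by (intro member_le_sum) auto
  finally have "sqrt ((?e j)\<^sup>2) \<le> frobenius_threshold TYPE('n) k h"
    unfolding frobenius_threshold_def by (rule real_sqrt_le_mono)
  then show ?thesis by simp
qed

text \<open>A form nonnegative on the sphere is nonnegative on each \<open>X s\<close>, so its image
  under \<open>Gamma_hat\<close> lies in the inner cone. Applied to that image, \<open>l\<close> is
  a fixed finite combination of the coefficients, and convergence of these real numbers suffices for
  the limit.\<close>

lemma Inter_dual_cones_subset:
  fixes X :: "nat \<Rightarrow> (real ^ 'n) set" and h :: "nat \<Rightarrow> real poly"
  assumes n: "CARD('n) \<ge> 3" and k: "k \<ge> 1" and X: "\<And>s. X s \<subseteq> sphere 0 1"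
    and nz: "\<And>s j. j \<le> k \<Longrightarrow> gegenbauer_coeff TYPE('n) (h s) (2 * j) \<noteq> 0"
    and lim: "(\<lambda>s. frobenius_threshold TYPE('n) k (h s)) \<longlonglongrightarrow> 0"
  shows "(\<Inter>s. dual_cone (2 * k) (inner_cone k (h s) (X s)))
    \<subseteq> dual_cone (2 * k) (nonneg_forms_on (2 * k) (sphere 0 1))"
proof
  let ?l = "\<lambda>s j. gegenbauer_coeff TYPE('n) (h s) (2 * j)"
  fix l assume l: "l \<in> (\<Inter>s. dual_cone (2 * k) (inner_cone k (h s) (X s)))"
  then have ld: "l \<in> dual_space (2 * k)" by (auto simp: dual_cone_def)
  have coeff_lim: "(\<lambda>s. ?l s j) \<longlonglongrightarrow> 1" if j: "j \<le> k" for j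
  proof -
    have "(\<lambda>s. 1 / ?l s j - 1) \<longlonglongrightarrow> 0"
      by (rule Lim_null_comparison[OF _ lim])
        (use inverse_coeff_deviation_le_threshold[OF n j] in auto)
    then have "(\<lambda>s. (1 / ?l s j - 1) + 1) \<longlonglongrightarrow> 0 + 1"
        by (intro tendsto_add tendsto_const)
    \<comment> \<open>The threshold measures the reciprocals of the coefficients, while
      \<open>Gamma_hat\<close> multiplies by the coefficients themselves.\<close>
    then have "(\<lambda>s. inverse (1 / ?l s j)) \<longlonglongrightarrow> inverse 1"
        by (intro tendsto_inverse) auto
    then show ?thesis by simp
  qed
  have "l f \<ge> 0" if f: "f \<in> nonneg_forms_on (2 * k) (sphere 0 1)" for f
  proof -
    have f': "f \<in> forms (2 * k)" using f by (simp add: nonneg_forms_on_def)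
    obtain F where F: "\<And>j. j \<le> k \<Longrightarrow> F j \<in> harmonic_forms (2 * j)" "f = assemble k F"
      using forms_eq_assemble[OF f'] by blast
    define u where "u j x = norm x ^ (2 * (k - j)) * F j x" for j x
    have u: "u j \<in> forms (2 * k)" if "j \<in> {..k}" for j
      unfolding u_def[abs_def] using that by (intro assemble_summand_forms F(1)) auto
    have eval: "l (Gamma_hat k (h s) f) = (\<Sum>j\<le>k. ?l s j * l (u j))" for s
    proof -
      have "Gamma_hat k (h s) f = (\<lambda>x. \<Sum>j\<le>k. ?l s j * u j x)"
        by (simp only: F(2) Gamma_hat_assemble[OF n k F(1)])
          (simp add: assemble_def[abs_def] u_def mult.left_commute)
      moreover have "l (\<lambda>x. \<Sum>j\<le>k. ?l s j * u j x) = (\<Sum>j\<le>k. ?l s j * l (u j))"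
        by (rule dual_space_sum[OF ld u])
      ultimately show ?thesis by simp
    qed
    have "Gamma_hat k (h s) f \<in> inner_cone k (h s) (X s)" for s
      using f X[of s] by (auto simp: inner_cone_def nonneg_forms_on_def)
    then have "l (Gamma_hat k (h s) f) \<ge> 0" for s using l by (auto simp: dual_cone_def)
    then have nonneg: "(\<Sum>j\<le>k. ?l s j * l (u j)) \<ge> 0" for s unfolding eval .
    have "(\<lambda>s. \<Sum>j\<le>k. ?l s j * l (u j)) \<longlonglongrightarrow> (\<Sum>j\<le>k. 1 * l (u j))"
      by (intro tendsto_sum tendsto_mult tendsto_const coeff_lim) auto
    then have "(\<Sum>j\<le>k. 1 * l (u j)) \<ge> 0"
      by (rule LIMSEQ_le_const) (use nonneg in blast)
    moreover have "l (\<lambda>x. \<Sum>j\<le>k. 1 * u j x) = (\<Sum>j\<le>k. 1 * l (u j))"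
      by (rule dual_space_sum[OF ld u])
    then have "l f = (\<Sum>j\<le>k. 1 * l (u j))"
      by (simp add: F(2) assemble_def[abs_def] u_def[abs_def])
    ultimately show ?thesis by simp
  qed
  then show "l \<in> dual_cone (2 * k) (nonneg_forms_on (2 * k) (sphere 0 1))"
    using ld by (simp add: dual_cone_def)
qed

text \<open>The assumption \<open>nonzero\<close> gives the reciprocals in the generators and in the
  threshold their intended meaning; division by 0 would silently yield 0.\<close>

theorem theorem1p7:
  fixes X :: "nat \<Rightarrow> (real ^ 'n) set"
    and W :: "nat \<Rightarrow> (real ^ 'n) \<Rightarrow> real"
    and h :: "nat \<Rightarrow> real poly"
    and k :: nat
  assumes n: "CARD('n) \<ge> 3"
    and k: "k \<ge> 1"
    and cub: "\<And>t. cubature (2 * t) (X (2 * t)) (W (2 * t))"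
    and nonneg: "\<And>s u. u \<in> {-1..1} \<Longrightarrow> poly (h s) u \<ge> 0"
    and nonzero: "\<And>s j. j \<le> k \<Longrightarrow> gegenbauer_coeff TYPE('n) (h s) (2 * j) \<noteq> 0"
  defines "P \<equiv> nonneg_forms_on (2 * k) (sphere 0 1)"
    and "A \<equiv> \<lambda>s. inner_cone k (h s) (X (2 * (k + degree (h s))))"
    and "A' \<equiv> \<lambda>s. outer_dual_cone k (h s) (X (2 * (k + degree (h s))))"
  shows "(\<forall>s. polyhedral_cone_in (dual_space (2 * k)) (A' s)
              \<and> A' s \<subseteq> dual_space (2 * k)
              \<and> dual_cone (2 * k) P \<subseteq> A' s
              \<and> A' s = dual_cone (2 * k) (A s))
       \<and> ((\<lambda>s. frobenius_threshold TYPE('n) k (h s)) \<longlonglongrightarrow> 0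
            \<longrightarrow> (\<Inter>s. A' s) = dual_cone (2 * k) P)"
proof -
  let ?X = "\<lambda>s. X (2 * (k + degree (h s)))"
  have X: "finite (?X s)" "?X s \<subseteq> sphere 0 1" for s
    using cub[of "k + degree (h s)"] by (auto simp: cubature_def)
  have poly: "polyhedral_cone_in (dual_space (2 * k)) (A' s)"
    and dual: "A' s = dual_cone (2 * k) (A s)" for s
    using outer_dual_cone_properties[where h = "h s", OF n k X[of s] nonzero] unfolding A'_def A_def by auto
  \<comment> \<open>Dualising reverses this inclusion, so an inner approximation of \<open>P\<close>
    becomes an outer approximation of its dual.\<close>
  have "A s \<subseteq> P" for s
    unfolding A_def P_def by (rule inner_cone_subset_nonneg[OF n k cub nonneg])
  then have P: "dual_cone (2 * k) P \<subseteq> A' s" for s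
    unfolding dual by (auto simp: dual_cone_def)
  have "(\<Inter>s. A' s) \<subseteq> dual_cone (2 * k) P"
    if "(\<lambda>s. frobenius_threshold TYPE('n) k (h s)) \<longlonglongrightarrow> 0"
    unfolding dual unfolding A_def P_def
    by (rule Inter_dual_cones_subset[OF n k X(2) nonzero that])
  moreover have "A' s \<subseteq> dual_space (2 * k)" for s unfolding dual by (auto simp: dual_cone_def)
  ultimately show ?thesis using poly dual P by blast
qed

end
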